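(* A plane triangulation is $h$-perfect if and only if it is perfect.
   Context: All graphs are finite, simple and undirected. A plane triangulation is a graph embedded in the plane in which every face (including the outer face) is bounded by a triangle. A graph $G$ is perfect if for every induced subgraph $H$ of $G$ the chromatic number of $H$ equals its clique number. A graph $G$ is $h$-perfect if the polytope in $\mathbb{R}^{V(G)}$ defined by the inequalities $x_v\ge 0$ for every $v\in V(G)$, $\sum_{v\in K}x_v\le 1$ for every clique $K$ of $G$, and $\sum_{v\in V(C)}x_v\le (|V(C)|-1)/2$ for every induced odd cycle $C$ of $G$, is integral (i.e. all its vertices have integer coordinates). *)

theory Defs
  imports "HOL-Analysis.Analysis" "HOL-Library.Ramsey"
begin

text \<open>
  A graph is a vertex set \<open>V\<close> with a set \<open>E\<close> of two-element vertex sets; \<open>[V]\<^bsup>2\<^esup>\<close> (the two-element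
  subsets of \<open>V\<close>) and \<open>clique\<close> come from \<^theory>\<open>HOL-Library.Ramsey\<close>.
\<close>

definition simple_graph :: "'v set \<Rightarrow> 'v set set \<Rightarrow> bool" where
  "simple_graph V E \<longleftrightarrow> finite V \<and> E \<subseteq> [V]\<^bsup>2\<^esup>"

definition induced_edges :: "'v set \<Rightarrow> 'v set set \<Rightarrow> 'v set set" where
  "induced_edges W E = {e \<in> E. e \<subseteq> W}"


subsection \<open>Perfect graphs\<close>

definition proper_coloring :: "'v set \<Rightarrow> 'v set set \<Rightarrow> nat \<Rightarrow> ('v \<Rightarrow> nat) \<Rightarrow> bool" where
  "proper_coloring V E k c \<longleftrightarrow>
     (\<forall>v\<in>V. c v < k) \<and> (\<forall>u\<in>V. \<forall>v\<in>V. {u, v} \<in> E \<longrightarrow> c u \<noteq> c v)"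

definition chromatic_number :: "'v set \<Rightarrow> 'v set set \<Rightarrow> nat" where
  "chromatic_number V E = (LEAST k. \<exists>c. proper_coloring V E k c)"

definition clique_number :: "'v set \<Rightarrow> 'v set set \<Rightarrow> nat" where
  "clique_number V E = Max (card ` {K. K \<subseteq> V \<and> clique K E})"

definition perfect :: "'v set \<Rightarrow> 'v set set \<Rightarrow> bool" where
  "perfect V E \<longleftrightarrow>
     (\<forall>W\<subseteq>V. chromatic_number W (induced_edges W E) = clique_number W (induced_edges W E))"


subsection \<open>h-perfect graphs\<close>

text \<open>A cycle is given by the cyclic list of its vertices.\<close>

definition cycle_edges :: "'v list \<Rightarrow> 'v set set" where
  "cycle_edges vs = (\<lambda>i. {vs ! i, vs ! (Suc i mod length vs)}) ` {..<length vs}"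

definition induced_cycle :: "'v set \<Rightarrow> 'v set set \<Rightarrow> 'v list \<Rightarrow> bool" where
  "induced_cycle V E vs \<longleftrightarrow>
     3 \<le> length vs \<and> distinct vs \<and> set vs \<subseteq> V \<and> induced_edges (set vs) E = cycle_edges vs"

text \<open>
  The space \<open>\<real>\<^sup>V\<close> is taken to be the coordinate subspace of \<^typ>\<open>real ^ 'v\<close> of the vectors that vanish
  outside \<open>V\<close>. For \<open>V = UNIV\<close> it is the whole space.
\<close>

definition h_polytope :: "'v::finite set \<Rightarrow> 'v set set \<Rightarrow> (real ^ 'v) set" where
  "h_polytope V E =
     {x. (\<forall>v. v \<notin> V \<longrightarrow> x $ v = 0)
       \<and> (\<forall>v\<in>V. 0 \<le> x $ v)
       \<and> (\<forall>K. K \<subseteq> V \<and> clique K E \<longrightarrow> (\<Sum>v\<in>K. x $ v) \<le> 1)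
       \<and> (\<forall>vs. induced_cycle V E vs \<and> odd (length vs) \<longrightarrow>
             (\<Sum>v\<in>set vs. x $ v) \<le> (real (length vs) - 1) / 2)}"

definition integral_polytope :: "(real ^ 'v::finite) set \<Rightarrow> bool" where
  "integral_polytope P \<longleftrightarrow> (\<forall>x. x extreme_point_of P \<longrightarrow> (\<forall>v. x $ v \<in> \<int>))"

definition h_perfect :: "'v::finite set \<Rightarrow> 'v set set \<Rightarrow> bool" where
  "h_perfect V E \<longleftrightarrow> integral_polytope (h_polytope V E)"


subsection \<open>Plane triangulations\<close>

text \<open>
  The plane is \<^typ>\<open>complex\<close>. An embedding places the vertex \<open>v\<close> at the point \<open>p v\<close> and draws the edge
  \<open>e\<close> as the arc \<open>\<gamma> e\<close>.
\<close>

definition plane_embedding ::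
  "'v set \<Rightarrow> 'v set set \<Rightarrow> ('v \<Rightarrow> complex) \<Rightarrow> ('v set \<Rightarrow> real \<Rightarrow> complex) \<Rightarrow> bool" where
  "plane_embedding V E p \<gamma> \<longleftrightarrow>
     inj_on p V
     \<and> (\<forall>e\<in>E. arc (\<gamma> e)
          \<and> {pathstart (\<gamma> e), pathfinish (\<gamma> e)} = p ` e
          \<and> path_image (\<gamma> e) \<inter> p ` V = p ` e)
     \<and> (\<forall>e\<in>E. \<forall>f\<in>E. e \<noteq> f \<longrightarrow> path_image (\<gamma> e) \<inter> path_image (\<gamma> f) = p ` (e \<inter> f))"

definition faces ::
  "'v set \<Rightarrow> 'v set set \<Rightarrow> ('v \<Rightarrow> complex) \<Rightarrow> ('v set \<Rightarrow> real \<Rightarrow> complex) \<Rightarrow> complex set set" where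
  "faces V E p \<gamma> = components (- (p ` V \<union> (\<Union>e\<in>E. path_image (\<gamma> e))))"

definition plane_triangulation ::
  "'v set \<Rightarrow> 'v set set \<Rightarrow> ('v \<Rightarrow> complex) \<Rightarrow> ('v set \<Rightarrow> real \<Rightarrow> complex) \<Rightarrow> bool" where
  "plane_triangulation V E p \<gamma> \<longleftrightarrow>
     simple_graph V E \<and> plane_embedding V E p \<gamma>
     \<and> (\<forall>F \<in> faces V E p \<gamma>. \<exists>T \<in> [V]\<^bsup>3\<^esup>. clique T E \<and>
          frontier F = (\<Union>e\<in>[T]\<^bsup>2\<^esup>. path_image (\<gamma> e)))"

end

theory Submission
  imports Defs "HOL-Complex_Analysis.Winding_Numbers"
begin

text \<open>
  Perfection implies h-perfection without planarity: replicating vertices covers every integral weight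
  function by as many stable sets as the largest weight of a clique, so each point of the polytope is a
  limit of averages of stable sets.

  Conversely, without induced odd cycles of length at least five, constant vectors on an induced
  subgraph satisfy the constraints of the polytope, and a stable set meeting all maximum cliques can be
  split off as a colour class. It remains to exclude these cycles. Take one, \<open>C\<close>, whose closed interior
  contains as few vertices as possible. It is then the only odd cycle constraint of length at least
  five on vectors supported in its closed interior. The faces inside \<open>C\<close> at a vertex \<open>c\<close> of \<open>C\<close> contain
  an induced path, the fan of \<open>c\<close>, joining the two cycle neighbours of \<open>c\<close> in the link of \<open>c\<close>.
  Integrality shows that no interior vertex is adjacent to three consecutive vertices of \<open>C\<close>. If \<open>c\<close> is
  clean, that is, not adjacent to a hub (an interior vertex with two nonadjacent neighbours on \<open>C\<close>), then
  replacing \<open>c\<close> by its fan gives another induced cycle, so the fan has an even number of vertices; doing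
  this for two nonadjacent clean vertices at once shows that their fans touch. By the Jordan curve theorem
  this excludes hubs. Finally the vector \<open>1/3\<close> on \<open>C\<close> and its fans satisfies all constraints, because these
  vertices span no \<open>K\<^sub>4\<close>. It yields a stable set meeting each triangle of each fan once, hence each three
  consecutive vertices of \<open>C\<close> once. So \<open>C\<close> has length at least nine, and among the touching pairs of fans
  two have to cross.
\<close>

subsection \<open>Stable sets from h-perfection\<close>

text \<open>Integrality enters only through \<open>h_perfect_stable_set\<close>: a point of the
  polytope that is positive at w is a convex combination of stable sets, one of them contains w, and
  every clique or cycle constraint tight at the point is tight for that set. So each use consists in
  choosing a vector with the right tight constraints. The obstacle is that such a vector has to
  respect all odd holes at once; the minimal choice of C removes it, since a vector supported in the
  closed interior of C meets the constraint of C alone. The value 1/3 makes every triangle tight,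
  which is why K4 must be kept out of the fans. Along an even fan of c the stable set alternates if
  it avoids c, so it contains exactly one of the two cycle neighbours of c. Counting then makes |C|
  a multiple of 3. An odd multiple of 3 that is at least 5 is at least 9, which leaves room for the
  positions 0, 2, 4, 6: pairwise nonadjacent, with the pairs 0, 4 and 2, 6 interleaved around
  C.\<close>

definition ind_vec :: "'v::finite set \<Rightarrow> real ^ 'v" where
  "ind_vec S = (\<chi> v. if v \<in> S then 1 else 0)"

lemma edge_neq: "simple_graph V E \<Longrightarrow> {u, v} \<in> E \<Longrightarrow> u \<noteq> v \<and> u \<in> V \<and> v \<in> V"
  unfolding simple_graph_def using doubleton_in_nsets_2[of u v V] by blast

text \<open>Entry 0 contributes nothing positive, and the other 2k entries form the k consecutive
  pairs (1,2), (3,4) and so on.\<close>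

lemma alternate_sum_le:
  fixes f :: "nat \<Rightarrow> real"
  assumes "f 0 \<le> 0" and "\<And>i. Suc i < 2 * k + 1 \<Longrightarrow> f i + f (Suc i) \<le> 1"
  shows "sum f {..<2 * k + 1} \<le> k"
  using assms(2)
proof (induction k)
  case 0
  then show ?case using assms(1) by simp
next
  case (Suc k)
  have "sum f {..<2 * Suc k + 1} = sum f {..<2 * k + 1} + (f (2*k+1) + f (Suc (2*k+1)))"
    by (simp add: algebra_simps)
  moreover have "sum f {..<2 * k + 1} \<le> k" using Suc by auto
  moreover have "f (2*k+1) + f (Suc (2*k+1)) \<le> 1" using Suc.prems[of "2*k+1"] by auto
  ultimately show ?case by simp
qed

lemma sum_set_nth:
  fixes x :: "'v \<Rightarrow> real"
  assumes "distinct vs"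
  shows "sum x (set vs) = (\<Sum>i<length vs. x (vs ! i))"
  by (rule sum.reindex_bij_betw[OF bij_betw_nth[OF assms], of _ _ x, symmetric]) auto

lemma cycle_edges_rotate:
  assumes "length vs \<ge> 1"
  shows "cycle_edges (rotate m vs) = cycle_edges vs"
proof -
  let ?n = "length vs"
  have n: "?n > 0" using assms by linarith
  have "cycle_edges (rotate m vs) =
    (\<lambda>i. {vs ! ((m + i) mod ?n), vs ! (Suc (m + i) mod ?n)}) ` {..<?n}"
    unfolding cycle_edges_def
  proof (rule image_cong)
    show "{..<length (rotate m vs)} = {..<?n}" by simp
    fix i assume "i \<in> {..<?n}"
    then have i: "i < ?n" by simp
    have "Suc i mod ?n < ?n" using n by simp
    then have "rotate m vs ! (Suc i mod ?n) = vs ! ((m + Suc i mod ?n) mod ?n)" by (rule nth_rotate)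
    moreover have "rotate m vs ! i = vs ! ((m + i) mod ?n)" using i by (rule nth_rotate)
    ultimately show "{rotate m vs ! i, rotate m vs ! (Suc i mod length (rotate m vs))}
        = {vs ! ((m + i) mod ?n), vs ! (Suc (m + i) mod ?n)}"
      by (simp add: mod_add_right_eq)
  qed
  also have "\<dots> = (\<lambda>i. {vs ! i, vs ! (Suc i mod ?n)}) ` ((\<lambda>i. (m + i) mod ?n) ` {..<?n})"
    by (simp add: image_image mod_Suc_eq)
  also have "(\<lambda>i. (m + i) mod ?n) ` {..<?n} = {..<?n}"
  proof
    show "(\<lambda>i. (m + i) mod ?n) ` {..<?n} \<subseteq> {..<?n}" using n by auto
    show "{..<?n} \<subseteq> (\<lambda>i. (m + i) mod ?n) ` {..<?n}"
    proof
      fix j assume "j \<in> {..<?n}"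
      then have j: "j < ?n" by simp
      \<comment> \<open>\<open>i\<close> is \<open>j\<close> shifted back by \<open>m\<close>; the
        summand \<open>?n - m mod ?n\<close> avoids a truncated subtraction.\<close>
      define i where "i = (j + (?n - m mod ?n)) mod ?n"
      have "(m + i) mod ?n = (m mod ?n + (j + (?n - m mod ?n))) mod ?n"
        unfolding i_def by (simp add: mod_add_left_eq mod_add_right_eq)
      also have "\<dots> = (j + ?n) mod ?n"
      proof -
        have "m mod ?n + (j + (?n - m mod ?n)) = j + ?n" using n mod_le_divisor[of ?n m] by linarith
        then show ?thesis by simp
      qed
      also have "\<dots> = j" using j by simp
      finally have "(m + i) mod ?n = j" .
      moreover have "i < ?n" using n i_def by simp
      ultimately show "j \<in> (\<lambda>i. (m + i) mod ?n) ` {..<?n}" by (metis image_eqI lessThan_iff)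
    qed
  qed
  finally show ?thesis unfolding cycle_edges_def .
qed

lemma induced_cycle_rotate:
  assumes "induced_cycle V E vs" shows "induced_cycle V E (rotate m vs)"
  using assms cycle_edges_rotate[of vs m] unfolding induced_cycle_def by auto

lemma induced_cycle_edge:
  assumes "induced_cycle V E vs" "i < length vs"
  shows "{vs ! i, vs ! (Suc i mod length vs)} \<in> E"
proof -
  have "{vs ! i, vs ! (Suc i mod length vs)} \<in> cycle_edges vs"
    using assms(2) unfolding cycle_edges_def by auto
  then show ?thesis using assms(1) unfolding induced_cycle_def induced_edges_def by auto
qed

text \<open>Rotate z to the front: deleting it leaves a path with an even number of vertices, which
  edges of the cycle pair off. Hence, given the edge constraints, an odd cycle constraint matters
  only for cycles contained in the support of the vector.\<close>

lemma odd_cycle_sum_le: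
  fixes x :: "'v \<Rightarrow> real"
  assumes c: "induced_cycle V E vs" and o: "odd (length vs)"
    and e: "\<And>u v. {u, v} \<in> E \<Longrightarrow> x u + x v \<le> 1"
    and z: "z \<in> set vs" "x z \<le> 0"
  shows "sum x (set vs) \<le> (real (length vs) - 1) / 2"
proof -
  obtain m where m: "m < length vs" "vs ! m = z" using z(1) by (auto simp: in_set_conv_nth)
  let ?ws = "rotate m vs"
  have c': "induced_cycle V E ?ws" using c by (rule induced_cycle_rotate)
  obtain k where k: "length vs = 2 * k + 1" using o by (rule oddE)
  have d: "distinct ?ws" using c' unfolding induced_cycle_def by auto
  have "sum x (set vs) = sum x (set ?ws)" by simp
  also have "\<dots> = (\<Sum>i<2*k+1. x (?ws ! i))" using sum_set_nth[OF d, of x] k by simp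
  also have "\<dots> \<le> k"
  proof (rule alternate_sum_le)
    show "x (?ws ! 0) \<le> 0"
      using m z(2) by (subst nth_rotate) auto
    fix i assume i: "Suc i < 2 * k + 1"
    show "x (?ws ! i) + x (?ws ! Suc i) \<le> 1"
      using induced_cycle_edge[OF c', of i] i k e by simp
  qed
  finally show ?thesis using k by simp
qed

text \<open>The previous lemma for the indicator function of S; it has a zero on the cycle because
  the first two vertices are adjacent.\<close>

lemma indep_odd_cycle:
  assumes c: "induced_cycle V E vs" and o: "odd (length vs)" and S: "indep S E"
    and g: "simple_graph V E"
  shows "2 * card (S \<inter> set vs) + 1 \<le> length vs"
proof -
  let ?x = "\<lambda>v. if v \<in> S then 1 else 0 :: real"
  have e: "?x u + ?x v \<le> 1" if "{u, v} \<in> E" for u v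
    using S that edge_neq[OF g that] unfolding indep_def by auto
  have n: "3 \<le> length vs" using c unfolding induced_cycle_def by auto
  have "\<not> (vs ! 0 \<in> S \<and> vs ! 1 \<in> S)"
    using induced_cycle_edge[OF c, of 0] n e[of "vs ! 0" "vs ! 1"] by fastforce
  moreover have "vs ! 0 \<in> set vs" "vs ! 1 \<in> set vs" using n by (auto intro!: nth_mem)
  ultimately obtain z where z: "z \<in> set vs" "?x z \<le> 0" by auto
  have "real (card (S \<inter> set vs)) = sum ?x (set vs)"
    by (simp add: sum.If_cases Int_commute)
  also have "\<dots> \<le> (real (length vs) - 1) / 2"
    by (rule odd_cycle_sum_le[where x = ?x, OF c o e z])
  finally have "real (2 * card (S \<inter> set vs) + 1) \<le> real (length vs)" by simp
  then show ?thesis by (simp only: of_nat_le_iff)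
qed

lemma clique_pair: "{u, v} \<in> E \<Longrightarrow> clique {u, v} E"
  unfolding clique_def by (auto simp: insert_commute)

lemma ind_vec_in_h_polytope:
  fixes V :: "'v::finite set"
  assumes g: "simple_graph V E" and S: "S \<subseteq> V" "indep S E"
  shows "ind_vec S \<in> h_polytope V E"
proof -
  have "(\<Sum>v\<in>K. ind_vec S $ v) \<le> 1" if "clique K E" for K
  proof -
    have "card (K \<inter> S) \<le> 1"
      using that S(2) unfolding clique_def indep_def One_nat_def
      by (subst card_le_Suc0_iff_eq) auto
    then show ?thesis by (simp add: ind_vec_def sum.If_cases)
  qed
  moreover have "(\<Sum>v\<in>set vs. ind_vec S $ v) \<le> (real (length vs) - 1) / 2"
    if "induced_cycle V E vs \<and> odd (length vs)" for vs
  proof -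
    have "2 * card (S \<inter> set vs) + 1 \<le> length vs" using indep_odd_cycle that S g by blast
    then show ?thesis by (simp add: ind_vec_def sum.If_cases Int_commute)
  qed
  ultimately show ?thesis unfolding h_polytope_def using S(1) by (auto simp: ind_vec_def)
qed

text \<open>As an intersection of half-spaces and hyperplanes the polytope inherits convexity and
  closedness from single constraints.\<close>

lemma h_polytope_Inter:
  "h_polytope V E = (\<Inter>v\<in>-V. {x. x $ v = 0}) \<inter> (\<Inter>v\<in>V. {x. 0 \<le> x $ v})
    \<inter> (\<Inter>K\<in>{K. K \<subseteq> V \<and> clique K E}. {x. (\<Sum>v\<in>K. x $ v) \<le> 1})
    \<inter> (\<Inter>vs\<in>{vs. induced_cycle V E vs \<and> odd (length vs)}.
         {x. (\<Sum>v\<in>set vs. x $ v) \<le> (real (length vs) - 1) / 2})"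
  unfolding h_polytope_def by auto

lemma h_polytope_convex: "convex (h_polytope V E)"
proof -
  have "convex {x :: real ^ 'a. (\<Sum>v\<in>K. x $ v) \<le> b}" for K b
    unfolding convex_def
    by (auto simp: sum.distrib sum_distrib_left[symmetric] intro: convex_bound_le)
  moreover have "convex {x :: real ^ 'a. x $ v = 0}" "convex {x :: real ^ 'a. 0 \<le> x $ v}" for v
    unfolding convex_def by auto
  ultimately show ?thesis unfolding h_polytope_Inter by (intro convex_Int convex_INT)
qed

lemma h_polytope_outside: "x \<in> h_polytope V E \<Longrightarrow> v \<notin> V \<Longrightarrow> x $ v = 0"
  by (simp add: h_polytope_def)

lemma h_polytope_clique:
  "x \<in> h_polytope V E \<Longrightarrow> K \<subseteq> V \<Longrightarrow> clique K E \<Longrightarrow> (\<Sum>v\<in>K. x $ v) \<le> 1"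
  by (simp add: h_polytope_def)

lemma h_polytope_odd_cycle:
  "x \<in> h_polytope V E \<Longrightarrow> induced_cycle V E vs \<Longrightarrow> odd (length vs) \<Longrightarrow>
    (\<Sum>v\<in>set vs. x $ v) \<le> (real (length vs) - 1) / 2"
  unfolding h_polytope_def by blast

lemma h_polytope_le_1:
  assumes "x \<in> h_polytope V E" "v \<in> V" shows "0 \<le> x $ v" "x $ v \<le> 1"
proof -
  have "clique {v} E" by (simp add: clique_def)
  moreover have "{v} \<subseteq> V" using assms by simp
  ultimately have "(\<Sum>u\<in>{v}. x $ u) \<le> 1"
    using assms(1) unfolding h_polytope_def by blast
  then show "x $ v \<le> 1" by simp
  show "0 \<le> x $ v" using assms unfolding h_polytope_def by auto
qed

lemma h_polytope_compact: "compact (h_polytope V E)"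
proof -
  have "closed (h_polytope V E)" unfolding h_polytope_Inter
    by (intro closed_Int closed_INT ballI closed_Collect_le closed_Collect_eq continuous_intros)
  moreover have "bounded (h_polytope V E)"
  proof -
    have "norm x \<le> CARD('a)" if "x \<in> h_polytope V E" for x
    proof -
      have "\<bar>x $ v\<bar> \<le> 1" for v
        using h_polytope_le_1[OF that, of v] that unfolding h_polytope_def by (cases "v \<in> V") auto
      then have "(\<Sum>v\<in>UNIV. \<bar>x $ v\<bar>) \<le> (\<Sum>v\<in>(UNIV::'a set). 1)" by (intro sum_mono) auto
      then show ?thesis using norm_le_l1_cart[of x] by simp
    qed
    then show ?thesis unfolding bounded_iff by blast
  qed
  ultimately show ?thesis by (simp add: compact_eq_bounded_closed)
qed

text \<open>Singleton cliques bound every coordinate by 1, so an integral extreme point is a 0-1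
  vector, and the edge cliques make its support stable.\<close>

lemma h_perfect_extreme_stable:
  fixes V :: "'v::finite set"
  assumes h: "h_perfect V E" and y: "y extreme_point_of h_polytope V E"
  shows "\<exists>S\<subseteq>V. indep S E \<and> y = ind_vec S"
proof -
  define S where "S = {v. y $ v = 1}"
  have yP: "y \<in> h_polytope V E" using y by (simp add: extreme_point_of_def)
  have y1: "y $ v = 1" if "v \<in> S" for v using that unfolding S_def by (rule CollectD)
  have S1: "v \<in> S" if "y $ v = 1" for v using that unfolding S_def by (rule CollectI)
  have sub: "v \<in> V" if "v \<in> S" for v
  proof (rule ccontr)
    assume "v \<notin> V"
    then show False using h_polytope_outside[OF yP, of v] y1[OF that] by linarith
  qed
  have y01: "y $ v = 0" if "v \<notin> S" for v
  proof (cases "v \<in> V")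
    case True
    have "y $ v \<in> \<int>" using h y unfolding h_perfect_def integral_polytope_def by simp
    then obtain i where i: "y $ v = of_int i" by (rule Ints_cases)
    have "0 \<le> real_of_int i" "real_of_int i \<le> 1"
      using h_polytope_le_1[OF yP True] unfolding i .
    moreover have "i \<noteq> 1" using that S1[of v] i by auto
    ultimately have "i = 0" by linarith
    then show ?thesis using i by simp
  next
    case False
    then show ?thesis by (rule h_polytope_outside[OF yP])
  qed
  have "y = ind_vec S"
    unfolding vec_eq_iff ind_vec_def vec_lambda_beta using y1 y01 by metis
  moreover have "indep S E"
    unfolding indep_def
  proof (intro ballI impI notI)
    fix u v assume uv: "u \<in> S" "v \<in> S" "u \<noteq> v" "{u, v} \<in> E"
    have "{u, v} \<subseteq> V" using sub uv(1,2) by simp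
    then have "(\<Sum>w\<in>{u,v}. y $ w) \<le> 1"
      by (rule h_polytope_clique[OF yP _ clique_pair[OF uv(4)]])
    moreover have "(\<Sum>w\<in>{u,v}. y $ w) = y $ u + y $ v" using uv(3) by simp
    ultimately show False using y1[OF uv(1)] y1[OF uv(2)] by linarith
  qed
  ultimately show ?thesis using sub by blast
qed

text \<open>By Krein-Milman x is a convex combination of extreme points, that is, of stable sets. As
  x is positive at w, some stable set of positive weight contains w. At an inequality tight for x
  the nonnegative slacks average to 0, so the slack of this set vanishes. The inequalities are
  quantified inside the conclusion because one S has to serve all of them simultaneously.\<close>

lemma h_perfect_stable_set:
  fixes V :: "'v::finite set"
  assumes h: "h_perfect V E" and x: "x \<in> h_polytope V E"
    and w: "0 < x $ w"
  obtains S where "S \<subseteq> V" "indep S E" "w \<in> S"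
    "\<forall>A \<beta>. (\<forall>y\<in>h_polytope V E. (\<Sum>v\<in>A. y $ v) \<le> \<beta>) \<longrightarrow> (\<Sum>v\<in>A. x $ v) = \<beta>
        \<longrightarrow> real (card (S \<inter> A)) = \<beta>"
proof -
  let ?P = "h_polytope V E"
  let ?X = "{y. y extreme_point_of ?P}"
  have "?P = convex hull ?X"
    by (intro Krein_Milman_Minkowski h_polytope_compact h_polytope_convex)
  then have "x \<in> convex hull ?X" using x by auto
  then obtain T u where T: "finite T" "T \<subseteq> ?X" "\<And>y. y \<in> T \<Longrightarrow> 0 \<le> u y" "sum u T = 1"
      and xs: "(\<Sum>y\<in>T. u y *\<^sub>R y) = x"
    unfolding convex_hull_explicit by auto
  have TP: "y \<in> ?P" if "y \<in> T" for y using T(2) that by (auto simp: extreme_point_of_def)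
  have xc: "x $ v = (\<Sum>y\<in>T. u y * y $ v)" for v
    unfolding xs[symmetric] by simp
  have "\<exists>y\<in>T. u y * y $ w > 0"
  proof (rule ccontr)
    assume "\<not> ?thesis"
    then have "(\<Sum>y\<in>T. u y * y $ w) \<le> 0" by (intro sum_nonpos) (auto simp: not_less)
    then show False using w xc by simp
  qed
  then obtain y where y: "y \<in> T" "u y * y $ w > 0" by blast
  have "u y > 0" using y T(3)[of y] by (cases "u y = 0") (auto simp: less_le)
  obtain S where S: "S \<subseteq> V" "indep S E" "y = ind_vec S"
    using h_perfect_extreme_stable[OF h, of y] T(2) y(1) by auto
  show thesis
  proof (rule that[OF S(1,2)])
    show "w \<in> S" using y(2) S(3) by (auto simp: ind_vec_def split: if_splits)
    show "\<forall>A \<beta>. (\<forall>y\<in>?P. (\<Sum>v\<in>A. y $ v) \<le> \<beta>) \<longrightarrow> (\<Sum>v\<in>A. x $ v) = \<beta> \<longrightarrow> real (card (S \<inter> A)) = \<beta>"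
    proof (intro allI impI)
      fix A \<beta>
      assume le: "\<forall>y\<in>?P. (\<Sum>v\<in>A. y $ v) \<le> \<beta>" and eq: "(\<Sum>v\<in>A. x $ v) = \<beta>"
      \<comment> \<open>The slacks of the extreme points, averaged with the coefficients
        \<open>u\<close>, give the slack of \<open>x\<close>, which is 0.\<close>
      have "(\<Sum>z\<in>T. u z * (\<beta> - (\<Sum>v\<in>A. z $ v))) = (\<Sum>z\<in>T. u z) * \<beta> - (\<Sum>z\<in>T. u z * (\<Sum>v\<in>A. z $ v))"
        by (simp add: right_diff_distrib sum_subtractf sum_distrib_right)
      also have "(\<Sum>z\<in>T. u z * (\<Sum>v\<in>A. z $ v)) = (\<Sum>v\<in>A. x $ v)"
        unfolding xc sum_distrib_left by (rule sum.swap)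
      finally have "(\<Sum>z\<in>T. u z * (\<beta> - (\<Sum>v\<in>A. z $ v))) = 0" using eq T(4) by simp
      moreover have "\<forall>z\<in>T. 0 \<le> u z * (\<beta> - (\<Sum>v\<in>A. z $ v))"
        using T(3) TP le by (auto intro!: mult_nonneg_nonneg)
      ultimately have "u y * (\<beta> - (\<Sum>v\<in>A. y $ v)) = 0"
        using T(1) y(1) by (simp add: sum_nonneg_eq_0_iff)
      then have "(\<Sum>v\<in>A. y $ v) = \<beta>" using \<open>u y > 0\<close> by simp
      then show "real (card (S \<inter> A)) = \<beta>"
        using S(3) by (simp add: ind_vec_def sum.If_cases Int_commute)
    qed
  qed
qed

subsection \<open>Induced cycles and paths\<close>

definition ipath :: "'v set set \<Rightarrow> 'v list \<Rightarrow> bool" where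
  "ipath E xs \<longleftrightarrow> distinct xs \<and>
     (\<forall>i j. i < j \<longrightarrow> j < length xs \<longrightarrow> ({xs ! i, xs ! j} \<in> E \<longleftrightarrow> j = Suc i))"

lemma ipath_rev:
  assumes "ipath E xs" shows "ipath E (rev xs)"
  unfolding ipath_def
proof (intro conjI allI impI)
  show "distinct (rev xs)" using assms by (simp add: ipath_def)
  fix i j assume ij: "i < j" "j < length (rev xs)"
  let ?n = "length xs"
  have "{xs ! (?n - Suc j), xs ! (?n - Suc i)} \<in> E \<longleftrightarrow> ?n - Suc i = Suc (?n - Suc j)"
    using assms ij unfolding ipath_def by auto
  moreover have "?n - Suc i = Suc (?n - Suc j) \<longleftrightarrow> j = Suc i" using ij by auto
  ultimately show "{rev xs ! i, rev xs ! j} \<in> E \<longleftrightarrow> j = Suc i"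
    using ij by (simp add: rev_nth insert_commute)
qed

text \<open>Turns the equality of two edge sets into a test on index pairs i < j, where the pair of
  first and last index stands for the closing edge. Cycles are assembled and taken apart in this
  form.\<close>

lemma induced_cycle_iff:
  assumes g: "simple_graph V E"
  shows "induced_cycle V E vs \<longleftrightarrow> 3 \<le> length vs \<and> distinct vs \<and> set vs \<subseteq> V \<and>
    (\<forall>i j. i < j \<longrightarrow> j < length vs \<longrightarrow>
      ({vs ! i, vs ! j} \<in> E \<longleftrightarrow> j = Suc i \<or> (i = 0 \<and> Suc j = length vs)))"
proof -
  let ?n = "length vs"
  have *: "induced_edges (set vs) E = cycle_edges vs \<longleftrightarrow>
     (\<forall>i j. i < j \<longrightarrow> j < ?n \<longrightarrow>
      ({vs ! i, vs ! j} \<in> E \<longleftrightarrow> j = Suc i \<or> (i = 0 \<and> Suc j = ?n)))"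
    if n: "3 \<le> ?n" and d: "distinct vs"
  proof -
    have cyc: "{vs ! i, vs ! j} \<in> cycle_edges vs \<longleftrightarrow> j = Suc i \<or> (i = 0 \<and> Suc j = ?n)"
      if ij: "i < j" "j < ?n" for i j
    proof
      assume "{vs ! i, vs ! j} \<in> cycle_edges vs"
      then obtain l where l: "l < ?n" "{vs ! i, vs ! j} = {vs ! l, vs ! (Suc l mod ?n)}"
        unfolding cycle_edges_def by auto
      have m: "Suc l mod ?n < ?n" using n by (intro mod_less_divisor) auto
      then have "i = l \<and> j = Suc l mod ?n \<or> i = Suc l mod ?n \<and> j = l"
        using l ij d by (auto simp: doubleton_eq_iff nth_eq_iff_index_eq)
      moreover have "Suc l mod ?n = Suc l \<or> Suc l = ?n \<and> Suc l mod ?n = 0"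
        using l(1) by (cases "Suc l = ?n") auto
      ultimately show "j = Suc i \<or> (i = 0 \<and> Suc j = ?n)" using ij by auto
    next
      assume "j = Suc i \<or> (i = 0 \<and> Suc j = ?n)"
      then show "{vs ! i, vs ! j} \<in> cycle_edges vs"
      proof
        assume "j = Suc i"
        then show ?thesis using ij unfolding cycle_edges_def by (intro image_eqI[of _ _ i]) auto
      next
        assume "i = 0 \<and> Suc j = ?n"
        then show ?thesis using ij unfolding cycle_edges_def
          by (intro image_eqI[of _ _ j]) auto
      qed
    qed
    have ind: "{vs ! i, vs ! j} \<in> induced_edges (set vs) E \<longleftrightarrow> {vs ! i, vs ! j} \<in> E"
      if "i < j" "j < ?n" for i j
      using that unfolding induced_edges_def by auto
    show ?thesis
    proof
      assume "induced_edges (set vs) E = cycle_edges vs"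
      then show "\<forall>i j. i < j \<longrightarrow> j < ?n \<longrightarrow>
        ({vs ! i, vs ! j} \<in> E \<longleftrightarrow> j = Suc i \<or> (i = 0 \<and> Suc j = ?n))"
        using cyc ind by metis
    next
      assume a: "\<forall>i j. i < j \<longrightarrow> j < ?n \<longrightarrow>
        ({vs ! i, vs ! j} \<in> E \<longleftrightarrow> j = Suc i \<or> (i = 0 \<and> Suc j = ?n))"
      have pair: "\<exists>i j. i < j \<and> j < ?n \<and> e = {vs ! i, vs ! j}"
        if "e \<subseteq> set vs" "card e = 2" for e
      proof -
        obtain x y where xy: "e = {x, y}" "x \<noteq> y" using \<open>card e = 2\<close> by (auto simp: card_2_iff)
        have "x \<in> set vs" "y \<in> set vs" using xy that(1) by auto
        then obtain i j where ij: "i < ?n" "j < ?n" "x = vs ! i" "y = vs ! j"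
          by (metis in_set_conv_nth)
        then have "i \<noteq> j" using xy by auto
        then show ?thesis using ij xy by (metis insert_commute linorder_neqE_nat)
      qed
      show "induced_edges (set vs) E = cycle_edges vs"
      proof (rule set_eqI)
        fix e
        show "e \<in> induced_edges (set vs) E \<longleftrightarrow> e \<in> cycle_edges vs"
        proof (cases "e \<subseteq> set vs \<and> card e = 2")
          case True
          then obtain i j where "i < j" "j < ?n" "e = {vs ! i, vs ! j}" using pair by blast
          then show ?thesis using a cyc ind by metis
        next
          case False
          have "e \<notin> induced_edges (set vs) E"
            using False g unfolding induced_edges_def simple_graph_def nsets_def by auto
          moreover have "e \<notin> cycle_edges vs"
          proof
            assume "e \<in> cycle_edges vs"
            then obtain l where l: "l < ?n" "e = {vs ! l, vs ! (Suc l mod ?n)}"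
              unfolding cycle_edges_def by auto
            have m: "Suc l mod ?n < ?n" using n by (intro mod_less_divisor) auto
            have "Suc l mod ?n \<noteq> l"
              using l(1) n by (cases "Suc l = ?n") auto
            then have "vs ! l \<noteq> vs ! (Suc l mod ?n)"
              using d l(1) m by (simp add: nth_eq_iff_index_eq)
            then have "card e = 2" using l(2) by simp
            moreover have "e \<subseteq> set vs" using l m by auto
            ultimately show False using False by simp
          qed
          ultimately show ?thesis by simp
        qed
      qed
    qed
  qed
  show ?thesis
  proof (cases "3 \<le> ?n \<and> distinct vs")
    case True
    show ?thesis
      unfolding induced_cycle_def *[OF conjunct1[OF True] conjunct2[OF True]] by (rule refl)
  next
    case False
    then show ?thesis unfolding induced_cycle_def by argo
  qed
qed

lemma induced_cycleD:
  assumes g: "simple_graph V E" and c: "induced_cycle V E vs"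
  shows "3 \<le> length vs" "distinct vs" "set vs \<subseteq> V"
    and "\<And>i j. i < j \<Longrightarrow> j < length vs \<Longrightarrow>
      ({vs ! i, vs ! j} \<in> E \<longleftrightarrow> j = Suc i \<or> (i = 0 \<and> Suc j = length vs))"
  using c unfolding induced_cycle_iff[OF g] by simp_all

text \<open>Two disjoint induced paths whose only connections are the two junctions close up to a
  cycle. The bound on the total length rules out two single vertices, for which both junctions would
  be the same edge.\<close>

lemma induced_cycle_glue:
  assumes g: "simple_graph V E" and ws: "ipath E ws" "set ws \<subseteq> V" and rs: "ipath E rs" "set rs \<subseteq> V"
    and ne: "ws \<noteq> []" "rs \<noteq> []" "3 \<le> length ws + length rs" and dj: "set ws \<inter> set rs = {}"
    and A: "\<And>i j. i < length ws \<Longrightarrow> j < length rs \<Longrightarrow>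
      ({ws ! i, rs ! j} \<in> E \<longleftrightarrow> Suc i = length ws \<and> j = 0 \<or> i = 0 \<and> Suc j = length rs)"
  shows "induced_cycle V E (ws @ rs)"
  unfolding induced_cycle_iff[OF g]
proof (intro conjI allI impI)
  show "3 \<le> length (ws @ rs)" using ne by simp
  show "distinct (ws @ rs)" using ws rs dj by (simp add: ipath_def)
  show "set (ws @ rs) \<subseteq> V" using ws rs by simp
  fix i j assume ij: "i < j" "j < length (ws @ rs)"
  let ?m = "length ws"
  consider "j < ?m" | "i < ?m" "?m \<le> j" | "?m \<le> i" using ij by linarith
  then show "{(ws @ rs) ! i, (ws @ rs) ! j} \<in> E \<longleftrightarrow>
      j = Suc i \<or> i = 0 \<and> Suc j = length (ws @ rs)"
  proof cases
    case 1
    have "{ws ! i, ws ! j} \<in> E \<longleftrightarrow> j = Suc i" using ws(1) ij 1 unfolding ipath_def by blast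
    moreover have "Suc j \<noteq> length (ws @ rs)" using 1 ne by (cases rs) auto
    ultimately show ?thesis using ij 1 by (simp add: nth_append)
  next
    case 2
    then show ?thesis using A[of i "j - ?m"] ij by (auto simp: nth_append)
  next
    case 3
    have "{rs ! (i - ?m), rs ! (j - ?m)} \<in> E \<longleftrightarrow> j - ?m = Suc (i - ?m)"
      using rs(1) ij 3 unfolding ipath_def by auto
    then show ?thesis using 3 ij ne by (auto simp: nth_append)
  qed
qed

lemma induced_cycle_tl_ipath:
  assumes g: "simple_graph V E" and c: "induced_cycle V E (z # rs)"
  shows "ipath E rs" "set rs \<subseteq> V" "2 \<le> length rs" "z \<notin> set rs"
    and "\<And>j. j < length rs \<Longrightarrow> ({z, rs ! j} \<in> E \<longleftrightarrow> j = 0 \<or> Suc j = length rs)"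
proof -
  have n: "3 \<le> length (z # rs)" and d: "distinct (z # rs)" and s: "set (z # rs) \<subseteq> V"
    and A: "\<And>i j. i < j \<Longrightarrow> j < length (z # rs) \<Longrightarrow>
      ({(z # rs) ! i, (z # rs) ! j} \<in> E \<longleftrightarrow> j = Suc i \<or> (i = 0 \<and> Suc j = length (z # rs)))"
    by (rule induced_cycleD[OF g c]; assumption)+
  show "ipath E rs" unfolding ipath_def using d A[of "Suc _" "Suc _"] by auto
  show "set rs \<subseteq> V" "2 \<le> length rs" "z \<notin> set rs" using n d s by auto
  show "{z, rs ! j} \<in> E \<longleftrightarrow> j = 0 \<or> Suc j = length rs" if "j < length rs" for j
    using A[of 0 "Suc j"] that by auto
qed

lemma induced_cycle_rotate_to:
  assumes "induced_cycle V E vs" "z \<in> set vs"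
  obtains rs where "induced_cycle V E (z # rs)" "set (z # rs) = set vs" "length (z # rs) = length vs"
proof -
  obtain m where m: "m < length vs" "vs ! m = z" using assms(2) by (auto simp: in_set_conv_nth)
  have "vs \<noteq> []" using m by auto
  then have "hd (rotate m vs) = z" using m by (simp add: hd_rotate_conv_nth)
  then have e: "rotate m vs = z # tl (rotate m vs)"
    by (metis \<open>vs \<noteq> []\<close> list.collapse rotate_is_Nil_conv)
  show thesis
    by (rule that[of "tl (rotate m vs)"])
      (use e induced_cycle_rotate[OF assms(1), of m] set_rotate[of m vs] length_rotate[of m vs] in metis)+
qed

text \<open>Without z the cycle is an induced path between the two neighbours of z, and
  \<open>ws\<close> closes it up again. It is not known at which end of this path a lies, so
  \<open>ws\<close> may have to be reversed.\<close>

lemma induced_cycle_flip: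
  assumes g: "simple_graph V E" and c: "induced_cycle V E vs" and z: "z \<in> set vs"
    and ws: "ipath E ws" "set ws \<subseteq> V" "ws \<noteq> []" and dj: "set ws \<inter> set vs = {}"
    and ab: "a \<in> set vs" "b \<in> set vs" "a \<noteq> b" "{z, a} \<in> E" "{z, b} \<in> E"
    and A: "\<And>w c. w \<in> set ws \<Longrightarrow> c \<in> set vs \<Longrightarrow> c \<noteq> z \<Longrightarrow>
      ({w, c} \<in> E \<longleftrightarrow> w = hd ws \<and> c = a \<or> w = last ws \<and> c = b)"
  obtains vs' where "induced_cycle V E vs'" "set vs' = set ws \<union> (set vs - {z})"
    "Suc (length vs') = length vs + length ws"
proof -
  obtain rs where rs: "induced_cycle V E (z # rs)" "set (z # rs) = set vs"
      "length (z # rs) = length vs"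
    using c z by (rule induced_cycle_rotate_to)
  note T = induced_cycle_tl_ipath[OF g rs(1)]
  have ne: "rs \<noteq> []" using T(3) by auto
  have ends: "{a, b} = {hd rs, last rs}"
  proof -
    have "x = hd rs \<or> x = last rs" if "x \<in> set vs" "{z, x} \<in> E" for x
    proof -
      have "x \<noteq> z" using that edge_neq[OF g] by blast
      then have "x \<in> set rs" using that rs(2) by auto
      then obtain j where j: "j < length rs" "x = rs ! j" by (auto simp: in_set_conv_nth)
      then have "j = 0 \<or> Suc j = length rs" using T(5) that by auto
      then show ?thesis
      proof
        assume "Suc j = length rs"
        then have "length rs - 1 = j" by simp
        then show ?thesis using j ne by (simp add: last_conv_nth)
      qed (use j ne in \<open>simp add: hd_conv_nth\<close>)
    qed
    then show ?thesis using ab by (metis insert_commute)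
  qed
  have sub: "set rs = set vs - {z}" using rs(2) T(4) by auto
  have drs: "distinct rs" and dws: "distinct ws" using T(1) ws by (auto simp: ipath_def)
  have main: "induced_cycle V E (us @ rs)"
    if us: "ipath E us" "set us = set ws" "length us = length ws"
      and B: "\<And>w c. w \<in> set ws \<Longrightarrow> c \<in> set vs \<Longrightarrow> c \<noteq> z \<Longrightarrow>
        ({w, c} \<in> E \<longleftrightarrow> w = hd us \<and> c = last rs \<or> w = last us \<and> c = hd rs)" for us
  proof (rule induced_cycle_glue[OF g us(1) _ T(1,2)])
    have une: "us \<noteq> []" using us ws(3) by auto
    then show "us \<noteq> []" .
    show "set us \<subseteq> V" using us ws by simp
    show "rs \<noteq> []" by (rule ne)
    show "3 \<le> length us + length rs" using T(3) une by (cases us) auto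
    show "set us \<inter> set rs = {}" using dj sub us by auto
    fix i j assume ij: "i < length us" "j < length rs"
    have dus: "distinct us" using us(1) by (simp add: ipath_def)
    have "us ! i \<in> set ws" using ij us by (metis nth_mem)
    moreover have "rs ! j \<in> set vs" "rs ! j \<noteq> z" using ij sub nth_mem by blast+
    ultimately have "{us ! i, rs ! j} \<in> E \<longleftrightarrow>
        us ! i = hd us \<and> rs ! j = last rs \<or> us ! i = last us \<and> rs ! j = hd rs"
      by (rule B)
    also have "us ! i = hd us \<longleftrightarrow> i = 0"
      using ij dus une by (simp add: hd_conv_nth nth_eq_iff_index_eq)
    also have "us ! i = last us \<longleftrightarrow> Suc i = length us"
      using ij dus une by (auto simp: last_conv_nth nth_eq_iff_index_eq)
    also have "rs ! j = hd rs \<longleftrightarrow> j = 0"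
      using ij drs ne by (simp add: hd_conv_nth nth_eq_iff_index_eq)
    also have "rs ! j = last rs \<longleftrightarrow> Suc j = length rs"
      using ij drs ne by (auto simp: last_conv_nth nth_eq_iff_index_eq)
    finally show "{us ! i, rs ! j} \<in> E \<longleftrightarrow>
        Suc i = length us \<and> j = 0 \<or> i = 0 \<and> Suc j = length rs" by blast
  qed
  have len: "Suc (length (us @ rs)) = length vs + length ws" if "length us = length ws" for us :: "'a list"
    using that rs(3) by simp
  show thesis
  proof (cases "a = last rs \<and> b = hd rs")
    case True
    have "induced_cycle V E (ws @ rs)" by (rule main[OF ws(1)]) (use A True in auto)
    then show thesis using that[of "ws @ rs"] sub len by simp
  next
    case False
    then have "a = hd rs \<and> b = last rs" using ends ab(3) by (metis doubleton_eq_iff)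
    then have "induced_cycle V E (rev ws @ rs)"
      using ws by (intro main ipath_rev) (auto simp: A hd_rev last_rev)
    then show thesis using that[of "rev ws @ rs"] sub len by simp
  qed
qed

text \<open>A walk of least length within X is induced: a repeated vertex or a chord would give a
  shortcut.\<close>

lemma ipath_exists:
  assumes g: "simple_graph V E"
    and r: "(a, b) \<in> {(u, v). u \<in> X \<and> v \<in> X \<and> {u, v} \<in> E}\<^sup>*" and a: "a \<in> X"
  obtains xs where "xs \<noteq> []" "hd xs = a" "last xs = b" "set xs \<subseteq> X" "ipath E xs"
proof -
  define walk where "walk b xs \<longleftrightarrow> xs \<noteq> [] \<and> hd xs = a \<and> last xs = b \<and> set xs \<subseteq> X \<and>
      (\<forall>i. Suc i < length xs \<longrightarrow> {xs ! i, xs ! Suc i} \<in> E)" for b xs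
  have "\<exists>xs. walk b xs"
    using r
  proof (induction rule: rtrancl_induct)
    case base
    then show ?case using a
      by (intro exI[of _ "[a]"]) (simp add: walk_def)
  next
    case (step y z)
    then obtain xs where xs: "walk y xs" by blast
    have "{(xs @ [z]) ! i, (xs @ [z]) ! Suc i} \<in> E" if "Suc i < length (xs @ [z])" for i
    proof (cases "Suc i < length xs")
      case True
      then show ?thesis using xs by (simp add: walk_def nth_append)
    next
      case False
      then have i: "Suc i = length xs" using that by simp
      then have "length xs - 1 = i" by simp
      then have "xs ! i = y" using xs last_conv_nth[of xs] by (simp add: walk_def)
      then show ?thesis using i step(2) by (simp add: nth_append)
    qed
    then have "walk z (xs @ [z])" using xs step(2) by (auto simp: walk_def)
    then show ?case by blast
  qed
  then obtain xs where xs: "walk b xs" and mn: "\<And>ys. walk b ys \<Longrightarrow> length xs \<le> length ys"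
    using ex_has_least_nat[of "walk b" _ length] by blast
  note w = xs[unfolded walk_def]
  \<comment> \<open>The shortcut jumps from position i to position k; k = \<open>length xs\<close>
    means stopping at i, which is allowed if the walk has reached b there. A chord is excluded with
    k = j, a repetition with k = \<open>Suc j\<close>.\<close>
  have short: False
    if ij: "Suc i < k" "k \<le> length xs" and e: "k < length xs \<Longrightarrow> {xs ! i, xs ! k} \<in> E"
      and l: "k = length xs \<Longrightarrow> xs ! i = b" for i k
  proof -
    let ?ys = "take (Suc i) xs @ drop k xs"
    have len: "length (take (Suc i) xs) = Suc i" using ij by simp
    have nt: "?ys ! t = (if t < Suc i then xs ! t else xs ! (k + (t - Suc i)))" if "t < length ?ys" for t
      using that ij by (auto simp: nth_append)
    have "walk b ?ys"
      unfolding walk_def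
    proof (intro conjI allI impI)
      show "?ys \<noteq> []" using w by simp
      show "hd ?ys = a" using w by (cases xs) auto
      show "last ?ys = b"
      proof (cases "k < length xs")
        case True
        then show ?thesis using w by simp
      next
        case False
        then have k: "k = length xs" using ij by simp
        have "last (take (Suc i) xs) = xs ! i"
          using ij w by (simp add: last_conv_nth)
        then show ?thesis using l[OF k] k by simp
      qed
      show "set ?ys \<subseteq> X" using w set_take_subset[of "Suc i" xs] set_drop_subset[of k xs] by auto
      fix t assume t: "Suc t < length ?ys"
      consider "Suc t < Suc i" | "t = i" | "Suc i \<le> t" by linarith
      then show "{?ys ! t, ?ys ! Suc t} \<in> E"
      proof cases
        case 1
        then show ?thesis using w t ij nt[of t] nt[of "Suc t"] by simp
      next
        case 2
        then have "k < length xs" using t ij by simp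
        then show ?thesis using 2 e t nt[of t] nt[of "Suc t"] by simp
      next
        case 3
        then have "Suc (k + (t - Suc i)) < length xs" using t ij by simp
        then have "{xs ! (k + (t - Suc i)), xs ! Suc (k + (t - Suc i))} \<in> E" using w by blast
        moreover have "Suc (k + (t - Suc i)) = k + (Suc t - Suc i)" using 3 by simp
        ultimately show ?thesis using 3 t nt[of t] nt[of "Suc t"] by simp
      qed
    qed
    then have "length xs \<le> length ?ys" by (rule mn)
    then show False using ij by simp
  qed
  have E1: "{xs ! i, xs ! Suc i} \<in> E" if "Suc i < length xs" for i using w that by blast
  have "distinct xs"
  proof -
    have "xs ! i \<noteq> xs ! j" if "i < j" "j < length xs" for i j
    proof
      assume eq: "xs ! i = xs ! j"
      have "xs ! j = b" if "Suc j = length xs"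
      proof -
        have "length xs - 1 = j" using that by simp
        then show ?thesis using w last_conv_nth[of xs] by simp
      qed
      then show False using short[of i "Suc j"] E1[of j] that eq by simp
    qed
    then show ?thesis unfolding distinct_conv_nth by (metis linorder_neqE_nat)
  qed
  moreover have "{xs ! i, xs ! j} \<in> E \<longleftrightarrow> j = Suc i" if ij: "i < j" "j < length xs" for i j
  proof
    assume "{xs ! i, xs ! j} \<in> E"
    then show "j = Suc i" using short[of i j] ij by (cases "j = Suc i") auto
  qed (use E1 that in auto)
  ultimately have "ipath E xs" unfolding ipath_def by blast
  then show thesis using that w by blast
qed

subsection \<open>Jordan curves with a common part\<close>

lemma connected_subset_inside:
  assumes "connected B" "B \<inter> S = {}" "x \<in> B" "x \<in> inside S"
  shows "B \<subseteq> inside S"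
proof
  fix y assume "y \<in> B"
  then have "connected_component (- S) x y"
    unfolding connected_component_def using assms(1-3) by (intro exI[of _ B]) blast
  then show "y \<in> inside S" using assms(4) by (rule inside_same_component)
qed

lemma connected_subset_outside:
  assumes "connected B" "B \<inter> S = {}" "x \<in> B" "x \<in> outside S"
  shows "B \<subseteq> outside S"
proof
  fix y assume "y \<in> B"
  then have "connected_component (- S) x y"
    unfolding connected_component_def using assms(1-3) by (intro exI[of _ B]) blast
  then show "y \<in> outside S" using assms(4) by (rule outside_same_component)
qed

text \<open>The outside of the Jordan curve is connected, unbounded and misses S, so it lies in the
  outside of S. A point of the open set \<open>inside S\<close> cannot lie on the curve either,
  because points outside the curve accumulate there.\<close>

lemma inside_subset_Jordan_inside:
  fixes c :: "real \<Rightarrow> complex"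
  assumes c: "simple_path c" "pathfinish c = pathstart c"
    and S: "closed S" "S \<subseteq> inside (path_image c) \<union> path_image c"
  shows "inside S \<subseteq> inside (path_image c)"
proof
  let ?J = "path_image c"
  note J = Jordan_inside_outside[OF c]
  fix y assume y: "y \<in> inside S"
  have sub: "outside ?J \<subseteq> outside S"
  proof
    fix z assume z: "z \<in> outside ?J"
    have "outside ?J \<subseteq> - S" 
      using S(2) inside_Int_outside[of ?J] outside_no_overlap[of ?J] by blast
    then have "outside ?J \<subseteq> connected_component_set (- S) z"
      using z J by (intro connected_component_maximal) auto
    then have "\<not> bounded (connected_component_set (- S) z)"
      using J bounded_subset by blast
    then show "z \<in> outside S" by (simp add: outside)
  qed
  have dis: "inside S \<inter> outside S = {}" by simp
  have "y \<notin> outside ?J" using y sub dis by blast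
  moreover have "y \<notin> ?J"
  proof
    assume "y \<in> ?J"
    then have "y \<in> closure (outside ?J)" using J by (auto simp: frontier_def)
    then have "inside S \<inter> outside ?J \<noteq> {}"
      using y open_inside[OF S(1)] by (metis IntI empty_iff open_Int_closure_eq_empty)
    then show False using sub dis by blast
  qed
  ultimately show "y \<in> inside ?J" by (simp add: inside_outside)
qed

text \<open>The sign of \<open>\<sigma>\<close> depends on the orientation of c, which stays
  unspecified; that it is nonzero suffices to tell inside from outside.\<close>

lemma Jordan_winding:
  assumes c: "simple_path c" "pathfinish c = pathstart c"
  obtains \<sigma> where "\<sigma> \<noteq> 0"
    "\<And>y. y \<notin> path_image c \<Longrightarrow> winding_number c y = (if y \<in> inside (path_image c) then \<sigma> else 0)"
proof -
  have out: "winding_number c y = 0" if "y \<notin> path_image c" "y \<notin> inside (path_image c)" for y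
    using that c by (intro winding_number_zero_in_outside) (auto simp: outside_inside simple_path_imp_path)
  show thesis
  proof (rule simple_closed_path_winding_number_inside[OF c(1)])
    assume "\<And>z. z \<in> inside (path_image c) \<Longrightarrow> winding_number c z = 1"
    then show thesis using out by (intro that[of 1]) auto
  next
    assume "\<And>z. z \<in> inside (path_image c) \<Longrightarrow> winding_number c z = -1"
    then show thesis using out by (intro that[of "-1"]) auto
  qed
qed

text \<open>Two loops with a common part: the difference of their winding numbers is that of a loop
  avoiding the common part, hence constant near a point of it.\<close>

lemma common_part_winding:
  assumes e: "path e" and r1: "path r1" and r2: "path r2"
    and ends: "pathfinish e = pathstart r1" "pathfinish e = pathstart r2"
      "pathfinish r1 = pathstart e" "pathfinish r2 = pathstart e"
    and z0: "z0 \<notin> path_image r1" "z0 \<notin> path_image r2"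
  obtains d where "0 < d" "\<And>y. y \<in> ball z0 d \<Longrightarrow> y \<notin> path_image e \<Longrightarrow>
    y \<notin> path_image r1 \<and> y \<notin> path_image r2 \<and>
    winding_number (e +++ r1) y - winding_number (e +++ r2) y
      = winding_number r1 z0 - winding_number r2 z0"
proof -
  have "closed (path_image r1 \<union> path_image r2)"
    by (intro closed_Un closed_path_image r1 r2)
  then obtain d where d: "0 < d" "ball z0 d \<subseteq> - (path_image r1 \<union> path_image r2)"
    using z0 openE[of "- (path_image r1 \<union> path_image r2)" z0] by (auto simp: open_closed)
  have L: "winding_number (r1 +++ reversepath r2) y = winding_number r1 y - winding_number r2 y"
    if "y \<in> ball z0 d" for y
  proof -
    have "y \<notin> path_image r1" "y \<notin> path_image r2" using that d by auto
    then show ?thesis using r1 r2 ends by (simp add: winding_number_join winding_number_reversepath)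
  qed
  show thesis
  proof (rule that[OF d(1)], intro conjI)
    fix y assume y: "y \<in> ball z0 d" "y \<notin> path_image e"
    then show y12: "y \<notin> path_image r1" "y \<notin> path_image r2" using d by auto
    have "winding_number (r1 +++ reversepath r2) y = winding_number (r1 +++ reversepath r2) z0"
    proof (rule winding_number_eq[of _ _ "ball z0 d"])
      show "path (r1 +++ reversepath r2)" using r1 r2 ends by simp
      show "pathfinish (r1 +++ reversepath r2) = pathstart (r1 +++ reversepath r2)" using ends by simp
      show "ball z0 d \<inter> path_image (r1 +++ reversepath r2) = {}"
        using d ends by (auto simp: path_image_join)
    qed (use y d in auto)
    then have "winding_number r1 y - winding_number r2 y = winding_number r1 z0 - winding_number r2 z0"
      using L y d by simp
    then show "winding_number (e +++ r1) y - winding_number (e +++ r2) y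
      = winding_number r1 z0 - winding_number r2 z0"
      using y y12 e r1 r2 ends by (simp add: winding_number_join)
  qed
qed

text \<open>Near z0 the two winding numbers differ by a constant, and each of them takes one value
  inside its loop and another one outside. So two points on the same side of one loop are on the
  same side of the other. Sides are thus compared locally without straightening the arc e.\<close>

lemma common_part_sides:
  fixes e r1 r2 :: "real \<Rightarrow> complex"
  assumes L1: "simple_path (e +++ r1)" and L2: "simple_path (e +++ r2)"
    and ends: "pathfinish e = pathstart r1" "pathfinish e = pathstart r2"
      "pathfinish r1 = pathstart e" "pathfinish r2 = pathstart e"
    and z0: "z0 \<notin> path_image r1" "z0 \<notin> path_image r2"
  obtains d where "0 < d" "\<And>y y'. y \<in> ball z0 d \<Longrightarrow> y' \<in> ball z0 d \<Longrightarrow>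
      y \<notin> path_image e \<Longrightarrow> y' \<notin> path_image e \<Longrightarrow>
      (y \<in> inside (path_image (e +++ r1)) \<longleftrightarrow> y' \<in> inside (path_image (e +++ r1))) \<Longrightarrow>
      (y \<in> inside (path_image (e +++ r2)) \<longleftrightarrow> y' \<in> inside (path_image (e +++ r2)))"
proof -
  have p: "path e" "path r1" "path r2"
    using simple_path_imp_path[OF L1] simple_path_imp_path[OF L2] ends by simp_all
  obtain d where d: "0 < d" and D: "\<And>y. y \<in> ball z0 d \<Longrightarrow> y \<notin> path_image e \<Longrightarrow>
    y \<notin> path_image r1 \<and> y \<notin> path_image r2 \<and>
    winding_number (e +++ r1) y - winding_number (e +++ r2) y
      = winding_number r1 z0 - winding_number r2 z0"
    using common_part_winding[OF p ends z0] by blast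
  obtain s1 where s1: "s1 \<noteq> 0" "\<And>y. y \<notin> path_image (e +++ r1) \<Longrightarrow>
      winding_number (e +++ r1) y = (if y \<in> inside (path_image (e +++ r1)) then s1 else 0)"
    using Jordan_winding[OF L1] ends by auto
  obtain s2 where s2: "s2 \<noteq> 0" "\<And>y. y \<notin> path_image (e +++ r2) \<Longrightarrow>
      winding_number (e +++ r2) y = (if y \<in> inside (path_image (e +++ r2)) then s2 else 0)"
    using Jordan_winding[OF L2] ends by auto
  show thesis
  proof (rule that[OF d])
    fix y y' assume y: "y \<in> ball z0 d" "y' \<in> ball z0 d" "y \<notin> path_image e" "y' \<notin> path_image e"
      and same: "y \<in> inside (path_image (e +++ r1)) \<longleftrightarrow> y' \<in> inside (path_image (e +++ r1))"
    have "winding_number (e +++ r1) y - winding_number (e +++ r2) y =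
        winding_number (e +++ r1) y' - winding_number (e +++ r2) y'"
      using D[OF y(1,3)] D[OF y(2,4)] by simp
    moreover have n: "y \<notin> path_image (e +++ r1)" "y' \<notin> path_image (e +++ r1)"
        "y \<notin> path_image (e +++ r2)" "y' \<notin> path_image (e +++ r2)"
      using D[OF y(1,3)] D[OF y(2,4)] y(3,4) ends by (auto simp: path_image_join)
    ultimately show "y \<in> inside (path_image (e +++ r2)) \<longleftrightarrow> y' \<in> inside (path_image (e +++ r2))"
      using same s1(2)[OF n(1)] s1(2)[OF n(2)] s2(2)[OF n(3)] s2(2)[OF n(4)] s2(1)
      by (auto split: if_splits)
  qed
qed

text \<open>The winding number of \<open>c1 +++ c2\<close> is the sum of those of
  \<open>c1 +++ c\<close> and \<open>c2 +++ reversepath c\<close>; it would be 0 at a point outside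
  both smaller loops.\<close>

lemma theta_inside:
  fixes c1 c2 c :: "real \<Rightarrow> complex"
  assumes c: "path c1" "path c2" "path c"
    and L: "simple_path (c1 +++ c2)"
    and ends: "pathfinish c1 = pathstart c2" "pathfinish c2 = pathstart c1"
      "pathstart c = pathfinish c1" "pathfinish c = pathstart c1"
    and y: "y \<in> inside (path_image c1 \<union> path_image c2)" "y \<notin> path_image c"
  shows "y \<in> inside (path_image c1 \<union> path_image c) \<or> y \<in> inside (path_image c2 \<union> path_image c)"
proof (rule ccontr)
  assume not: "\<not> ?thesis"
  have pc: "path_image (c1 +++ c2) = path_image c1 \<union> path_image c2"
    using ends by (simp add: path_image_join)
  have yn: "y \<notin> path_image c1" "y \<notin> path_image c2"
    using y(1) inside_no_overlap by blast+
  obtain s where s: "s \<noteq> 0" "\<And>y. y \<notin> path_image (c1 +++ c2) \<Longrightarrow>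
      winding_number (c1 +++ c2) y = (if y \<in> inside (path_image (c1 +++ c2)) then s else 0)"
    using Jordan_winding[OF L] ends by auto
  have "winding_number (c1 +++ c) y = 0"
    using not y yn c ends
    by (intro winding_number_zero_in_outside) (auto simp: path_image_join outside_inside)
  moreover have "winding_number (c2 +++ reversepath c) y = 0"
    using not y yn c ends
    by (intro winding_number_zero_in_outside) (auto simp: path_image_join outside_inside)
  ultimately have "winding_number (c1 +++ c2) y = 0"
    using y yn c ends by (simp add: winding_number_join winding_number_reversepath)
  then show False using s(1) s(2)[of y] y(1) yn pc by simp
qed

section \<open>Drawings of walks and cycles\<close>

locale plane_graph =
  fixes V :: "'v set" and E :: "'v set set" and p :: "'v \<Rightarrow> complex"
    and \<gamma> :: "'v set \<Rightarrow> real \<Rightarrow> complex"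
  assumes graph: "simple_graph V E" and emb: "plane_embedding V E p \<gamma>"
begin

definition drawing :: "'v set set \<Rightarrow> complex set" where
  "drawing X = (\<Union>e\<in>X. path_image (\<gamma> e))"

lemma drawing_Un: "drawing (X \<union> Y) = drawing X \<union> drawing Y"
  by (auto simp: drawing_def)

lemma finite_E: "finite E"
  using graph unfolding simple_graph_def by (meson finite_imp_finite_nsets finite_subset)

lemma finite_V: "finite V"
  using graph unfolding simple_graph_def by blast

lemma edge_subset: "e \<in> E \<Longrightarrow> e \<subseteq> V"
  using graph unfolding simple_graph_def nsets_def by auto

lemma edge_V: "{u, v} \<in> E \<Longrightarrow> u \<in> V \<and> v \<in> V \<and> u \<noteq> v"
  using edge_neq[OF graph] by blast

lemma inj_p: "u \<in> V \<Longrightarrow> v \<in> V \<Longrightarrow> p u = p v \<longleftrightarrow> u = v"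
  using emb unfolding plane_embedding_def by (auto dest: inj_onD)

lemma edge_arc:
  assumes "e \<in> E"
  shows "arc (\<gamma> e)" "{pathstart (\<gamma> e), pathfinish (\<gamma> e)} = p ` e"
    "path_image (\<gamma> e) \<inter> p ` V = p ` e"
  using emb assms unfolding plane_embedding_def by blast+

lemma edge_Int:
  assumes "e \<in> E" "f \<in> E" "e \<noteq> f"
  shows "path_image (\<gamma> e) \<inter> path_image (\<gamma> f) = p ` (e \<inter> f)"
  using emb assms unfolding plane_embedding_def by blast

lemma closed_drawing: "X \<subseteq> E \<Longrightarrow> closed (drawing X)"
  unfolding drawing_def using finite_subset[OF _ finite_E] edge_arc(1)
  by (intro closed_UN) (auto intro!: closed_path_image arc_imp_path)

lemma vertex_in_drawing:
  assumes "X \<subseteq> E" "v \<in> V" shows "p v \<in> drawing X \<longleftrightarrow> v \<in> \<Union>X"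
proof
  assume "p v \<in> drawing X"
  then obtain e where e: "e \<in> X" "p v \<in> path_image (\<gamma> e)" by (auto simp: drawing_def)
  then have "p v \<in> p ` e" using edge_arc(3)[of e] assms by blast
  then obtain u where "u \<in> e" "p v = p u" by blast
  moreover then have "u \<in> V" using e edge_subset assms(1) by blast
  ultimately have "v \<in> e" using inj_p assms(2) by blast
  then show "v \<in> \<Union>X" using e by blast
next
  assume "v \<in> \<Union>X"
  then obtain e where e: "e \<in> X" "v \<in> e" by blast
  then have "p v \<in> path_image (\<gamma> e)" using edge_arc(3)[of e] assms by blast
  then show "p v \<in> drawing X" using e by (auto simp: drawing_def)
qed

lemma drawing_Int:
  assumes "A \<subseteq> E" "B \<subseteq> E" "A \<inter> B = {}"
  shows "drawing A \<inter> drawing B \<subseteq> p ` (\<Union>A \<inter> \<Union>B)"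
proof
  fix z assume "z \<in> drawing A \<inter> drawing B"
  then obtain e f where ef: "e \<in> A" "f \<in> B" "z \<in> path_image (\<gamma> e)" "z \<in> path_image (\<gamma> f)"
    by (auto simp: drawing_def)
  then have "e \<noteq> f" using assms(3) by blast
  then have "z \<in> p ` (e \<inter> f)" using edge_Int[of e f] ef assms by blast
  then show "z \<in> p ` (\<Union>A \<inter> \<Union>B)" using ef by blast
qed

lemma edge_off_drawing:
  assumes "{u, v} \<in> E" "X \<subseteq> E" "u \<notin> \<Union>X" "v \<notin> \<Union>X"
  shows "path_image (\<gamma> {u, v}) \<inter> drawing X = {}"
proof -
  have "{u, v} \<notin> X" using assms(3) by blast
  then show ?thesis using drawing_Int[of "{{u, v}}" X] assms by (auto simp: drawing_def)
qed

lemma edge_same_side: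
  assumes e: "{u, v} \<in> E" and X: "X \<subseteq> E" "u \<notin> \<Union>X" "v \<notin> \<Union>X"
    and u: "p u \<in> inside (drawing X)"
  shows "p v \<in> inside (drawing X)" "path_image (\<gamma> {u, v}) \<subseteq> inside (drawing X)"
proof -
  have pu: "p u \<in> path_image (\<gamma> {u, v})" "p v \<in> path_image (\<gamma> {u, v})"
    using edge_arc(3)[OF e] by blast+
  show "path_image (\<gamma> {u, v}) \<subseteq> inside (drawing X)"
    by (rule connected_subset_inside[OF _ edge_off_drawing[OF e X] pu(1) u])
      (simp add: edge_arc(1)[OF e] arc_imp_path connected_path_image)
  then show "p v \<in> inside (drawing X)" using pu by blast
qed

text \<open>\<open>\<gamma>\<close> is indexed by unordered edges, so its arcs have arbitrary
  direction; a dart is the edge traversed from u to v.\<close>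

definition dart :: "'v \<Rightarrow> 'v \<Rightarrow> real \<Rightarrow> complex" where
  "dart u v = (if pathstart (\<gamma> {u, v}) = p u then \<gamma> {u, v} else reversepath (\<gamma> {u, v}))"

lemma dart:
  assumes e: "{u, v} \<in> E"
  shows "arc (dart u v)" "pathstart (dart u v) = p u" "pathfinish (dart u v) = p v"
    "path_image (dart u v) = path_image (\<gamma> {u, v})" "dart v u = reversepath (dart u v)"
proof -
  have uv: "u \<in> V" "v \<in> V" "u \<noteq> v" using edge_V[OF e] by auto
  then have ne: "p u \<noteq> p v" using inj_p by blast
  have s: "{pathstart (\<gamma> {u, v}), pathfinish (\<gamma> {u, v})} = {p u, p v}"
    using edge_arc(2)[OF e] by simp
  then have c: "pathstart (\<gamma> {u, v}) = p u \<and> pathfinish (\<gamma> {u, v}) = p v \<or>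
      pathstart (\<gamma> {u, v}) = p v \<and> pathfinish (\<gamma> {u, v}) = p u"
    by (simp add: doubleton_eq_iff)
  show "arc (dart u v)" using edge_arc(1)[OF e] by (simp add: dart_def arc_reversepath)
  show "pathstart (dart u v) = p u" "pathfinish (dart u v) = p v"
    using c ne by (auto simp: dart_def)
  show "path_image (dart u v) = path_image (\<gamma> {u, v})" by (simp add: dart_def)
  have "{v, u} = {u, v}" by auto
  then show "dart v u = reversepath (dart u v)" using c ne by (auto simp: dart_def)
qed

fun walk_edges :: "'v list \<Rightarrow> 'v set set" where
  "walk_edges (u # v # xs) = insert {u, v} (walk_edges (v # xs))"
| "walk_edges _ = {}"

text \<open>Lists with fewer than two entries have no edge; their value is a dummy.\<close>

fun walk_path :: "'v list \<Rightarrow> real \<Rightarrow> complex" where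
  "walk_path (u # v # w # xs) = dart u v +++ walk_path (v # w # xs)"
| "walk_path (u # v # []) = dart u v"
| "walk_path _ = linepath 0 0"

lemma Union_walk_edges: "2 \<le> length xs \<Longrightarrow> \<Union>(walk_edges xs) = set xs"
proof (induction xs rule: walk_edges.induct)
  case (1 u v xs)
  then show ?case by (cases xs) auto
qed auto

lemma walk_edges_subset: "e \<in> walk_edges xs \<Longrightarrow> e \<subseteq> set xs"
  by (induction xs rule: walk_edges.induct) auto

lemma walk_edges_append:
  "xs \<noteq> [] \<Longrightarrow> ys \<noteq> [] \<Longrightarrow>
    walk_edges (xs @ ys) = insert {last xs, hd ys} (walk_edges xs \<union> walk_edges ys)"
proof (induction xs rule: walk_edges.induct)
  case (1 u v xs)
  then show ?case by (cases xs) auto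
next
  case ("2_2" u)
  then show ?case by (cases ys) auto
qed auto

lemma walk_path:
  assumes "distinct xs" "2 \<le> length xs" "walk_edges xs \<subseteq> E"
  shows "arc (walk_path xs) \<and> pathstart (walk_path xs) = p (hd xs) \<and>
    pathfinish (walk_path xs) = p (last xs) \<and> path_image (walk_path xs) = drawing (walk_edges xs)"
  using assms
proof (induction xs rule: walk_path.induct)
  case (1 u v w xs)
  let ?r = "v # w # xs"
  have IH: "arc (walk_path ?r)" "pathstart (walk_path ?r) = p v"
    "pathfinish (walk_path ?r) = p (last ?r)" "path_image (walk_path ?r) = drawing (walk_edges ?r)"
    using 1 by auto
  have e: "{u, v} \<in> E" and r: "walk_edges ?r \<subseteq> E" using 1(4) by auto
  have "u \<notin> set ?r" using 1(2) by auto
  have U: "\<Union>(walk_edges ?r) = set ?r" by (rule Union_walk_edges) simp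
  have nin: "{u, v} \<notin> walk_edges ?r" using \<open>u \<notin> set ?r\<close> walk_edges_subset[of "{u, v}" ?r] by auto
  have "drawing {{u, v}} \<inter> drawing (walk_edges ?r) \<subseteq> p ` (\<Union>{{u, v}} \<inter> \<Union>(walk_edges ?r))"
    using e r nin by (intro drawing_Int) auto
  also have "\<Union>{{u, v}} \<inter> \<Union>(walk_edges ?r) \<subseteq> {v}" unfolding U using \<open>u \<notin> set ?r\<close> by auto
  finally have int: "path_image (dart u v) \<inter> path_image (walk_path ?r) \<subseteq> {p v}"
    using IH(4) dart(4)[OF e] by (auto simp: drawing_def)
  have "arc (dart u v +++ walk_path ?r)"
    using dart[OF e] IH int by (intro arc_join) auto
  moreover have "path_image (dart u v +++ walk_path ?r) = drawing (walk_edges (u # ?r))"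
    using dart[OF e] IH by (simp add: path_image_join drawing_def)
  ultimately show ?case using dart[OF e] IH by simp
next
  case (2 u v)
  then show ?case using dart[of u v] by (simp add: drawing_def)
qed auto

text \<open>Sharing only end vertices does not prevent both walks from being one and the same edge,
  hence the separate condition that the edge sets are disjoint.\<close>

lemma walk_loop:
  assumes xs: "distinct xs" "2 \<le> length xs" "walk_edges xs \<subseteq> E"
    and ys: "distinct ys" "2 \<le> length ys" "walk_edges ys \<subseteq> E"
    and ends: "hd ys = last xs" "last ys = hd xs"
    and dj: "walk_edges xs \<inter> walk_edges ys = {}" "set xs \<inter> set ys \<subseteq> {hd xs, last xs}"
  shows "simple_path (walk_path xs +++ walk_path ys)"
    "pathfinish (walk_path xs +++ walk_path ys) = pathstart (walk_path xs +++ walk_path ys)"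
    "path_image (walk_path xs +++ walk_path ys) = drawing (walk_edges xs \<union> walk_edges ys)"
proof -
  note X = walk_path[OF xs] and Y = walk_path[OF ys]
  have "drawing (walk_edges xs) \<inter> drawing (walk_edges ys) \<subseteq> p ` (set xs \<inter> set ys)"
    using drawing_Int[OF xs(3) ys(3) dj(1)] Union_walk_edges xs(2) ys(2) by simp
  then have "path_image (walk_path xs) \<inter> path_image (walk_path ys) \<subseteq> {p (hd xs), p (last xs)}"
    using X Y dj(2) by auto
  then show "simple_path (walk_path xs +++ walk_path ys)"
    using X Y ends by (intro simple_path_join_loop) auto
  show "pathfinish (walk_path xs +++ walk_path ys) = pathstart (walk_path xs +++ walk_path ys)"
    using X Y ends by simp
  show "path_image (walk_path xs +++ walk_path ys) = drawing (walk_edges xs \<union> walk_edges ys)"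
    using X Y ends by (simp add: path_image_join drawing_Un)
qed

text \<open>A point of the edge that lies on no other edge and at no vertex; the local arguments at
  an edge take place around it.\<close>

definition mid :: "'v set \<Rightarrow> complex" where "mid e = \<gamma> e (1/2)"

lemma mid:
  assumes e: "e \<in> E"
  shows "mid e \<in> path_image (\<gamma> e)" "mid e \<notin> p ` V"
    "\<And>f. f \<in> E \<Longrightarrow> f \<noteq> e \<Longrightarrow> mid e \<notin> path_image (\<gamma> f)"
proof -
  show m: "mid e \<in> path_image (\<gamma> e)" by (auto simp: mid_def path_image_def)
  have inj: "inj_on (\<gamma> e) {0..1}" using edge_arc(1)[OF e] by (simp add: arc_def)
  have "mid e \<noteq> pathstart (\<gamma> e)" "mid e \<noteq> pathfinish (\<gamma> e)"
    using inj_onD[OF inj, of "1/2" 0] inj_onD[OF inj, of "1/2" 1]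
    by (auto simp: mid_def pathstart_def pathfinish_def)
  then have "mid e \<notin> p ` e" using edge_arc(2)[OF e] by blast
  then show n: "mid e \<notin> p ` V" using m edge_arc(3)[OF e] by blast
  show "mid e \<notin> path_image (\<gamma> f)" if f: "f \<in> E" "f \<noteq> e" for f
  proof
    assume "mid e \<in> path_image (\<gamma> f)"
    then have "mid e \<in> p ` (e \<inter> f)" using m edge_Int[of e f] e f by blast
    then show False using n edge_subset[OF e] by blast
  qed
qed

text \<open>Leaving out the end \<open>p v\<close> permits v to be a vertex of X, while the rest of
  the edge stays connected and off the drawing of X.\<close>

lemma half_edge:
  assumes e: "{u, v} \<in> E" and X: "X \<subseteq> E" "u \<notin> \<Union>X"
  shows "connected (path_image (\<gamma> {u, v}) - {p v})"
    "(path_image (\<gamma> {u, v}) - {p v}) \<inter> drawing X = {}"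
    "p u \<in> path_image (\<gamma> {u, v}) - {p v}"
proof -
  note D = dart[OF e]
  have uv: "u \<in> V" "v \<in> V" "u \<noteq> v" using edge_V[OF e] by auto
  have inj: "inj_on (dart u v) {0..1}" and pth: "path (dart u v)" using D(1) by (simp_all add: arc_def)
  have v1: "p v = dart u v 1" using D(3) by (simp add: pathfinish_def)
  have I: "{0..1::real} = insert 1 {0..<1}" by auto
  have "dart u v ` {0..1} = insert (dart u v 1) (dart u v ` {0..<1})"
    unfolding I by (rule image_insert)
  then have img: "path_image (\<gamma> {u, v}) = insert (dart u v 1) (dart u v ` {0..<1})"
    using D(4) unfolding path_image_def by simp
  have "dart u v 1 \<notin> dart u v ` {0..<1}"
  proof
    assume "dart u v 1 \<in> dart u v ` {0..<1}"
    then obtain t where t: "t \<in> {0..<1}" "dart u v 1 = dart u v t" by blast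
    then have "1 = t" using inj_onD[OF inj t(2)] by auto
    then show False using t(1) by simp
  qed
  then have eq: "path_image (\<gamma> {u, v}) - {p v} = dart u v ` {0..<1}"
    unfolding img v1 by blast
  have "continuous_on {0..<1} (dart u v)"
    using pth unfolding path_def by (rule continuous_on_subset) auto
  then show "connected (path_image (\<gamma> {u, v}) - {p v})"
    unfolding eq by (intro connected_continuous_image) auto
  have "{u, v} \<notin> X" using X(2) by blast
  then have "path_image (\<gamma> {u, v}) \<inter> drawing X \<subseteq> p ` (\<Union>{{u, v}} \<inter> \<Union>X)"
    using drawing_Int[of "{{u, v}}" X] e X(1) by (auto simp: drawing_def)
  also have "\<dots> \<subseteq> {p v}" using X(2) by auto
  finally show "(path_image (\<gamma> {u, v}) - {p v}) \<inter> drawing X = {}" by blast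
  show "p u \<in> path_image (\<gamma> {u, v}) - {p v}"
    using edge_arc(3)[OF e] uv inj_p by blast
qed

lemma half_edge_inside:
  assumes e: "{u, v} \<in> E" and X: "X \<subseteq> E" "u \<notin> \<Union>X"
    and z: "z \<in> path_image (\<gamma> {u, v}) - {p v}" "z \<in> inside (drawing X)"
  shows "path_image (\<gamma> {u, v}) - {p v} \<subseteq> inside (drawing X)"
  by (rule connected_subset_inside[OF half_edge(1,2)[OF e X] z])

lemma walk_edges_nth: "walk_edges xs = {{xs ! i, xs ! Suc i} |i. Suc i < length xs}"
proof (induction xs rule: walk_edges.induct)
  case (1 u v xs)
  have "{{(u # v # xs) ! i, (u # v # xs) ! Suc i} |i. Suc i < length (u # v # xs)}
      = insert {u, v} {{(v # xs) ! i, (v # xs) ! Suc i} |i. Suc i < length (v # xs)}"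
    (is "?L = ?R")
  proof
    show "?L \<subseteq> ?R"
    proof
      fix e assume "e \<in> ?L"
      then obtain i where i: "e = {(u # v # xs) ! i, (u # v # xs) ! Suc i}"
        "Suc i < length (u # v # xs)" by blast
      then show "e \<in> ?R" by (cases i) auto
    qed
    show "?R \<subseteq> ?L"
    proof
      fix e assume "e \<in> ?R"
      then consider "e = {u, v}" | i where "e = {(v # xs) ! i, (v # xs) ! Suc i}"
        "Suc i < length (v # xs)" by blast
      then show "e \<in> ?L"
      proof cases
        case 1
        then show ?thesis by (intro CollectI exI[of _ 0]) auto
      next
        case 2
        then show ?thesis by (intro CollectI exI[of _ "Suc i"]) auto
      qed
    qed
  qed
  then show ?case using 1 by simp
qed auto

lemma cycle_edges_walk:
  fixes vs :: "'v list"
  assumes ne: "vs \<noteq> []"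
  shows "cycle_edges vs = walk_edges (vs @ [hd vs])"
proof -
  let ?us = "vs @ [hd vs]"
  have "{?us ! i, ?us ! Suc i} = {vs ! i, vs ! (Suc i mod length vs)}" if "i < length vs" for i
  proof (cases "Suc i = length vs")
    case True
    then show ?thesis using ne by (simp add: nth_append hd_conv_nth)
  next
    case False
    then show ?thesis using that by (simp add: nth_append)
  qed
  moreover have "walk_edges ?us = (\<lambda>i. {?us ! i, ?us ! Suc i}) ` {..<length vs}"
    unfolding walk_edges_nth by auto
  ultimately show ?thesis unfolding cycle_edges_def by simp
qed

lemma Union_cycle_edges:
  fixes vs :: "'v list"
  assumes "2 \<le> length vs" shows "\<Union>(cycle_edges vs) = set vs"
proof -
  have ne: "vs \<noteq> []" using assms by auto
  have "\<Union>(cycle_edges vs) = set (vs @ [hd vs])"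
    unfolding cycle_edges_walk[OF ne] by (rule Union_walk_edges) (use assms in simp)
  then show ?thesis using ne by auto
qed

lemma walk_edges_ends:
  assumes "distinct (a # xs @ [b])" "{a, b} \<in> walk_edges (a # xs @ [b])" shows "xs = []"
proof -
  let ?l = "a # xs @ [b]"
  have la: "?l ! 0 = a" "?l ! Suc (length xs) = b" by (simp_all add: nth_append)
  obtain i where i: "{a, b} = {?l ! i, ?l ! Suc i}" "Suc i < length ?l"
    using assms(2) unfolding walk_edges_nth by blast
  have "i = 0 \<and> Suc i = Suc (length xs) \<or> Suc i = 0 \<and> i = Suc (length xs)"
    using i assms(1) la by (metis (no_types, lifting) Suc_lessD doubleton_eq_iff length_Cons
        length_append_singleton lessI nth_eq_iff_index_eq zero_less_Suc)
  then show ?thesis by auto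
qed

text \<open>Two vertices cut the cycle into two walks, which together form a simple closed curve.
  The condition on xs and ys excludes the list of just two vertices, where both walks would be the
  same edge.\<close>

lemma cycle_split:
  assumes d: "distinct (a # xs @ b # ys)" and ne: "xs \<noteq> [] \<or> ys \<noteq> []"
    and E: "cycle_edges (a # xs @ b # ys) \<subseteq> E"
  shows "cycle_edges (a # xs @ b # ys) = walk_edges (a # xs @ [b]) \<union> walk_edges (b # ys @ [a])"
    "walk_edges (a # xs @ [b]) \<inter> walk_edges (b # ys @ [a]) = {}"
    "simple_path (walk_path (a # xs @ [b]) +++ walk_path (b # ys @ [a]))"
    "pathfinish (walk_path (a # xs @ [b]) +++ walk_path (b # ys @ [a])) =
      pathstart (walk_path (a # xs @ [b]) +++ walk_path (b # ys @ [a]))"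
    "path_image (walk_path (a # xs @ [b]) +++ walk_path (b # ys @ [a])) =
      drawing (cycle_edges (a # xs @ b # ys))"
proof -
  let ?x = "a # xs @ [b]" and ?y = "b # ys @ [a]"
  have "walk_edges ((a # xs) @ (b # ys @ [a])) = walk_edges ?x \<union> walk_edges ?y"
    using walk_edges_append[of "a # xs" ?y] walk_edges_append[of "a # xs" "[b]"] by auto
  then show eq: "cycle_edges (a # xs @ b # ys) = walk_edges ?x \<union> walk_edges ?y"
    by (simp add: cycle_edges_walk)
  have sxy: "set ?x \<inter> set ?y \<subseteq> {a, b}" using d by auto
  have dx: "distinct ?x" and dy: "distinct ?y" using d by auto
  \<comment> \<open>A common edge has both ends in {a, b}. A walk without repetitions from a to b
    contains that edge only if nothing lies between, so both xs and ys would be empty.\<close>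
  show dj: "walk_edges ?x \<inter> walk_edges ?y = {}"
  proof (rule ccontr)
    assume "\<not> ?thesis"
    then obtain e where e: "e \<in> walk_edges ?x" "e \<in> walk_edges ?y" by blast
    have "e \<subseteq> {a, b}" using e walk_edges_subset sxy by blast
    moreover have "card e = 2" using e(1) eq E graph unfolding simple_graph_def nsets_def by auto
    ultimately have "e = {a, b}" by (metis card_seteq card_2_iff d distinct.simps(2) finite.emptyI
          finite.insertI in_set_conv_decomp list.set_intros(1) order_refl Un_iff set_append)
    then show False using walk_edges_ends[of a xs b] walk_edges_ends[of b ys a] e dx dy ne
      by (auto simp: insert_commute)
  qed
  have L: "distinct ?x" "2 \<le> length ?x" "walk_edges ?x \<subseteq> E"
    "distinct ?y" "2 \<le> length ?y" "walk_edges ?y \<subseteq> E" "hd ?y = last ?x" "last ?y = hd ?x"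
    using dx dy eq E by auto
  have s: "set ?x \<inter> set ?y \<subseteq> {hd ?x, last ?x}" using sxy by simp
  show "simple_path (walk_path ?x +++ walk_path ?y)"
    by (rule walk_loop(1)[OF L dj s])
  show "pathfinish (walk_path ?x +++ walk_path ?y) = pathstart (walk_path ?x +++ walk_path ?y)"
    by (rule walk_loop(2)[OF L dj s])
  show "path_image (walk_path ?x +++ walk_path ?y) = drawing (cycle_edges (a # xs @ b # ys))"
    unfolding eq by (rule walk_loop(3)[OF L dj s])
qed

lemma cycle_loop:
  assumes d: "distinct vs" and n: "3 \<le> length vs" and E: "cycle_edges vs \<subseteq> E"
  obtains c where "simple_path c" "pathfinish c = pathstart c" "path_image c = drawing (cycle_edges vs)"
proof -
  obtain a b c xs where vs: "vs = a # b # c # xs"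
    using n by (auto simp: numeral_3_eq_3 Suc_le_length_iff)
  have "simple_path (walk_path (a # [] @ [b]) +++ walk_path (b # (c # xs) @ [a]))"
    "pathfinish (walk_path (a # [] @ [b]) +++ walk_path (b # (c # xs) @ [a])) =
      pathstart (walk_path (a # [] @ [b]) +++ walk_path (b # (c # xs) @ [a]))"
    "path_image (walk_path (a # [] @ [b]) +++ walk_path (b # (c # xs) @ [a])) =
      drawing (cycle_edges (a # [] @ b # (c # xs)))"
    by (rule cycle_split(3-5)[of a "[]" b "c # xs"]; use d E vs in simp)+
  then show thesis by (intro that) (simp_all only: vs append_Nil)
qed

text \<open>The path through ms cuts the inside of the cycle in two, and h lies in one of the parts
  by \<open>theta_inside\<close>. The edges from h to h' and on to the cycle vertex of the opposite
  arc avoid the boundary of this part, so that vertex would lie inside the part, hence inside the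
  cycle it belongs to. The case h = h' covers a single vertex seen from both arcs.\<close>

lemma no_crossing:
  assumes d: "distinct (a # xs @ b # ys)" and ne: "xs \<noteq> [] \<or> ys \<noteq> []"
    and E: "cycle_edges (a # xs @ b # ys) \<subseteq> E"
    and ms: "ms \<noteq> []" "distinct ms" "set ms \<inter> set (a # xs @ b # ys) = {}" "walk_edges (b # ms @ [a]) \<subseteq> E"
    and msi: "\<And>m. m \<in> set ms \<Longrightarrow> p m \<in> inside (drawing (cycle_edges (a # xs @ b # ys)))"
    and h: "h = h' \<or> {h, h'} \<in> E" "h \<in> V" "h' \<in> V" "h \<notin> set ms" "h' \<notin> set ms"
    and hi: "p h \<in> inside (drawing (cycle_edges (a # xs @ b # ys)))"
      "p h' \<in> inside (drawing (cycle_edges (a # xs @ b # ys)))"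
    and c1: "c1 \<in> set xs" "{h, c1} \<in> E" and c2: "c2 \<in> set ys" "{h', c2} \<in> E"
  shows False
proof -
  let ?vs = "a # xs @ b # ys" and ?x = "a # xs @ [b]" and ?y = "b # ys @ [a]" and ?c = "b # ms @ [a]"
  let ?D = "drawing (cycle_edges ?vs)"
  note sp = cycle_split[OF d ne E]
  have Ex: "walk_edges ?x \<subseteq> E" and Ey: "walk_edges ?y \<subseteq> E" using sp(1) E by auto
  have dc: "distinct ?c" using ms d by auto
  have Ux: "\<Union>(walk_edges ?x) = set ?x" and Uy: "\<Union>(walk_edges ?y) = set ?y"
    and Uc: "\<Union>(walk_edges ?c) = set ?c" by (rule Union_walk_edges; simp)+
  have X: "arc (walk_path ?x) \<and> pathstart (walk_path ?x) = p (hd ?x) \<and>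
      pathfinish (walk_path ?x) = p (last ?x) \<and> path_image (walk_path ?x) = drawing (walk_edges ?x)"
    using d Ex by (intro walk_path) auto
  have Y: "arc (walk_path ?y) \<and> pathstart (walk_path ?y) = p (hd ?y) \<and>
      pathfinish (walk_path ?y) = p (last ?y) \<and> path_image (walk_path ?y) = drawing (walk_edges ?y)"
    using d Ey by (intro walk_path) auto
  have C: "arc (walk_path ?c) \<and> pathstart (walk_path ?c) = p (hd ?c) \<and>
      pathfinish (walk_path ?c) = p (last ?c) \<and> path_image (walk_path ?c) = drawing (walk_edges ?c)"
    using dc ms(4) by (intro walk_path) auto
  have UD: "\<Union>(cycle_edges ?vs) = set ?vs" by (rule Union_cycle_edges) simp
  have DD: "?D = drawing (walk_edges ?x) \<union> drawing (walk_edges ?y)" unfolding sp(1) drawing_Un ..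
  have offD: "v \<notin> set ?vs" if "v \<in> V" "p v \<in> inside ?D" for v
    using vertex_in_drawing[OF E that(1)] UD that(2) inside_no_overlap[of ?D] by blast
  have sub: "drawing (walk_edges ?c) \<subseteq> inside ?D \<union> ?D"
  proof
    fix z assume "z \<in> drawing (walk_edges ?c)"
    then obtain e where e: "e \<in> walk_edges ?c" "z \<in> path_image (\<gamma> e)" by (auto simp: drawing_def)
    obtain i where i: "e = {?c ! i, ?c ! Suc i}" "Suc i < length ?c"
      using e(1) unfolding walk_edges_nth by blast
    \<comment> \<open>As \<open>ms\<close> is not empty, every edge of the dividing walk has an end
      in \<open>ms\<close>, so that all of it except possibly its other end is inside the
      cycle.\<close>
    have "?c ! i \<in> set ms \<or> ?c ! Suc i \<in> set ms"
    proof (cases i)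
      case 0
      then have "?c ! Suc i = ms ! 0" using ms(1) by (simp add: nth_append)
      then show ?thesis using ms(1) by simp
    next
      case (Suc j)
      then show ?thesis using i(2) by (simp add: nth_append)
    qed
    moreover have "?c ! i \<in> set ?c" "?c ! Suc i \<in> set ?c"
      by (rule nth_mem, use i(2) in linarith)+
    moreover have "e = {?c ! Suc i, ?c ! i}" using i(1) by blast
    ultimately obtain u v where uv: "e = {u, v}" "u \<in> set ms" "v \<in> set ?c"
      using i(1) by metis
    have eE: "{u, v} \<in> E" using e(1) uv(1) ms(4) by blast
    have "u \<notin> \<Union>(cycle_edges ?vs)" unfolding UD using ms(3) uv(2) by blast
    then have in1: "path_image (\<gamma> {u, v}) - {p v} \<subseteq> inside ?D"
      using half_edge_inside[OF eE E _ half_edge(3)[OF eE E] msi[OF uv(2)]] by blast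
    have "p v \<in> inside ?D \<union> ?D"
    proof (cases "v \<in> set ms")
      case False
      then have "v \<in> set ?vs" using uv(3) by auto
      then show ?thesis using vertex_in_drawing[OF E, of v] edge_V[OF eE] UD by blast
    qed (use msi in blast)
    then show "z \<in> inside ?D \<union> ?D" using in1 e(2) uv(1) by blast
  qed
  have hs: "h \<notin> set ?vs" "h' \<notin> set ?vs" using offD h hi by blast+
  \<comment> \<open>\<open>W\<close> is the arc bounding the part that contains h, and
    \<open>q\<close> is the one of h, h' with a neighbour \<open>c\<close> on the opposite
    arc.\<close>
  have part: False
    if W: "W \<subseteq> cycle_edges ?vs" and hin: "p h \<in> inside (drawing (W \<union> walk_edges ?c))"
      and q: "q = h \<or> q = h'" "{q, c} \<in> E" "c \<in> set ?vs" "c \<notin> \<Union>(W \<union> walk_edges ?c)" for W q c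
  proof -
    let ?X = "W \<union> walk_edges ?c"
    have XE: "?X \<subseteq> E" using W E ms(4) by blast
    have UX: "\<Union>?X \<subseteq> set ?vs \<union> set ms" using W UD Uc by auto
    have hn: "h \<notin> \<Union>?X" "h' \<notin> \<Union>?X" using UX hs h by blast+
    have "p h' \<in> inside (drawing ?X)"
      using h(1) edge_same_side(1)[OF _ XE hn hin] hin by blast
    then have "p q \<in> inside (drawing ?X)" using q(1) hin by blast
    then have pc: "p c \<in> inside (drawing ?X)"
      using edge_same_side(1)[OF q(2) XE _ q(4)] q(1) hn by blast
    have "drawing ?X \<subseteq> inside ?D \<union> ?D"
      using sub W unfolding drawing_Un by (auto simp: drawing_def)
    then have "inside (drawing ?X) \<subseteq> inside ?D"
      using inside_subset_Jordan_inside[OF sp(3,4) closed_drawing[OF XE]] unfolding sp(5) by blast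
    then have "p c \<in> inside ?D" using pc by blast
    then show False using offD[of c] edge_V[OF q(2)] q(3) by blast
  qed
  have "p h \<notin> drawing (walk_edges ?c)"
    using vertex_in_drawing[OF ms(4) h(2)] hs h(4) Uc by auto
  moreover have "p h \<in> inside (drawing (walk_edges ?x) \<union> drawing (walk_edges ?y))"
    using hi(1) DD by simp
  ultimately have "p h \<in> inside (drawing (walk_edges ?x) \<union> drawing (walk_edges ?c)) \<or>
      p h \<in> inside (drawing (walk_edges ?y) \<union> drawing (walk_edges ?c))"
    using theta_inside[of "walk_path ?x" "walk_path ?y" "walk_path ?c" "p h"] sp(3) X Y C
    by (simp add: arc_imp_path)
  moreover have "c1 \<notin> set ?y" "c1 \<notin> set ?c" "c1 \<in> set ?vs" "c2 \<notin> set ?x" "c2 \<notin> set ?c" "c2 \<in> set ?vs"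
    using c1(1) c2(1) d ms(3) by auto
  moreover have "walk_edges ?x \<subseteq> cycle_edges ?vs" "walk_edges ?y \<subseteq> cycle_edges ?vs"
    unfolding sp(1) by blast+
  ultimately show False
    using part[of "walk_edges ?x" h' c2] part[of "walk_edges ?y" h c1] c1(2) c2(2)
    unfolding drawing_Un Union_Un_distrib Ux Uy Uc by blast
qed

end

section \<open>Triangles and drawings of K4\<close>

lemma nsets_2_triple:
  assumes "a \<noteq> b" "b \<noteq> c" "a \<noteq> c"
  shows "[{a, b, c}]\<^bsup>2\<^esup> = {{a, b}, {b, c}, {c, a}}"
proof
  show "[{a, b, c}]\<^bsup>2\<^esup> \<subseteq> {{a, b}, {b, c}, {c, a}}"
  proof
    fix e assume "e \<in> [{a, b, c}]\<^bsup>2\<^esup>"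
    then obtain x y where "e = {x, y}" "x \<noteq> y" "x \<in> {a, b, c}" "y \<in> {a, b, c}"
      unfolding nsets_def by (auto simp: card_2_iff)
    then show "e \<in> {{a, b}, {b, c}, {c, a}}" by (auto simp: insert_commute)
  qed
qed (use assms in auto)

context plane_graph
begin

definition triangle :: "'v \<Rightarrow> 'v \<Rightarrow> 'v \<Rightarrow> 'v set set" where
  "triangle a b c = {{a, b}, {b, c}, {c, a}}"

lemma triangle_loop:
  assumes "{a, b} \<in> E" "{b, c} \<in> E" "{c, a} \<in> E"
  shows "simple_path (dart a b +++ dart b c +++ dart c a)"
    "pathfinish (dart a b +++ dart b c +++ dart c a) = pathstart (dart a b +++ dart b c +++ dart c a)"
    "path_image (dart a b +++ dart b c +++ dart c a) = drawing (triangle a b c)"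
    "mid {a, b} \<notin> path_image (dart b c +++ dart c a)"
    "\<And>z. z \<in> outside (drawing (triangle a b c)) \<Longrightarrow>
      winding_number (dart a b) z + winding_number (dart b c) z + winding_number (dart c a) z = 0"
proof -
  have ne: "a \<noteq> b" "b \<noteq> c" "c \<noteq> a" using assms edge_V by blast+
  have d: "distinct (a # [] @ b # [c])" using ne by auto
  have cy: "cycle_edges (a # [] @ b # [c]) = triangle a b c"
    by (auto simp: cycle_edges_walk triangle_def)
  have sub: "cycle_edges (a # [] @ b # [c]) \<subseteq> E" unfolding cy using assms by (simp add: triangle_def)
  note sp = cycle_split[OF d _ sub, unfolded cy, simplified]
  show L: "simple_path (dart a b +++ dart b c +++ dart c a)"
    "pathfinish (dart a b +++ dart b c +++ dart c a) = pathstart (dart a b +++ dart b c +++ dart c a)"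
    and im: "path_image (dart a b +++ dart b c +++ dart c a) = drawing (triangle a b c)"
    using sp by simp_all
  note ab = dart[OF assms(1)] and bc = dart[OF assms(2)] and ca = dart[OF assms(3)]
  have "mid {a, b} \<notin> path_image (\<gamma> {b, c})" "mid {a, b} \<notin> path_image (\<gamma> {c, a})"
    using mid(3)[OF assms(1)] assms ne by (auto simp: doubleton_eq_iff)
  then show "mid {a, b} \<notin> path_image (dart b c +++ dart c a)"
    using bc ca by (simp add: path_image_join)
  fix z assume z: "z \<in> outside (drawing (triangle a b c))"
  then have "winding_number (dart a b +++ dart b c +++ dart c a) z = 0"
    using L unfolding im[symmetric]
    by (intro winding_number_zero_in_outside) (auto simp: simple_path_imp_path)
  moreover have "z \<notin> path_image (dart a b +++ dart b c +++ dart c a)"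
    unfolding im using z outside_no_overlap by blast
  ultimately show "winding_number (dart a b) z + winding_number (dart b c) z + winding_number (dart c a) z = 0"
    using ab bc ca by (simp add: winding_number_join arc_imp_path path_image_join add.assoc)
qed

lemma half_edge_outside:
  assumes e: "{u, v} \<in> E" and X: "X \<subseteq> E" "u \<notin> \<Union>X" and u: "p u \<notin> inside (drawing X)"
  shows "path_image (\<gamma> {u, v}) - {p v} \<subseteq> outside (drawing X)"
proof (rule connected_subset_outside[OF half_edge(1,2)[OF e X] half_edge(3)[OF e X]])
  have "p u \<notin> drawing X" using vertex_in_drawing[OF X(1)] X(2) edge_V[OF e] by blast
  then show "p u \<in> outside (drawing X)" using u by (simp add: outside_inside)
qed

text \<open>Otherwise the midpoint of ab is outside the triangles bcd and cad, and their vanishing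
  winding numbers add up to the statement that the detours from b to a via c and via d wind equally
  around it. So abc and abd have a common inside point near it. As neither drawing enters the inside
  of the other, the insides agree, hence so do the boundaries, although only one of them contains
  c.\<close>

lemma K4:
  assumes e: "{a, b} \<in> E" "{b, c} \<in> E" "{c, a} \<in> E" "{a, d} \<in> E" "{b, d} \<in> E" "{c, d} \<in> E"
  shows "p a \<in> inside (drawing (triangle b c d)) \<or> p b \<in> inside (drawing (triangle c a d)) \<or>
    p c \<in> inside (drawing (triangle a b d)) \<or> p d \<in> inside (drawing (triangle a b c))"
proof (rule ccontr)
  assume "\<not> ?thesis"
  then have na: "p a \<notin> inside (drawing (triangle b c d))" and nb: "p b \<notin> inside (drawing (triangle c a d))"
    and nc: "p c \<notin> inside (drawing (triangle a b d))" and nd: "p d \<notin> inside (drawing (triangle a b c))"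
    by blast+
  have e': "{b, a} \<in> E" "{c, b} \<in> E" "{a, c} \<in> E" "{d, a} \<in> E" "{d, b} \<in> E" "{d, c} \<in> E"
    using e by (simp_all add: insert_commute)
  have ne: "a \<noteq> b" "b \<noteq> c" "c \<noteq> a" "a \<noteq> d" "b \<noteq> d" "c \<noteq> d" using e edge_V by blast+
  have V: "a \<in> V" "b \<in> V" "c \<in> V" "d \<in> V" using e edge_V by blast+
  have T: "triangle b c d \<subseteq> E" "triangle c a d \<subseteq> E" "triangle a b d \<subseteq> E" "triangle a b c \<subseteq> E"
    using e e' by (simp_all add: triangle_def)
  let ?z = "mid {a, b}"
  have zm: "?z \<in> path_image (\<gamma> {a, b})" "?z \<noteq> p a" "?z \<noteq> p b" using mid(1,2)[OF e(1)] V by auto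
  have U: "\<Union>(triangle x y z) = {x, y, z}" for x y z by (auto simp: triangle_def)
  have "?z \<in> outside (drawing (triangle b c d))"
    using half_edge_outside[OF e(1) T(1) _ na] zm ne U[of b c d] by auto
  then have w1: "winding_number (dart b c) ?z + winding_number (dart c d) ?z + winding_number (dart d b) ?z = 0"
    by (rule triangle_loop(5)[OF e(2) e(6) e'(5)])
  have "?z \<in> outside (drawing (triangle c a d))"
    using half_edge_outside[OF e'(1) T(2) _ nb] zm ne U[of c a d] by (auto simp: insert_commute)
  then have w2: "winding_number (dart c a) ?z + winding_number (dart a d) ?z + winding_number (dart d c) ?z = 0"
    by (rule triangle_loop(5)[OF e(3,4) e'(6)])
  have off: "?z \<notin> path_image (\<gamma> {b, c})" "?z \<notin> path_image (\<gamma> {c, a})" "?z \<notin> path_image (\<gamma> {a, d})"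
    "?z \<notin> path_image (\<gamma> {b, d})" "?z \<notin> path_image (\<gamma> {c, d})"
    by (rule mid(3)[OF e(1)]; use e ne in \<open>auto simp: doubleton_eq_iff\<close>)+
  note D = dart[OF e(1)] dart[OF e(2)] dart[OF e(3)] dart[OF e(4)] dart[OF e(5)] dart[OF e(6)]
  have wr: "winding_number (dart d c) ?z = - winding_number (dart c d) ?z"
    "winding_number (dart d b) ?z = - winding_number (dart b d) ?z"
    "winding_number (dart d a) ?z = - winding_number (dart a d) ?z"
    using D off by (simp_all add: winding_number_reversepath arc_imp_path)
  have j1: "winding_number (dart b c +++ dart c a) ?z = winding_number (dart b c) ?z + winding_number (dart c a) ?z"
    using D off by (intro winding_number_join) (auto simp: arc_imp_path)
  have j2: "winding_number (dart b d +++ dart d a) ?z = winding_number (dart b d) ?z + winding_number (dart d a) ?z"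
    using D off by (intro winding_number_join) (auto simp: arc_imp_path)
  \<comment> \<open>The contributions of cd cancel in the sum of the two vanishing winding
    numbers.\<close>
  have eq: "winding_number (dart b c +++ dart c a) ?z - winding_number (dart b d +++ dart d a) ?z = 0"
    unfolding j1 j2 using w1 w2 wr by algebra
  note L1 = triangle_loop[OF e(1-3)] and L2 = triangle_loop[OF e(1,5) e'(4)]
  let ?r1 = "dart b c +++ dart c a" and ?r2 = "dart b d +++ dart d a"
  have pth: "path (dart a b)" "path ?r1" "path ?r2" using D by (simp_all add: arc_imp_path)
  have ends: "pathfinish (dart a b) = pathstart ?r1" "pathfinish (dart a b) = pathstart ?r2"
      "pathfinish ?r1 = pathstart (dart a b)" "pathfinish ?r2 = pathstart (dart a b)"
    using D by simp_all
  obtain \<delta> where \<delta>: "0 < \<delta>" "\<And>y. y \<in> ball ?z \<delta> \<Longrightarrow> y \<notin> path_image (dart a b) \<Longrightarrow>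
    y \<notin> path_image ?r1 \<and> y \<notin> path_image ?r2 \<and>
    winding_number (dart a b +++ ?r1) y - winding_number (dart a b +++ ?r2) y
      = winding_number ?r1 ?z - winding_number ?r2 ?z"
    using common_part_winding[OF pth ends L1(4) L2(4)] by blast
  note J1 = Jordan_inside_outside[OF L1(1,2), unfolded L1(3)]
    and J2 = Jordan_inside_outside[OF L2(1,2), unfolded L2(3)]
  have "?z \<in> closure (inside (drawing (triangle a b c)))"
    using J1 zm(1) unfolding frontier_def by (auto simp: drawing_def triangle_def)
  then have "ball ?z \<delta> \<inter> closure (inside (drawing (triangle a b c))) \<noteq> {}"
      using centre_in_ball[of "?z" \<delta>] \<delta>(1) by blast
  then have "ball ?z \<delta> \<inter> inside (drawing (triangle a b c)) \<noteq> {}"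
    using open_Int_closure_eq_empty[OF open_ball] by blast
  then obtain y where y: "y \<in> ball ?z \<delta>" "y \<in> inside (drawing (triangle a b c))" by blast
  have yn: "y \<notin> drawing (triangle a b c)" using y(2) inside_no_overlap by blast
  have ye: "y \<notin> path_image (dart a b)"
    using yn D(4) by (auto simp: drawing_def triangle_def)
  have weq: "winding_number (dart a b +++ ?r1) y = winding_number (dart a b +++ ?r2) y"
    and yr: "y \<notin> path_image ?r2" using \<delta>(2)[OF y(1) ye] eq by auto
  obtain s1 where s1: "s1 \<noteq> 0" "\<And>y. y \<notin> path_image (dart a b +++ ?r1) \<Longrightarrow>
    winding_number (dart a b +++ ?r1) y = (if y \<in> inside (path_image (dart a b +++ ?r1)) then s1 else 0)"
    using Jordan_winding[OF L1(1,2)] by blast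
  obtain s2 where s2: "s2 \<noteq> 0" "\<And>y. y \<notin> path_image (dart a b +++ ?r2) \<Longrightarrow>
    winding_number (dart a b +++ ?r2) y = (if y \<in> inside (path_image (dart a b +++ ?r2)) then s2 else 0)"
    using Jordan_winding[OF L2(1,2)] by blast
  have yn2: "y \<notin> path_image (dart a b +++ ?r2)" using ye yr ends by (simp add: path_image_join)
  have "winding_number (dart a b +++ ?r1) y = s1" using s1(2)[of y] y(2) yn unfolding L1(3) by simp
  then have y2: "y \<in> inside (drawing (triangle a b d))"
    using s2(2)[OF yn2] s1(1) weq unfolding L2(3) by (auto split: if_splits)
  \<comment> \<open>The only corner of \<open>triangle a b y\<close> off
    \<open>triangle a b x\<close> is y; as it is not inside, no edge of the first triangle enters
    the inside of the second.\<close>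
  have disj: "inside (drawing (triangle a b x)) \<inter> drawing (triangle a b y) = {}"
    if "p y \<notin> inside (drawing (triangle a b x))" "triangle a b x \<subseteq> E" "triangle a b y \<subseteq> E"
      "y \<noteq> a" "y \<noteq> b" "y \<noteq> x" for x y
  proof -
    let ?D = "drawing (triangle a b x)"
    have n: "y \<notin> \<Union>(triangle a b x)" using that U by simp
    have ey: "{y, a} \<in> E" "{y, b} \<in> E" using that(3) by (auto simp: triangle_def insert_commute)
    have "path_image (\<gamma> {y, a}) - {p a} \<subseteq> outside ?D" "path_image (\<gamma> {y, b}) - {p b} \<subseteq> outside ?D"
      using half_edge_outside[OF _ that(2) n that(1)] ey by blast+
    moreover have "p a \<in> ?D" "p b \<in> ?D" using vertex_in_drawing[OF that(2)] V U by auto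
    moreover have "path_image (\<gamma> {a, b}) \<subseteq> ?D" by (auto simp: drawing_def triangle_def)
    moreover have "drawing (triangle a b y) =
        path_image (\<gamma> {a, b}) \<union> path_image (\<gamma> {y, b}) \<union> path_image (\<gamma> {y, a})"
      by (auto simp: drawing_def triangle_def insert_commute)
    ultimately have "drawing (triangle a b y) \<subseteq> outside ?D \<union> ?D" by blast
    then show ?thesis using inside_Int_outside[of ?D] inside_no_overlap[of ?D] by blast
  qed
  have "inside (drawing (triangle a b c)) \<subseteq> inside (drawing (triangle a b d))"
    by (rule connected_subset_inside[OF _ _ y(2) y2]) (use J1 disj[OF nd T(4,3)] ne in auto)
  moreover have "inside (drawing (triangle a b d)) \<subseteq> inside (drawing (triangle a b c))"
    by (rule connected_subset_inside[OF _ _ y2 y(2)]) (use J2 disj[OF nc T(3,4)] ne in auto)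
  ultimately have "inside (drawing (triangle a b c)) = inside (drawing (triangle a b d))" by blast
  then have "drawing (triangle a b c) = drawing (triangle a b d)" using J1 J2 by metis
  then show False
    using vertex_in_drawing[OF T(4) V(3)] vertex_in_drawing[OF T(3) V(3)] U ne by auto
qed

end

subsection \<open>Faces\<close>

locale plane_triang = plane_graph V E p \<gamma> for V :: "'v set" and E p \<gamma> +
  assumes face_triangle: "F \<in> faces V E p \<gamma> \<Longrightarrow>
    \<exists>T \<in> [V]\<^bsup>3\<^esup>. clique T E \<and> frontier F = (\<Union>e\<in>[T]\<^bsup>2\<^esup>. path_image (\<gamma> e))"
begin

abbreviation Faces :: "complex set set" where "Faces \<equiv> faces V E p \<gamma>"

text \<open>The corners are read off the frontier, which spares naming the bounding triangle of
  F.\<close>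

definition tri :: "complex set \<Rightarrow> 'v set" where "tri F = {v \<in> V. p v \<in> frontier F}"

lemma face_props:
  assumes "F \<in> Faces"
  shows "F \<noteq> {}" "connected F" "F \<inter> drawing E = {}" "F \<inter> p ` V = {}"
  using in_components_nonempty[of F] in_components_connected[of F] in_components_subset[of F]
    assms unfolding faces_def drawing_def by blast+

lemma face_disjoint: "F \<in> Faces \<Longrightarrow> X \<subseteq> E \<Longrightarrow> F \<inter> drawing X = {}"
  using face_props(3)[of F] unfolding drawing_def by blast

lemma face_obtain:
  assumes F: "F \<in> Faces"
  obtains a b c where "tri F = {a, b, c}" "{a, b} \<in> E" "{b, c} \<in> E" "{c, a} \<in> E"
    "frontier F = drawing (triangle a b c)"
proof -
  obtain T where T: "T \<in> [V]\<^bsup>3\<^esup>" "clique T E" "frontier F = drawing ([T]\<^bsup>2\<^esup>)"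
    using face_triangle[OF F] unfolding drawing_def by blast
  obtain a b c where abc: "T = {a, b, c}" "a \<noteq> b" "b \<noteq> c" "a \<noteq> c"
    using T(1) unfolding nsets_def by (auto simp: card_3_iff)
  have E: "{a, b} \<in> E" "{b, c} \<in> E" "{c, a} \<in> E" using T(2) abc unfolding clique_def by auto
  have fr: "frontier F = drawing (triangle a b c)"
    unfolding T(3) abc(1) nsets_2_triple[OF abc(2-4)] triangle_def ..
  have "triangle a b c \<subseteq> E" using E by (simp add: triangle_def)
  moreover have "\<Union>(triangle a b c) = {a, b, c}" by (auto simp: triangle_def)
  ultimately have "tri F = {a, b, c}"
    unfolding tri_def fr using vertex_in_drawing[of "triangle a b c"] E edge_V by blast
  then show thesis using that E fr by blast
qed

lemma face_obtain_edge:
  assumes F: "F \<in> Faces" and ab: "{a, b} \<subseteq> tri F" "a \<noteq> b"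
  obtains c where "tri F = {a, b, c}" "{a, b} \<in> E" "{b, c} \<in> E" "{c, a} \<in> E"
    "frontier F = drawing (triangle a b c)"
proof -
  obtain x y z where t: "tri F = {x, y, z}" "{x, y} \<in> E" "{y, z} \<in> E" "{z, x} \<in> E"
    "frontier F = drawing (triangle x y z)"
    using F by (rule face_obtain)
  have "x \<noteq> y" "y \<noteq> z" "z \<noteq> x" using t edge_V by blast+
  then obtain c where c: "{x, y, z} = {a, b, c}" "c \<noteq> a" "c \<noteq> b" using t(1) ab by auto
  have eq: "triangle x y z = triangle a b c"
    using nsets_2_triple[of x y z] nsets_2_triple[of a b c] c ab(2) \<open>x \<noteq> y\<close> \<open>y \<noteq> z\<close> \<open>z \<noteq> x\<close>
    unfolding triangle_def by metis
  have "triangle a b c \<subseteq> E" unfolding eq[symmetric] using t by (simp add: triangle_def)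
  then show thesis using that[of c] t c eq by (simp add: triangle_def)
qed

lemma face_side:
  assumes F: "F \<in> Faces" and X: "X \<subseteq> E"
  shows "F \<subseteq> inside (drawing X) \<or> F \<subseteq> outside (drawing X)"
    "F \<inter> inside (drawing X) \<noteq> {} \<Longrightarrow> F \<subseteq> inside (drawing X)"
    "F \<inter> outside (drawing X) \<noteq> {} \<Longrightarrow> F \<subseteq> outside (drawing X)"
proof -
  note d = face_disjoint[OF F X]
  show i: "F \<subseteq> inside (drawing X)" if "F \<inter> inside (drawing X) \<noteq> {}"
    using connected_subset_inside[OF face_props(2)[OF F] d] that by blast
  show o: "F \<subseteq> outside (drawing X)" if "F \<inter> outside (drawing X) \<noteq> {}"
    using connected_subset_outside[OF face_props(2)[OF F] d] that by blast
  obtain z where z: "z \<in> F" using face_props(1)[OF F] by blast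
  then have "z \<in> inside (drawing X) \<or> z \<in> outside (drawing X)"
    using d by (auto simp: inside_outside)
  then show "F \<subseteq> inside (drawing X) \<or> F \<subseteq> outside (drawing X)" using i o z by blast
qed

text \<open>If the face were a proper part of the side A containing it, the connected set A would
  meet the frontier of the face, which is the triangle itself.\<close>

lemma face_is_side:
  assumes F: "F \<in> Faces" and fr: "frontier F = drawing (triangle a b c)"
    and e: "{a, b} \<in> E" "{b, c} \<in> E" "{c, a} \<in> E"
  shows "F = inside (drawing (triangle a b c)) \<or> F = outside (drawing (triangle a b c))"
proof -
  let ?D = "drawing (triangle a b c)"
  have X: "triangle a b c \<subseteq> E" using e by (simp add: triangle_def)
  note L = triangle_loop[OF e]
  note J = Jordan_inside_outside[OF L(1,2), unfolded L(3)]
  have *: "F = A" if A: "F \<subseteq> A" "connected A" "A \<inter> ?D = {}" for A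
  proof (rule ccontr)
    assume "F \<noteq> A"
    then have "A - F \<noteq> {}" "A \<inter> F \<noteq> {}" using A face_props(1)[OF F] by blast+
    then have "A \<inter> frontier F \<noteq> {}" using A(2) by (intro connected_Int_frontier) auto
    then show False using fr A(3) by simp
  qed
  have "inside ?D \<inter> ?D = {}" "outside ?D \<inter> ?D = {}" using inside_no_overlap[of ?D] outside_no_overlap[of ?D] by blast+
  then show ?thesis using face_side(1)[OF F X] * J by metis
qed

text \<open>By \<open>face_is_side\<close> a face is given by three vertices and the choice of a
  side.\<close>

lemma finite_Faces: "finite Faces"
proof -
  have "Faces \<subseteq> (\<lambda>(a, b, c). inside (drawing (triangle a b c))) ` (V \<times> V \<times> V) \<union>
      (\<lambda>(a, b, c). outside (drawing (triangle a b c))) ` (V \<times> V \<times> V)"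
  proof
    fix F assume F: "F \<in> Faces"
    obtain a b c where abc: "tri F = {a, b, c}" "{a, b} \<in> E" "{b, c} \<in> E" "{c, a} \<in> E"
      "frontier F = drawing (triangle a b c)"
      using F by (rule face_obtain)
    have "(a, b, c) \<in> V \<times> V \<times> V" using abc edge_V by blast
    moreover have "F = inside (drawing (triangle a b c)) \<or> F = outside (drawing (triangle a b c))"
      by (rule face_is_side[OF F abc(5,2-4)])
    ultimately show "F \<in> (\<lambda>(a, b, c). inside (drawing (triangle a b c))) ` (V \<times> V \<times> V) \<union>
      (\<lambda>(a, b, c). outside (drawing (triangle a b c))) ` (V \<times> V \<times> V)"
      by (metis (mono_tags, lifting) UnCI case_prod_conv image_eqI)
  qed
  then show ?thesis using finite_V by (auto intro: finite_subset)
qed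

section \<open>Counting the faces at an edge\<close>

text \<open>Around \<open>mid e\<close> nothing but e is drawn, so points of A nearby belong to
  faces contained in A. As there are finitely many faces, one of these has \<open>mid e\<close> in
  its closure, and the edge of its triangle through this point can only be e.\<close>

lemma face_at_edge:
  assumes X: "X \<subseteq> E" "e \<in> X" and A: "open A" "frontier A = drawing X"
    and side: "\<And>F. F \<in> Faces \<Longrightarrow> F \<inter> A \<noteq> {} \<Longrightarrow> F \<subseteq> A"
  shows "\<exists>F\<in>Faces. F \<subseteq> A \<and> e \<subseteq> tri F"
proof -
  have eE: "e \<in> E" using X by blast
  note m = mid[OF eE]
  let ?Y = "p ` V \<union> drawing (E - {e})"
  have "closed ?Y" using finite_V by (intro closed_Un finite_imp_closed closed_drawing) auto
  moreover have "mid e \<notin> ?Y" using m by (auto simp: drawing_def)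
  ultimately obtain r where r: "0 < r" "ball (mid e) r \<subseteq> - ?Y"
    using openE[of "- ?Y" "mid e"] by (auto simp: open_closed)
  have eX: "path_image (\<gamma> e) \<subseteq> drawing X" using X(2) by (auto simp: drawing_def)
  then have "mid e \<in> closure A" using m(1) A(2) unfolding frontier_def by blast
  then have "mid e \<in> closure (ball (mid e) r \<inter> A)"
    using open_Int_closure_subset[of "ball (mid e) r" A] r(1) by auto
  moreover have "ball (mid e) r \<inter> A \<subseteq> \<Union>{F \<in> Faces. F \<subseteq> A}"
  proof
    fix z assume z: "z \<in> ball (mid e) r \<inter> A"
    have "A \<inter> drawing X = {}" using A by (auto simp: frontier_def interior_open)
    then have "z \<notin> path_image (\<gamma> e)" using z eX by blast
    moreover have "z \<notin> ?Y" using z r(2) by blast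
    ultimately have "z \<in> - (p ` V \<union> (\<Union>e\<in>E. path_image (\<gamma> e)))" by (auto simp: drawing_def)
    then obtain F where F: "F \<in> Faces" "z \<in> F" unfolding faces_def by (metis UnionE Union_components)
    then have "F \<subseteq> A" using side z by blast
    then show "z \<in> \<Union>{F \<in> Faces. F \<subseteq> A}" using F by blast
  qed
  ultimately have "mid e \<in> closure (\<Union>{F \<in> Faces. F \<subseteq> A})" using closure_mono by blast
  moreover have "closure (\<Union>{F \<in> Faces. F \<subseteq> A}) \<subseteq> (\<Union>F\<in>{F \<in> Faces. F \<subseteq> A}. closure F)"
  proof (rule closure_minimal)
    show "closed (\<Union>F\<in>{F \<in> Faces. F \<subseteq> A}. closure F)"
      by (rule closed_UN) (use finite_Faces in auto)
  qed (use closure_subset in blast)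
  ultimately obtain F where F: "F \<in> Faces" "F \<subseteq> A" "mid e \<in> closure F" by blast
  have "mid e \<notin> F" using face_disjoint[OF F(1), of "{e}"] eE m(1) by (auto simp: drawing_def)
  then have "mid e \<in> frontier F" using F(3) interior_subset unfolding frontier_def by blast
  moreover obtain a b c where abc: "tri F = {a, b, c}" "{a, b} \<in> E" "{b, c} \<in> E" "{c, a} \<in> E"
    "frontier F = drawing (triangle a b c)" using F(1) by (rule face_obtain)
  ultimately obtain f where f: "f \<in> triangle a b c" "mid e \<in> path_image (\<gamma> f)" by (auto simp: drawing_def)
  then have "f \<in> E" using abc by (auto simp: triangle_def)
  then have "f = e" using m(3) f(2) by blast
  then have "e \<subseteq> tri F" using f(1) abc(1) by (auto simp: triangle_def)
  then show ?thesis using F by blast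
qed

text \<open>The cycle and the triangle bounding F share the edge ab. Points of F and G near its
  midpoint are on the same side of the cycle, hence by \<open>common_part_sides\<close> on the same
  side of the triangle, and F is the whole of that side.\<close>

lemma face_unique:
  assumes d: "distinct (a # b # ys)" "ys \<noteq> []" and E: "cycle_edges (a # b # ys) \<subseteq> E"
    and F: "F \<in> Faces" "{a, b} \<subseteq> tri F" and G: "G \<in> Faces" "{a, b} \<subseteq> tri G"
    and side: "F \<subseteq> inside (drawing (cycle_edges (a # b # ys))) \<longleftrightarrow>
      G \<subseteq> inside (drawing (cycle_edges (a # b # ys)))"
  shows "F = G"
proof -
  let ?D = "drawing (cycle_edges (a # b # ys))" and ?r1 = "walk_path (b # ys @ [a])"
  have "a \<noteq> b" using d by auto
  obtain c where c: "tri F = {a, b, c}" "{a, b} \<in> E" "{b, c} \<in> E" "{c, a} \<in> E"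
    "frontier F = drawing (triangle a b c)" using F \<open>a \<noteq> b\<close> by (rule face_obtain_edge)
  obtain c' where c': "tri G = {a, b, c'}" "{a, b} \<in> E" "{b, c'} \<in> E" "{c', a} \<in> E"
    "frontier G = drawing (triangle a b c')" using G \<open>a \<noteq> b\<close> by (rule face_obtain_edge)
  have d': "distinct (a # [] @ b # ys)" and ne: "[] \<noteq> [] \<or> ys \<noteq> []" and E': "cycle_edges (a # [] @ b # ys) \<subseteq> E"
    using d E by auto
  note sp = cycle_split[OF d' ne E', simplified append_Nil]
  have w2: "walk_path [a, b] = dart a b" "walk_edges [a, b] = {{a, b}}" by simp_all
  have L1: "simple_path (dart a b +++ ?r1)"
    "pathfinish (dart a b +++ ?r1) = pathstart (dart a b +++ ?r1)"
    "path_image (dart a b +++ ?r1) = ?D" using sp(3-5) unfolding w2 by auto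
  have wE: "walk_edges (b # ys @ [a]) \<subseteq> E" "{a, b} \<notin> walk_edges (b # ys @ [a])"
    using sp(1,2) E unfolding w2 by auto
  have "distinct (b # ys @ [a])" using d by auto
  then have Y: "arc ?r1 \<and> pathstart ?r1 = p (hd (b # ys @ [a])) \<and>
      pathfinish ?r1 = p (last (b # ys @ [a])) \<and> path_image ?r1 = drawing (walk_edges (b # ys @ [a]))"
    using wE(1) by (intro walk_path) auto
  note D = dart[OF c(2)] dart[OF c(3)] dart[OF c(4)]
  note L2 = triangle_loop[OF c(2-4)]
  note m = mid[OF c(2)]
  have "mid {a, b} \<notin> path_image (\<gamma> f)" if "f \<in> walk_edges (b # ys @ [a])" for f
    using m(3)[of f] wE that by blast
  then have z1: "mid {a, b} \<notin> path_image ?r1" using Y by (auto simp: drawing_def)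
  have ends: "pathfinish (dart a b) = pathstart ?r1" "pathfinish (dart a b) = pathstart (dart b c +++ dart c a)"
      "pathfinish ?r1 = pathstart (dart a b)" "pathfinish (dart b c +++ dart c a) = pathstart (dart a b)"
    using D Y by simp_all
  obtain \<delta> where \<delta>: "0 < \<delta>" "\<And>y y'. y \<in> ball (mid {a, b}) \<delta> \<Longrightarrow> y' \<in> ball (mid {a, b}) \<delta> \<Longrightarrow>
      y \<notin> path_image (dart a b) \<Longrightarrow> y' \<notin> path_image (dart a b) \<Longrightarrow>
      (y \<in> inside ?D \<longleftrightarrow> y' \<in> inside ?D) \<Longrightarrow>
      (y \<in> inside (drawing (triangle a b c)) \<longleftrightarrow> y' \<in> inside (drawing (triangle a b c)))"
    using common_part_sides[OF L1(1) L2(1) ends z1 L2(4)] unfolding L1(3) L2(3) by blast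
  have near: "\<exists>y. y \<in> ball (mid {a, b}) \<delta> \<inter> H" if "H \<in> Faces" "frontier H = drawing (triangle a b x)" for H x
  proof -
    have "mid {a, b} \<in> closure H"
      using that(2) m(1) unfolding frontier_def by (auto simp: drawing_def triangle_def)
    then have "ball (mid {a, b}) \<delta> \<inter> closure H \<noteq> {}"
      using centre_in_ball[of "mid {a, b}" \<delta>] \<delta>(1) by blast
    then have "ball (mid {a, b}) \<delta> \<inter> H \<noteq> {}"
      using open_Int_closure_eq_empty[OF open_ball] by blast
    then show ?thesis by blast
  qed
  obtain y where y: "y \<in> ball (mid {a, b}) \<delta>" "y \<in> F" using near[OF F(1) c(5)] by blast
  obtain y' where y': "y' \<in> ball (mid {a, b}) \<delta>" "y' \<in> G" using near[OF G(1) c'(5)] by blast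
  have off: "y \<notin> path_image (dart a b)" "y' \<notin> path_image (dart a b)"
    using face_disjoint[OF F(1), of "{{a, b}}"] face_disjoint[OF G(1), of "{{a, b}}"] c(2) y(2) y'(2) D(4)
    by (auto simp: drawing_def)
  have ss: "w \<in> inside ?D \<longleftrightarrow> H \<subseteq> inside ?D" if "H \<in> Faces" "w \<in> H" for w H
    using face_side(2)[OF that(1) E] that by blast
  have "y \<in> inside ?D \<longleftrightarrow> y' \<in> inside ?D" using ss[OF F(1) y(2)] ss[OF G(1) y'(2)] side by blast
  then have same: "y \<in> inside (drawing (triangle a b c)) \<longleftrightarrow> y' \<in> inside (drawing (triangle a b c))"
    using \<delta>(2) y(1) y'(1) off by blast
  have T: "triangle a b c \<subseteq> E" using c by (simp add: triangle_def)
  have "y' \<notin> drawing (triangle a b c)" using face_disjoint[OF G(1) T] y'(2) by blast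
  then have "y' \<in> F"
    using face_is_side[OF F(1) c(5,2-4)] same y(2)
      inside_Int_outside[of "drawing (triangle a b c)"]
    by (auto simp: outside_inside)
  then show "F = G"
    using components_nonoverlap[of F _ G] F(1) G(1) y'(2) unfolding faces_def by blast
qed

lemma card_faces_side:
  assumes d: "distinct (a # b # ys)" "ys \<noteq> []" and E: "cycle_edges (a # b # ys) \<subseteq> E"
  shows "card {F \<in> Faces. F \<subseteq> inside (drawing (cycle_edges (a # b # ys))) \<and> {a, b} \<subseteq> tri F} = 1"
    "card {F \<in> Faces. F \<subseteq> outside (drawing (cycle_edges (a # b # ys))) \<and> {a, b} \<subseteq> tri F} = 1"
proof -
  let ?D = "drawing (cycle_edges (a # b # ys))"
  have "3 \<le> length (a # b # ys)" using d by (cases ys) auto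
  then obtain c where c: "simple_path c" "pathfinish c = pathstart c" "path_image c = ?D"
    using cycle_loop[OF d(1) _ E] by blast
  note J = Jordan_inside_outside[OF c(1,2), unfolded c(3)]
  have e: "{a, b} \<in> cycle_edges (a # b # ys)" by (simp add: cycle_edges_walk)
  obtain F where F: "F \<in> Faces" "F \<subseteq> inside ?D" "{a, b} \<subseteq> tri F"
    using face_at_edge[OF E e, of "inside ?D"] J face_side(2)[OF _ E] by blast
  obtain G where G: "G \<in> Faces" "G \<subseteq> outside ?D" "{a, b} \<subseteq> tri G"
    using face_at_edge[OF E e, of "outside ?D"] J face_side(3)[OF _ E] by blast
  have no: "\<not> H \<subseteq> inside ?D" if "H \<in> Faces" "H \<subseteq> outside ?D" for H
    using that face_props(1)[OF that(1)] J by blast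
  have "H = F" if "H \<in> Faces" "H \<subseteq> inside ?D" "{a, b} \<subseteq> tri H" for H
    using face_unique[OF d E that(1,3) F(1,3)] that(2) F(2) by blast
  then have "{F \<in> Faces. F \<subseteq> inside ?D \<and> {a, b} \<subseteq> tri F} = {F}"
    using F by blast
  then show "card {F \<in> Faces. F \<subseteq> inside ?D \<and> {a, b} \<subseteq> tri F} = 1" by simp
  have "H = G" if "H \<in> Faces" "H \<subseteq> outside ?D" "{a, b} \<subseteq> tri H" for H
    using face_unique[OF d E that(1,3) G(1,3)] no[OF that(1,2)] no[OF G(1,2)] by blast
  then have "{F \<in> Faces. F \<subseteq> outside ?D \<and> {a, b} \<subseteq> tri F} = {G}"
    using G by blast
  then show "card {F \<in> Faces. F \<subseteq> outside ?D \<and> {a, b} \<subseteq> tri F} = 1" by simp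
qed

text \<open>The count is 0 or 2: once there is a face at the edge, its own triangle serves as the
  cycle in \<open>card_faces_side\<close>, with one face on either side.\<close>

lemma even_card_faces_edge:
  assumes "a \<noteq> b"
  shows "even (card {F \<in> Faces. {a, b} \<subseteq> tri F})"
proof (cases "{F \<in> Faces. {a, b} \<subseteq> tri F} = {}")
  case False
  then obtain F where F: "F \<in> Faces" "{a, b} \<subseteq> tri F" by blast
  obtain c where c: "tri F = {a, b, c}" "{a, b} \<in> E" "{b, c} \<in> E" "{c, a} \<in> E"
    "frontier F = drawing (triangle a b c)" using F assms by (rule face_obtain_edge)
  have "c \<noteq> a" "c \<noteq> b" using c edge_V by blast+
  then have d: "distinct (a # b # [c])" "[c] \<noteq> []" using assms by auto
  have E: "cycle_edges (a # b # [c]) \<subseteq> E" using c by (simp add: cycle_edges_walk)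
  let ?D = "drawing (cycle_edges (a # b # [c]))"
  have "{F \<in> Faces. {a, b} \<subseteq> tri F} = {F \<in> Faces. F \<subseteq> inside ?D \<and> {a, b} \<subseteq> tri F} \<union>
      {F \<in> Faces. F \<subseteq> outside ?D \<and> {a, b} \<subseteq> tri F}"
    using face_side(1)[OF _ E] by blast
  moreover have "card ({F \<in> Faces. F \<subseteq> inside ?D \<and> {a, b} \<subseteq> tri F} \<union>
      {F \<in> Faces. F \<subseteq> outside ?D \<and> {a, b} \<subseteq> tri F}) = 1 + 1"
  proof (subst card_Un_disjoint)
    show "{F \<in> Faces. F \<subseteq> inside ?D \<and> {a, b} \<subseteq> tri F} \<inter>
      {F \<in> Faces. F \<subseteq> outside ?D \<and> {a, b} \<subseteq> tri F} = {}"
    proof -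
      have False if "F \<in> Faces" "F \<subseteq> inside ?D" "F \<subseteq> outside ?D" for F
        using face_props(1)[OF that(1)] that(2,3) inside_Int_outside[of ?D] by blast
      then show ?thesis by blast
    qed
  qed (use card_faces_side[OF d E] finite_Faces in auto)
  ultimately show ?thesis by simp
qed (simp only: card.empty even_zero)

text \<open>A handshake argument. Let K be the component of a in the link N of c, and count pairs of
  a face inside the cycle at c and a corner of it in K. Each face contributes 0 or 2, as its two
  corners other than c are adjacent. If b were not in K, every member of K except a would be an
  inner vertex, whose edge to c lies on an even number of faces, all inside; but ca lies on exactly
  one face inside, which makes the total odd.\<close>

lemma link_connected:
  assumes d: "distinct (c # a # ys @ [b])" and E: "cycle_edges (c # a # ys @ [b]) \<subseteq> E"
    and chord: "\<And>y. y \<in> set ys \<Longrightarrow> {c, y} \<notin> E"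
    and W: "W = set (c # a # ys @ [b]) \<union> {v \<in> V. p v \<in> inside (drawing (cycle_edges (c # a # ys @ [b])))}"
    and N: "N = {x \<in> W. {c, x} \<in> E}"
  shows "(a, b) \<in> {(u, v). u \<in> N \<and> v \<in> N \<and> {u, v} \<in> E}\<^sup>*"
proof (rule ccontr)
  let ?vs = "c # a # ys @ [b]"
  let ?D = "drawing (cycle_edges ?vs)" and ?R = "{(u, v). u \<in> N \<and> v \<in> N \<and> {u, v} \<in> E}"
  assume not: "(a, b) \<notin> ?R\<^sup>*"
  have ce: "{c, a} \<in> cycle_edges ?vs" by (simp add: cycle_edges_walk)
  have caE: "{c, a} \<in> E" using ce E by blast
  have UD: "\<Union>(cycle_edges ?vs) = set ?vs" by (rule Union_cycle_edges) simp
  have WV: "W \<subseteq> V" using W UD E edge_subset by blast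
  have aN: "a \<in> N" unfolding N W using caE by simp
  define K where "K = {x \<in> N. (a, x) \<in> ?R\<^sup>*}"
  have finK: "finite K" using finite_subset[OF _ finite_V] WV unfolding K_def N by auto
  have aK: "a \<in> K" using aN by (simp add: K_def)
  have bK: "b \<notin> K" using not by (simp add: K_def)
  have cN: "c \<notin> N" unfolding N using edge_V[of c c] by blast
  define Fs where "Fs = {F \<in> Faces. F \<subseteq> inside ?D \<and> c \<in> tri F}"
  have finF: "finite Fs" using finite_Faces by (simp add: Fs_def)
  have cl: "closure (inside ?D) \<subseteq> inside ?D \<union> ?D"
  proof -
    obtain l where l: "simple_path l" "pathfinish l = pathstart l" "path_image l = ?D"
      using cycle_loop[OF d _ E] by auto
    have "frontier (inside ?D) = ?D" using Jordan_inside_outside[OF l(1,2)] l(3) by metis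
    then show ?thesis using interior_subset[of "inside ?D"] unfolding frontier_def by blast
  qed
  have inW: "x \<in> W" if "F \<in> Faces" "F \<subseteq> inside ?D" "x \<in> tri F" for F x
  proof -
    have "p x \<in> closure (inside ?D)" "x \<in> V"
      using that closure_mono[OF that(2)] unfolding tri_def frontier_def by blast+
    then have "p x \<in> inside ?D \<or> x \<in> set ?vs"
      using cl vertex_in_drawing[OF E] UD by blast
    then show ?thesis using W \<open>x \<in> V\<close> by blast
  qed
  have evF: "even (card {x \<in> K. x \<in> tri F})" if F: "F \<in> Fs" for F
  proof -
    have F': "F \<in> Faces" "F \<subseteq> inside ?D" "c \<in> tri F" using F by (auto simp: Fs_def)
    obtain u v w where uvw: "tri F = {u, v, w}" "{u, v} \<in> E"
      using F'(1) by (rule face_obtain)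
    obtain x where x: "x \<in> tri F" "x \<noteq> c"
      using uvw edge_V[OF uvw(2)] by (cases "u = c") auto
    have cx: "{c, x} \<subseteq> tri F" "c \<noteq> x" using x F'(3) by auto
    obtain y where y: "tri F = {c, x, y}" "{c, x} \<in> E" "{x, y} \<in> E" "{y, c} \<in> E"
      using F'(1) cx by (rule face_obtain_edge)
    have xy: "x \<in> N" "y \<in> N" "x \<noteq> y"
      using inW[OF F'(1,2)] y edge_V unfolding N by (auto simp: insert_commute)
    have "(x, y) \<in> ?R" "(y, x) \<in> ?R" using xy y(3) by (auto simp: insert_commute)
    then have "x \<in> K \<longleftrightarrow> y \<in> K" using xy unfolding K_def by (auto intro: rtrancl_into_rtrancl)
    moreover have "c \<notin> K" using cN by (simp add: K_def)
    ultimately have "{z \<in> K. z \<in> tri F} = (if x \<in> K then {x, y} else {})" using y(1) by auto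
    then show ?thesis using xy by simp
  qed
  have eq: "(\<Sum>F\<in>Fs. card {x \<in> K. x \<in> tri F}) = (\<Sum>x\<in>K. card {F \<in> Fs. x \<in> tri F})"
    using finF finK by (intro sum_multicount_gen) auto
  have one: "card {F \<in> Fs. a \<in> tri F} = 1"
  proof -
    have "{F \<in> Fs. a \<in> tri F} = {F \<in> Faces. F \<subseteq> inside ?D \<and> {c, a} \<subseteq> tri F}" unfolding Fs_def by blast
    then show ?thesis using card_faces_side(1)[of c a "ys @ [b]"] d E by simp
  qed
  \<comment> \<open>On the cycle c is adjacent to a and b only, so \<open>x\<close> is an inner
    vertex and all faces at it are inside the cycle.\<close>
  have evx: "even (card {F \<in> Fs. x \<in> tri F})" if x: "x \<in> K - {a}" for x
  proof -
    have xN: "x \<in> N" "x \<noteq> a" "x \<noteq> b" using x bK by (auto simp: K_def)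
    have "x \<notin> set ?vs" using xN cN chord unfolding N by auto
    then have ins: "p x \<in> inside ?D" using xN(1) unfolding N W by blast
    have op: "open (inside ?D)" by (rule open_inside[OF closed_drawing[OF E]])
    have "F \<subseteq> inside ?D" if F: "F \<in> Faces" "x \<in> tri F" for F
    proof -
      have "p x \<in> closure F" using F(2) unfolding tri_def frontier_def by blast
      then have "inside ?D \<inter> F \<noteq> {}" using op ins open_Int_closure_eq_empty by blast
      then show ?thesis using face_side(2)[OF F(1) E] by blast
    qed
    then have "{F \<in> Fs. x \<in> tri F} = {F \<in> Faces. {c, x} \<subseteq> tri F}" unfolding Fs_def by blast
    moreover have "c \<noteq> x" using cN xN by blast
    ultimately show ?thesis using even_card_faces_edge by metis
  qed
  have "(\<Sum>x\<in>K. card {F \<in> Fs. x \<in> tri F}) = 1 + (\<Sum>x\<in>K - {a}. card {F \<in> Fs. x \<in> tri F})"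
    unfolding sum.remove[OF finK aK, of "\<lambda>x. card {F \<in> Fs. x \<in> tri F}"] one ..
  moreover have "even (\<Sum>x\<in>K - {a}. card {F \<in> Fs. x \<in> tri F})" using evx by (intro dvd_sum) auto
  moreover have "even (\<Sum>F\<in>Fs. card {x \<in> K. x \<in> tri F})" using evF by (intro dvd_sum) auto
  ultimately show False using eq by simp
qed

end

subsection \<open>Minimal odd holes\<close>

lemma induced_cycle_successors:
  assumes g: "simple_graph V E" and c: "induced_cycle V E (z # rs)"
  shows "{x. x \<in> set rs \<and> {z, x} \<in> E} = {hd rs, last rs}" "hd rs \<noteq> last rs"
proof -
  note T = induced_cycle_tl_ipath[OF g c]
  have ne: "rs \<noteq> []" and d: "distinct rs" using T(1,3) by (auto simp: ipath_def)
  have "x \<in> set rs \<and> {z, x} \<in> E \<longleftrightarrow> x = hd rs \<or> x = last rs" for x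
  proof
    assume "x \<in> set rs \<and> {z, x} \<in> E"
    then obtain j where j: "j < length rs" "rs ! j = x" "{z, rs ! j} \<in> E" by (auto simp: in_set_conv_nth)
    then have "j = 0 \<or> j = length rs - 1" using T(5)[of j] by auto
    then show "x = hd rs \<or> x = last rs" using j ne by (auto simp: hd_conv_nth last_conv_nth)
  next
    assume "x = hd rs \<or> x = last rs"
    then show "x \<in> set rs \<and> {z, x} \<in> E"
      using T(5)[of 0] T(5)[of "length rs - 1"] ne by (auto simp: hd_conv_nth last_conv_nth)
  qed
  then show "{x. x \<in> set rs \<and> {z, x} \<in> E} = {hd rs, last rs}" by blast
  have "rs ! 0 \<noteq> rs ! (length rs - 1)"
    using d T(3) by (subst nth_eq_iff_index_eq) auto
  then show "hd rs \<noteq> last rs" using ne by (simp add: hd_conv_nth last_conv_nth)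
qed

lemma induced_cycle_3_clique:
  assumes g: "simple_graph V E" and c: "induced_cycle V E vs" and n: "length vs = 3"
  shows "clique (set vs) E"
proof -
  obtain a b c where abc: "vs = [a, b, c]" using n by (auto simp: numeral_3_eq_3 length_Suc_conv)
  have "{a, b} \<in> E" "{b, c} \<in> E" "{a, c} \<in> E"
    using induced_cycleD(4)[OF g c, of 0 1] induced_cycleD(4)[OF g c, of 1 2]
      induced_cycleD(4)[OF g c, of 0 2] abc by auto
  then show ?thesis unfolding abc clique_def by (auto simp: insert_commute)
qed

lemma induced_cycle_degree:
  assumes g: "simple_graph V E" and c: "induced_cycle V E vs" and z: "z \<in> set vs"
  shows "card {x \<in> set vs. {z, x} \<in> E} = 2"
proof -
  obtain rs where rs: "induced_cycle V E (z # rs)" "set (z # rs) = set vs"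
    using c z by (rule induced_cycle_rotate_to)
  have "x \<noteq> z" if "{z, x} \<in> E" for x using edge_neq[OF g that] by blast
  then have "{x \<in> set vs. {z, x} \<in> E} = {x. x \<in> set rs \<and> {z, x} \<in> E}" unfolding rs(2)[symmetric] by auto
  then show ?thesis using induced_cycle_successors[OF g rs(1)] by simp
qed

text \<open>Every vertex has degree 2 in either cycle, so a vertex of the smaller one has all its
  neighbours on the larger one within the smaller. Walking along the larger cycle therefore never
  leaves the smaller.\<close>

lemma induced_cycle_subset_eq:
  assumes g: "simple_graph V E" and c: "induced_cycle V E vs" and u: "induced_cycle V E us"
    and sub: "set vs \<subseteq> set us"
  shows "set vs = set us"
proof -
  have n: "vs \<noteq> []" using c by (auto simp: induced_cycle_def)
  then obtain x where x: "x \<in> set vs" by (cases vs) auto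
  obtain rs where rs: "induced_cycle V E (x # rs)" "set (x # rs) = set us"
    using u sub x by (meson induced_cycle_rotate_to subsetD)
  have cl: "y \<in> set vs" if "z \<in> set vs" "y \<in> set us" "{z, y} \<in> E" for y z
  proof -
    have "{y \<in> set vs. {z, y} \<in> E} = {y \<in> set us. {z, y} \<in> E}"
      using induced_cycle_degree[OF g c that(1)] induced_cycle_degree[OF g u, of z] that(1) sub
      by (intro card_subset_eq) auto
    then show ?thesis using that by blast
  qed
  have "(x # rs) ! i \<in> set vs" if "i < length (x # rs)" for i
    using that
  proof (induction i)
    case (Suc i)
    have "{(x # rs) ! i, (x # rs) ! Suc i} \<in> E"
      using induced_cycleD(4)[OF g rs(1), of i "Suc i"] Suc by simp
    moreover have "(x # rs) ! Suc i \<in> set us" using Suc(2) rs(2) nth_mem by blast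
    moreover have "(x # rs) ! i \<in> set vs" using Suc by simp
    ultimately show ?case using cl by blast
  qed (use x in simp)
  then have "set (x # rs) \<subseteq> set vs" by (metis in_set_conv_nth subsetI)
  then show ?thesis using rs(2) sub by blast
qed

text \<open>The neighbours of x on the cycle are the ends of an induced path with at least three
  vertices, so they are not adjacent.\<close>

lemma induced_cycle_no_triangle:
  assumes g: "simple_graph V E" and c: "induced_cycle V E vs" "4 \<le> length vs"
    and x: "x \<in> set vs" "y \<in> set vs" "z \<in> set vs" "{x, y} \<in> E" "{y, z} \<in> E" "{x, z} \<in> E"
  shows False
proof -
  obtain rs where rs: "induced_cycle V E (x # rs)" "set (x # rs) = set vs" "length (x # rs) = length vs"
    using c(1) x(1) by (rule induced_cycle_rotate_to)
  note T = induced_cycle_tl_ipath[OF g rs(1)] and S = induced_cycle_successors[OF g rs(1)]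
  have ne: "x \<noteq> y" "x \<noteq> z" "y \<noteq> z" using x edge_neq[OF g] by blast+
  then have "y \<in> {hd rs, last rs}" "z \<in> {hd rs, last rs}"
    using x rs(2) unfolding S(1)[symmetric] by auto
  then have "{hd rs, last rs} \<in> E" using x(5) ne by (auto simp: insert_commute)
  moreover have "rs \<noteq> []" using T(3) by auto
  ultimately have "{rs ! 0, rs ! (length rs - 1)} \<in> E" by (simp add: hd_conv_nth last_conv_nth)
  then have "length rs - 1 = Suc 0" using T(1,3) unfolding ipath_def by auto
  then show False using rs(3) c(2) by simp
qed

context plane_triang
begin

text \<open>The edges of an induced cycle are determined by its vertex set, so holes are handled as
  sets and their curve is drawn without choosing a cyclic list.\<close>

definition boundary :: "'v set \<Rightarrow> complex set" where
  "boundary C = drawing (induced_edges C E)"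

definition enclosed :: "'v set \<Rightarrow> 'v set" where
  "enclosed C = {v \<in> V. p v \<in> inside (boundary C)}"

definition odd_hole :: "'v set \<Rightarrow> bool" where
  "odd_hole C \<longleftrightarrow> odd (card C) \<and> 5 \<le> card C \<and> (\<exists>vs. induced_cycle V E vs \<and> set vs = C)"

definition min_hole :: "'v set \<Rightarrow> bool" where
  "min_hole C \<longleftrightarrow> odd_hole C \<and>
    (\<forall>C'. odd_hole C' \<longrightarrow> card (C \<union> enclosed C) \<le> card (C' \<union> enclosed C'))"

lemma cycle_edges_induced: "induced_cycle V E vs \<Longrightarrow> cycle_edges vs = induced_edges (set vs) E"
  by (simp add: induced_cycle_def)

lemma cycle_edges_E: "induced_cycle V E vs \<Longrightarrow> cycle_edges vs \<subseteq> E"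
  unfolding induced_cycle_def induced_edges_def by auto

lemma boundary_cycle: "induced_cycle V E vs \<Longrightarrow> boundary (set vs) = drawing (cycle_edges vs)"
  by (simp add: boundary_def cycle_edges_induced)

lemma induced_cycle_loop:
  assumes "induced_cycle V E vs"
  obtains l where "simple_path l" "pathfinish l = pathstart l" "path_image l = boundary (set vs)"
  using cycle_loop[OF _ _ cycle_edges_E[OF assms]] induced_cycleD(1,2)[OF graph assms]
  unfolding boundary_cycle[OF assms] by blast

lemma vertex_in_boundary:
  assumes "induced_cycle V E vs" "v \<in> V"
  shows "p v \<in> boundary (set vs) \<longleftrightarrow> v \<in> set vs"
proof -
  have "2 \<le> length vs" using induced_cycleD(1)[OF graph assms(1)] by simp
  then show ?thesis
    unfolding boundary_cycle[OF assms(1)]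
      vertex_in_drawing[OF cycle_edges_E[OF assms(1)] assms(2)] Union_cycle_edges[OF \<open>2 \<le> length vs\<close>] by simp
qed

lemma enclosed_disjoint:
  assumes "induced_cycle V E vs" shows "set vs \<inter> enclosed (set vs) = {}"
proof -
  have "p v \<notin> inside (boundary (set vs))" if "v \<in> set vs" "v \<in> V" for v
    using vertex_in_boundary[OF assms that(2)] that(1) inside_no_overlap[of "boundary (set vs)"] by blast
  then show ?thesis unfolding enclosed_def by blast
qed

lemma region_edge:
  assumes c: "induced_cycle V E vs" and e: "{u, v} \<in> E"
    and u: "u \<in> set vs \<union> enclosed (set vs)" and v: "v \<in> set vs \<union> enclosed (set vs)"
  shows "path_image (\<gamma> {u, v}) \<subseteq> inside (boundary (set vs)) \<union> boundary (set vs)"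
proof -
  let ?D = "boundary (set vs)"
  have sub: "induced_edges (set vs) E \<subseteq> E" by (auto simp: induced_edges_def)
  have half: "path_image (\<gamma> {x, y}) \<subseteq> inside ?D \<union> ?D"
    if xy: "{x, y} \<in> E" "x \<notin> set vs" "x \<in> enclosed (set vs)" "y \<in> set vs \<union> enclosed (set vs)" for x y
  proof -
    have "x \<notin> \<Union>(induced_edges (set vs) E)" using xy(2) by (auto simp: induced_edges_def)
    then have "path_image (\<gamma> {x, y}) - {p y} \<subseteq> inside ?D"
      using half_edge_inside[OF xy(1) sub _ half_edge(3)[OF xy(1) sub]] xy(3)
      unfolding boundary_def enclosed_def by blast
    moreover have "p y \<in> inside ?D \<union> ?D"
      using xy(4) vertex_in_boundary[OF c, of y] edge_V[OF xy(1)] unfolding enclosed_def by blast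
    ultimately show ?thesis by blast
  qed
  show ?thesis
  proof (cases "u \<in> set vs \<and> v \<in> set vs")
    case True
    then have "{u, v} \<in> induced_edges (set vs) E" using e by (simp add: induced_edges_def)
    then show ?thesis unfolding boundary_def drawing_def by blast
  next
    case False
    then show ?thesis using half[of u v] half[of v u] e u v by (auto simp: insert_commute)
  qed
qed

text \<open>Edges between vertices of the closed interior stay in it, and a closed set in the closed
  interior has its inside within that of the cycle.\<close>

lemma region_drawing:
  assumes c: "induced_cycle V E vs" and X: "X \<subseteq> E" "\<Union>X \<subseteq> set vs \<union> enclosed (set vs)"
  shows "inside (drawing X) \<subseteq> inside (boundary (set vs))"
proof -
  obtain l where l: "simple_path l" "pathfinish l = pathstart l" "path_image l = boundary (set vs)"
    using c by (rule induced_cycle_loop)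
  have "path_image (\<gamma> e) \<subseteq> inside (boundary (set vs)) \<union> boundary (set vs)" if e: "e \<in> X" for e
  proof -
    have "e \<in> [V]\<^bsup>2\<^esup>" using X(1) e graph unfolding simple_graph_def by blast
    then obtain u v where "e = {u, v}" unfolding nsets_def by (auto simp: card_2_iff)
    then show ?thesis using region_edge[OF c, of u v] e X by blast
  qed
  then have "drawing X \<subseteq> inside (boundary (set vs)) \<union> boundary (set vs)"
    unfolding drawing_def by blast
  then show ?thesis
    using inside_subset_Jordan_inside[OF l(1,2) closed_drawing[OF X(1)]] unfolding l(3) by blast
qed

lemma odd_hole_obtain:
  assumes "odd_hole C"
  obtains vs where "induced_cycle V E vs" "set vs = C" "length vs = card C" "odd (length vs)" "5 \<le> length vs"
proof -
  obtain vs where vs: "induced_cycle V E vs" "set vs = C" using assms by (auto simp: odd_hole_def)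
  then have "length vs = card C" using distinct_card induced_cycleD(2)[OF graph vs(1)] by metis
  then show thesis using that vs assms by (simp add: odd_hole_def)
qed

lemma odd_hole_cycle:
  "induced_cycle V E vs \<Longrightarrow> odd (length vs) \<Longrightarrow> 5 \<le> length vs \<Longrightarrow> odd_hole (set vs)"
  using induced_cycleD(2)[OF graph] distinct_card unfolding odd_hole_def by metis

lemma min_hole_obtain:
  assumes "min_hole C"
  obtains vs where "induced_cycle V E vs" "set vs = C" "length vs = card C" "odd (length vs)" "5 \<le> length vs"
  using assms odd_hole_obtain unfolding min_hole_def by blast

text \<open>The closed interior of D is contained in that of C, so by minimality both have the same
  vertices. No vertex of C is strictly inside D, as it would then be strictly inside C. So C is
  contained in D, and nested induced cycles coincide.\<close>

lemma min_hole_unique: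
  assumes C: "min_hole C" and D: "odd_hole D" "D \<subseteq> C \<union> enclosed C"
  shows "D = C"
proof -
  obtain vs where vs: "induced_cycle V E vs" "set vs = C"
    using C by (rule min_hole_obtain)
  obtain us where us: "induced_cycle V E us" "set us = D" using D(1) by (rule odd_hole_obtain)
  have U: "\<Union>(induced_edges D E) \<subseteq> D" by (auto simp: induced_edges_def)
  have sub: "inside (boundary D) \<subseteq> inside (boundary C)"
    using region_drawing[OF vs(1), of "induced_edges D E"] D(2) U vs(2)
    unfolding boundary_def by (auto simp: induced_edges_def)
  have CV: "C \<subseteq> V" "D \<subseteq> V" using induced_cycleD(3)[OF graph] vs us by blast+
  have fin: "finite (C \<union> enclosed C)" using CV finite_V by (auto simp: enclosed_def intro: finite_subset)
  have "D \<union> enclosed D \<subseteq> C \<union> enclosed C" using sub D(2) unfolding enclosed_def by blast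
  moreover have "card (C \<union> enclosed C) \<le> card (D \<union> enclosed D)" using C D(1) by (simp add: min_hole_def)
  ultimately have "D \<union> enclosed D = C \<union> enclosed C" by (rule card_seteq[OF fin])
  moreover have "C \<inter> enclosed D = {}"
    using enclosed_disjoint[OF vs(1)] sub unfolding vs(2) enclosed_def by blast
  ultimately have "C \<subseteq> D" by blast
  then show ?thesis using induced_cycle_subset_eq[OF graph vs(1) us(1)] vs us by simp
qed

lemma min_hole_finite: "min_hole C \<Longrightarrow> finite (C \<union> enclosed C) \<and> C \<union> enclosed C \<subseteq> V"
proof -
  assume "min_hole C"
  then have "odd_hole C" by (simp add: min_hole_def)
  then obtain vs where "induced_cycle V E vs" "set vs = C" by (rule odd_hole_obtain)
  then have "C \<union> enclosed C \<subseteq> V" using induced_cycleD(3)[OF graph] by (auto simp: enclosed_def)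
  then show ?thesis using finite_subset[OF _ finite_V] by blast
qed

lemma min_hole_no_triangle:
  assumes "min_hole C" "x \<in> C" "y \<in> C" "z \<in> C" "{x, y} \<in> E" "{y, z} \<in> E" "{x, z} \<in> E"
  shows False
proof -
  obtain vs where "induced_cycle V E vs" "set vs = C" "5 \<le> length vs"
    using assms(1) by (rule min_hole_obtain)
  then show False using induced_cycle_no_triangle[OF graph, of vs x y z] assms by simp
qed

end

section \<open>Vectors supported in the closed interior of a minimal hole\<close>

locale h_perfect_triang = plane_triang V E p \<gamma>
  for V :: "'v::finite set" and E p \<gamma> +
  assumes hp: "h_perfect V E"
begin

text \<open>Odd cycles of length 3 are cliques, longer ones leaving the closed interior contain a
  zero of x, so \<open>odd_cycle_sum_le\<close> applies, and the remaining ones have vertex set C by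
  \<open>min_hole_unique\<close>.\<close>

lemma region_vector_in_polytope:
  fixes x :: "real ^ 'v"
  assumes C: "min_hole C"
    and x: "\<And>v. v \<notin> C \<union> enclosed C \<Longrightarrow> x $ v = 0" "\<And>v. 0 \<le> x $ v"
    and cl: "\<And>K. K \<subseteq> C \<union> enclosed C \<Longrightarrow> clique K E \<Longrightarrow> (\<Sum>v\<in>K. x $ v) \<le> 1"
    and cy: "(\<Sum>v\<in>C. x $ v) \<le> (real (card C) - 1) / 2"
  shows "x \<in> h_polytope V E"
proof -
  have CV: "C \<union> enclosed C \<subseteq> V" using min_hole_finite[OF C] by blast
  have cl': "(\<Sum>v\<in>K. x $ v) \<le> 1" if "clique K E" for K
  proof -
    have "(\<Sum>v\<in>K. x $ v) = (\<Sum>v\<in>K \<inter> (C \<union> enclosed C). x $ v)"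
      using x(1) by (intro sum.mono_neutral_right) auto
    also have "\<dots> \<le> 1" using that by (intro cl) (auto simp: clique_def)
    finally show ?thesis .
  qed
  have e: "x $ u + x $ v \<le> 1" if "{u, v} \<in> E" for u v
    using cl'[OF clique_pair[OF that]] edge_V[OF that] by simp
  have cy': "(\<Sum>v\<in>set us. x $ v) \<le> (real (length us) - 1) / 2"
    if us: "induced_cycle V E us" "odd (length us)" for us
  proof -
    have n: "3 \<le> length us" and d: "distinct us" using induced_cycleD(1,2)[OF graph us(1)] by auto
    have "length us \<noteq> 4" using us(2) by auto
    then consider "length us = 3" | "5 \<le> length us" using n by linarith
    then show ?thesis
    proof cases
      case 1
      then show ?thesis using cl'[OF induced_cycle_3_clique[OF graph us(1)]] by simp
    next
      case 2
      then have o: "odd_hole (set us)" using us odd_hole_cycle by blast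
      show ?thesis
      proof (cases "set us \<subseteq> C \<union> enclosed C")
        case True
        then have "set us = C" using min_hole_unique[OF C o] by blast
        then show ?thesis using cy distinct_card[OF d] by simp
      next
        case False
        then obtain z where "z \<in> set us" "x $ z \<le> 0" using x(1) by force
        then show ?thesis using odd_cycle_sum_le[OF us, of "\<lambda>v. x $ v"] e by blast
      qed
    qed
  qed
  have out: "x $ v = 0" if "v \<notin> V" for v using x(1) that CV by blast
  show ?thesis
    unfolding h_polytope_def mem_Collect_eq using out x(2) cl' cy' by (intro conjI allI impI ballI) auto
qed

text \<open>With |C| = 2k + 1, the weight k/(2k + 1) on C makes its constraint tight. A clique has
  at most two vertices on C, which leaves room for the weight 1/(2k + 1) at w. The stable set
  obtained contains w and k vertices of C, but neither c nor its cycle neighbours, as they are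
  adjacent to w. So c can be added to its trace on C, giving k + 1 stable vertices on the cycle: one
  too many.\<close>

lemma no_three_consecutive:
  assumes C: "min_hole C" and w: "w \<in> enclosed C" and c: "c \<in> C"
    and all: "\<And>d. d \<in> C \<Longrightarrow> d = c \<or> {c, d} \<in> E \<Longrightarrow> {w, d} \<in> E"
  shows False
proof -
  obtain vs where vs: "induced_cycle V E vs" "set vs = C" "length vs = card C" "odd (length vs)"
    using C by (rule min_hole_obtain)
  obtain k where k: "card C = 2 * k + 1" using vs by (metis oddE)
  have k2: "2 \<le> k" using C k by (simp add: min_hole_def odd_hole_def)
  have wC: "w \<notin> C" using enclosed_disjoint[OF vs(1)] w vs(2) by blast
  have fin: "finite C" using min_hole_finite[OF C] by simp
  define x :: "real ^ 'v" where
    "x = (\<chi> v. if v \<in> C then k / (2 * k + 1) else if v = w then 1 / (2 * k + 1) else 0)"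
  have xC: "x $ v = k / (2 * k + 1)" if "v \<in> C" for v using that by (simp add: x_def)
  have xw: "x $ w = 1 / (2 * k + 1)" using wC by (simp add: x_def)
  have x0: "x $ v = 0" if "v \<notin> C" "v \<noteq> w" for v using that by (simp add: x_def)
  have sumC: "(\<Sum>v\<in>C. x $ v) = k"
  proof -
    have "(\<Sum>v\<in>C. x $ v) = real (card C) * (k / (2 * k + 1))" using xC by simp
    also have "\<dots> = k" unfolding k by (simp add: field_simps)
    finally show ?thesis .
  qed
  have xP: "x \<in> h_polytope V E"
  proof (rule region_vector_in_polytope[OF C])
    show "x $ v = 0" if "v \<notin> C \<union> enclosed C" for v using that w by (intro x0) auto
    show "0 \<le> x $ v" for v by (simp add: x_def)
    show "(\<Sum>v\<in>C. x $ v) \<le> (real (card C) - 1) / 2" unfolding sumC k by simp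
    fix K assume K: "K \<subseteq> C \<union> enclosed C" "clique K E"
    have "card (K \<inter> C) \<le> 2"
    proof (rule ccontr)
      assume "\<not> card (K \<inter> C) \<le> 2"
      then have "3 \<le> card (K \<inter> C)" by simp
      then obtain T where T: "T \<subseteq> K \<inter> C" "card T = 3" by (meson obtain_subset_with_card_n)
      then obtain a b c where "T = {a, b, c}" "a \<noteq> b" "b \<noteq> c" "a \<noteq> c" by (auto simp: card_3_iff)
      then show False using min_hole_no_triangle[OF C, of a b c] T(1) K(2) unfolding clique_def by blast
    qed
    have "(\<Sum>v\<in>K. x $ v) = (\<Sum>v\<in>K \<inter> (C \<union> {w}). x $ v)"
      using x0 by (intro sum.mono_neutral_right) auto
    also have "\<dots> \<le> (\<Sum>v\<in>K \<inter> C. x $ v) + (\<Sum>v\<in>{w}. x $ v)"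
    proof -
      have "(\<Sum>v\<in>K \<inter> (C \<union> {w}). x $ v) \<le> (\<Sum>v\<in>(K \<inter> C) \<union> {w}. x $ v)"
        by (intro sum_mono2) (auto simp: x_def)
      also have "\<dots> = (\<Sum>v\<in>K \<inter> C. x $ v) + (\<Sum>v\<in>{w}. x $ v)" using wC by (intro sum.union_disjoint) auto
      finally show ?thesis .
    qed
    also have "\<dots> = real (card (K \<inter> C)) * (k / (2 * k + 1)) + 1 / (2 * k + 1)" using xC xw by simp
    also have "\<dots> \<le> 2 * (k / (2 * k + 1)) + 1 / (2 * k + 1)"
      using \<open>card (K \<inter> C) \<le> 2\<close> by (intro add_right_mono mult_right_mono) auto
    also have "\<dots> = 1" by (simp add: field_simps)
    finally show "(\<Sum>v\<in>K. x $ v) \<le> 1" .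
  qed
  have pos: "0 < x $ w" unfolding xw by simp
  obtain S where S: "S \<subseteq> V" "indep S E" "w \<in> S"
    and tight: "\<forall>A \<beta>. (\<forall>y\<in>h_polytope V E. (\<Sum>v\<in>A. y $ v) \<le> \<beta>) \<longrightarrow> (\<Sum>v\<in>A. x $ v) = \<beta>
        \<longrightarrow> real (card (S \<inter> A)) = \<beta>"
    using hp xP pos by (rule h_perfect_stable_set)
  have "real (card (S \<inter> C)) = k"
  proof (rule tight[rule_format, OF _ sumC])
    fix y assume "y \<in> h_polytope V E"
    then have "(\<Sum>v\<in>set vs. y $ v) \<le> (real (length vs) - 1) / 2"
      using vs by (intro h_polytope_odd_cycle)
    then show "(\<Sum>v\<in>C. y $ v) \<le> real k" using vs k by simp
  qed
  then have cS: "card (S \<inter> C) = k" by simp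
  have noS: "d \<notin> S" if "d \<in> C" "d = c \<or> {c, d} \<in> E" for d
  proof
    assume "d \<in> S"
    moreover have "{w, d} \<in> E" "w \<noteq> d" using all[OF that] that(1) wC by blast+
    ultimately show False using S(2,3) unfolding indep_def by blast
  qed
  let ?S = "insert c (S \<inter> C)"
  have "indep ?S E"
    using S(2) noS unfolding indep_def by (auto simp: insert_commute)
  then have "2 * card (?S \<inter> C) + 1 \<le> 2 * k + 1"
    using indep_odd_cycle[OF vs(1,4) _ graph, of ?S] vs k by simp
  moreover have "?S \<inter> C = ?S" using c by blast
  moreover have "card ?S = Suc (card (S \<inter> C))" using noS[OF c] fin by simp
  ultimately show False using cS by simp
qed

end

subsection \<open>Fans\<close>

lemma ipath_ConsD:
  assumes "ipath E (a # xs)" shows "ipath E xs"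
proof -
  have *: "{(a # xs) ! i, (a # xs) ! j} \<in> E \<longleftrightarrow> j = Suc i" if "i < j" "j < length (a # xs)" for i j
    using assms that unfolding ipath_def by blast
  have "{xs ! i, xs ! j} \<in> E \<longleftrightarrow> j = Suc i" if "i < j" "j < length xs" for i j
    using *[of "Suc i" "Suc j"] that by simp
  then show ?thesis using assms unfolding ipath_def by auto
qed

lemma ipath_snocD: "ipath E (xs @ [b]) \<Longrightarrow> ipath E xs"
  using ipath_ConsD[of E b "rev xs"] ipath_rev[of E "xs @ [b]"] ipath_rev[of E "rev xs"] by simp

lemma ipath_Cons_adj:
  assumes p: "ipath E (a # ws)" and w: "w \<in> set ws"
  shows "{w, a} \<in> E \<longleftrightarrow> w = hd ws"
proof -
  obtain i where i: "i < length ws" "ws ! i = w" using w by (auto simp: in_set_conv_nth)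
  have "{(a # ws) ! 0, (a # ws) ! Suc i} \<in> E \<longleftrightarrow> Suc i = Suc 0"
    using p i unfolding ipath_def by (metis length_Cons Suc_less_eq zero_less_Suc)
  then have "{w, a} \<in> E \<longleftrightarrow> i = 0" using i by (simp add: insert_commute)
  also have "\<dots> \<longleftrightarrow> w = hd ws"
  proof -
    have "ws \<noteq> []" using w by auto
    then have "hd ws = ws ! 0" by (rule hd_conv_nth)
    moreover have "distinct ws" using p by (simp add: ipath_def)
    moreover have "0 < length ws" using i(1) by linarith
    ultimately show ?thesis using i nth_eq_iff_index_eq by metis
  qed
  finally show ?thesis .
qed

lemma ipath_snoc_adj:
  assumes p: "ipath E (ws @ [b])" and w: "w \<in> set ws"
  shows "{w, b} \<in> E \<longleftrightarrow> w = last ws"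
  using ipath_Cons_adj[of E b "rev ws" w] ipath_rev[OF p] w by (simp add: hd_rev)

lemma induced_cycle_separated:
  assumes g: "simple_graph V E" and c: "induced_cycle V E (a # xs @ b # ys)"
    and x: "x \<in> set xs" and y: "y \<in> set ys"
  shows "{x, y} \<notin> E"
proof -
  let ?vs = "a # xs @ b # ys"
  obtain i where i: "i < length xs" "x = xs ! i" using x by (auto simp: in_set_conv_nth)
  obtain j where j: "j < length ys" "y = ys ! j" using y by (auto simp: in_set_conv_nth)
  have "?vs ! Suc i = x" using i by (simp add: nth_append)
  moreover have "?vs ! (Suc (Suc (length xs)) + j) = y" using j by (simp add: nth_append)
  ultimately show ?thesis
    using induced_cycleD(4)[OF g c, of "Suc i" "Suc (Suc (length xs)) + j"] i j by auto
qed

lemma induced_cycle_swap: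
  assumes "induced_cycle V E (xs @ ys)" shows "induced_cycle V E (ys @ xs)"
  using induced_cycle_rotate[OF assms, of "length xs"] by (simp add: rotate_append)

lemma induced_cycle_split_at:
  assumes g: "simple_graph V E" and c: "induced_cycle V E vs"
    and uv: "u \<in> set vs" "v \<in> set vs" "u \<noteq> v" "{u, v} \<notin> E"
  obtains xs ys where "induced_cycle V E (u # xs @ v # ys)" "set (u # xs @ v # ys) = set vs"
    "xs \<noteq> []" "ys \<noteq> []"
proof -
  obtain rs where rs: "induced_cycle V E (u # rs)" "set (u # rs) = set vs"
    using c uv(1) by (rule induced_cycle_rotate_to)
  have "v \<in> set rs" using rs(2) uv by auto
  then obtain xs ys where sp: "rs = xs @ v # ys" by (meson split_list)
  note T = induced_cycle_tl_ipath[OF g rs(1)]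
  have "rs ! 0 = hd rs" "rs ! (length rs - 1) = last rs" using sp by (auto simp: hd_conv_nth last_conv_nth)
  moreover have "0 < length rs" "length rs - 1 < length rs" "Suc (length rs - 1) = length rs" using T(3) by linarith+
  ultimately have "{u, hd rs} \<in> E" "{u, last rs} \<in> E" using T(5)[of 0] T(5)[of "length rs - 1"] by metis+
  then have "xs \<noteq> []" "ys \<noteq> []" using uv(4) sp by auto
  then show thesis using that rs sp by simp
qed

context plane_triang
begin

definition hub :: "'v set \<Rightarrow> 'v \<Rightarrow> bool" where
  "hub C w \<longleftrightarrow> w \<in> enclosed C \<and>
    (\<exists>u\<in>C. \<exists>v\<in>C. u \<noteq> v \<and> {u, v} \<notin> E \<and> {w, u} \<in> E \<and> {w, v} \<in> E)"

definition clean :: "'v set \<Rightarrow> 'v \<Rightarrow> bool" where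
  "clean C c \<longleftrightarrow> c \<in> C \<and> (\<forall>w. hub C w \<longrightarrow> {w, c} \<notin> E)"

definition fan :: "'v set \<Rightarrow> 'v \<Rightarrow> 'v list \<Rightarrow> 'v \<Rightarrow> 'v \<Rightarrow> bool" where
  "fan C c ws a b \<longleftrightarrow> 2 \<le> length ws \<and> set ws \<subseteq> enclosed C \<and> (\<forall>w\<in>set ws. {c, w} \<in> E) \<and>
    a \<in> C \<and> b \<in> C \<and> a \<noteq> b \<and> {c, a} \<in> E \<and> {c, b} \<in> E \<and> ipath E (a # ws @ [b])"

lemma hole_no_crossing:
  assumes c: "induced_cycle V E (a # xs @ b # ys)" "set (a # xs @ b # ys) = C"
    and ne: "xs \<noteq> [] \<or> ys \<noteq> []"
    and ms: "ms \<noteq> []" "distinct ms" "set ms \<subseteq> enclosed C" "walk_edges (b # ms @ [a]) \<subseteq> E"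
    and h: "h = h' \<or> {h, h'} \<in> E" "h \<in> enclosed C" "h' \<in> enclosed C" "h \<notin> set ms" "h' \<notin> set ms"
    and c1: "c1 \<in> set xs" "{h, c1} \<in> E" and c2: "c2 \<in> set ys" "{h', c2} \<in> E"
  shows False
proof -
  have b: "boundary C = drawing (cycle_edges (a # xs @ b # ys))"
    using boundary_cycle[OF c(1)] c(2) by simp
  have in1: "p m \<in> inside (drawing (cycle_edges (a # xs @ b # ys)))" "m \<in> V" if "m \<in> enclosed C" for m
    using that unfolding enclosed_def b by blast+
  have "set ms \<inter> set (a # xs @ b # ys) = {}"
    using enclosed_disjoint[OF c(1)] ms(3) unfolding c(2) by blast
  then show False
    using no_crossing[OF induced_cycleD(2)[OF graph c(1)] ne cycle_edges_E[OF c(1)] ms(1,2) _ ms(4) _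
      h(1) in1(2)[OF h(2)] in1(2)[OF h(3)] h(4,5) in1(1)[OF h(2)] in1(1)[OF h(3)] c1 c2] in1(1) ms(3) by blast
qed

end

context h_perfect_triang
begin

text \<open>\<open>link_connected\<close> joins the cycle neighbours a and b of c within the link of
  c, and an induced path is chosen there. It has inner vertices because C contains no triangle, and
  more than one because a single one would be adjacent to a, c and b.\<close>

lemma fan_exists:
  assumes C: "min_hole C" and c: "c \<in> C"
  obtains ws a b where "fan C c ws a b"
proof -
  obtain us where us: "induced_cycle V E us" "set us = C" "5 \<le> length us"
    using C by (rule min_hole_obtain)
  have "c \<in> set us" using c us by simp
  then obtain rs where rs: "induced_cycle V E (c # rs)" "set (c # rs) = set us" "length (c # rs) = length us"
    by (rule induced_cycle_rotate_to[OF us(1)])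
  note S = induced_cycle_successors[OF graph rs(1)]
  obtain a rs' where a: "rs = a # rs'" using rs(3) us(3) by (cases rs) auto
  have "rs' \<noteq> []" using rs(3) us(3) a by auto
  then obtain ys b where b: "rs = a # ys @ [b]" using a by (metis rev_exhaust)
  let ?vs = "c # a # ys @ [b]"
  have vs: "induced_cycle V E ?vs" "set ?vs = C" "5 \<le> length ?vs" using rs us b by auto
  have nb: "{x. x \<in> set rs \<and> {c, x} \<in> E} = {a, b}" "a \<noteq> b" using S b by auto
  have d: "distinct ?vs" by (rule induced_cycleD(2)[OF graph vs(1)])
  have bd: "boundary C = drawing (cycle_edges ?vs)" using boundary_cycle[OF vs(1)] vs(2) by simp
  define N where "N = {x \<in> C \<union> enclosed C. {c, x} \<in> E}"
  have nbC: "x = a \<or> x = b" if "x \<in> C" "{c, x} \<in> E" for x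
  proof -
    have "x \<noteq> c" using that(2) edge_V by blast
    then have "x \<in> set rs" using that(1) vs(2) b by auto
    then show ?thesis using nb(1) that(2) by blast
  qed
  have chord: "{c, y} \<notin> E" if "y \<in> set ys" for y
    using nbC[of y] that d vs(2) by auto
  have W: "C \<union> enclosed C = set ?vs \<union> {v \<in> V. p v \<in> inside (drawing (cycle_edges ?vs))}"
    unfolding vs(2) enclosed_def bd ..
  have r: "(a, b) \<in> {(u, v). u \<in> N \<and> v \<in> N \<and> {u, v} \<in> E}\<^sup>*"
    by (rule link_connected[OF d cycle_edges_E[OF vs(1)] chord W N_def])
  have ab: "a \<in> C" "b \<in> C" "{c, a} \<in> E" "{c, b} \<in> E" using nb(1) b vs(2) by auto
  then have "a \<in> N" by (simp add: N_def)
  obtain xs where xs: "xs \<noteq> []" "hd xs = a" "last xs = b" "set xs \<subseteq> N" "ipath E xs"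
    using graph r \<open>a \<in> N\<close> by (rule ipath_exists)
  obtain xs' where xs': "xs = a # xs'" using xs(1,2) by (cases xs) auto
  have "xs' \<noteq> []" using xs' xs(3) nb(2) by auto
  then obtain ws where ws: "xs = a # ws @ [b]"
    using xs' xs(3) by (metis append_butlast_last_id last_ConsR)
  have dws: "distinct (a # ws @ [b])" using xs(5) ws by (simp add: ipath_def)
  have wsN: "w \<in> enclosed C" "{c, w} \<in> E" if "w \<in> set ws" for w
    using that xs(4) ws dws nbC unfolding N_def by auto
  have nab: "{a, b} \<notin> E" using min_hole_no_triangle[OF C c ab(1,2,3) _ ab(4)] by blast
  have wne: "ws \<noteq> []"
  proof
    assume "ws = []"
    then have "ipath E [a, b]" using xs(5) ws by simp
    then show False using nab unfolding ipath_def by (metis One_nat_def diff_Suc_1 length_Cons lessI list.size(3) nth_Cons_0 nth_Cons_Suc zero_less_one)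
  qed
  have "length ws \<noteq> 1"
  proof
    assume "length ws = 1"
    then obtain w where w: "ws = [w]" by (auto simp: length_Suc_conv)
    have p: "ipath E (a # [w])" "ipath E ([w] @ [b])"
      using xs(5) ipath_snocD[of E "[a, w]" b] ipath_ConsD[of E a "[w, b]"] unfolding ws w by auto
    have "{w, a} \<in> E" "{w, b} \<in> E" "{w, c} \<in> E"
      using ipath_Cons_adj[OF p(1)] ipath_snoc_adj[OF p(2)] wsN[of w] w by (auto simp: insert_commute)
    then show False using no_three_consecutive[OF C _ c, of w] wsN[of w] nbC w by auto
  qed
  moreover have "length ws \<noteq> 0" using wne by simp
  ultimately have "2 \<le> length ws" by linarith
  then have "fan C c ws a b" unfolding fan_def using wsN ab nb(2) xs(5) ws by auto
  then show thesis by (rule that)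
qed

text \<open>A fan vertex is adjacent to c and, as c is clean, not a hub. So its other neighbours on
  C are adjacent to c, which leaves a and b, and the induced path decides which fan vertices see
  them.\<close>

lemma fan_adj:
  assumes C: "min_hole C" and c: "clean C c" and f: "fan C c ws a b"
    and w: "w \<in> set ws" and d: "d \<in> C" "d \<noteq> c"
  shows "{w, d} \<in> E \<longleftrightarrow> w = hd ws \<and> d = a \<or> w = last ws \<and> d = b"
proof -
  have cC: "c \<in> C" and F: "set ws \<subseteq> enclosed C" "{c, w} \<in> E" "a \<in> C" "b \<in> C" "a \<noteq> b" "{c, a} \<in> E" "{c, b} \<in> E"
    "ipath E (a # ws @ [b])"
    using c f w by (auto simp: clean_def fan_def)
  have aw: "{w, a} \<in> E \<longleftrightarrow> w = hd ws"
    using ipath_Cons_adj[OF ipath_snocD[of E "a # ws" b]] F(8) w by simp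
  have bw: "{w, b} \<in> E \<longleftrightarrow> w = last ws"
    using ipath_snoc_adj[OF ipath_ConsD[OF F(8)] w] .
  have "d = a \<or> d = b" if e: "{w, d} \<in> E"
  proof -
    have "\<not> hub C w" using c F(2) by (auto simp: clean_def insert_commute)
    then have cd: "{c, d} \<in> E"
      using e F(1,2) w cC d unfolding hub_def by (auto simp: insert_commute)
    obtain us where us: "induced_cycle V E us" "set us = C"
      using C by (rule min_hole_obtain)
    have "card {x \<in> C. {c, x} \<in> E} = 2" using induced_cycle_degree[OF graph us(1)] us(2) cC by simp
    moreover have "{a, b} \<subseteq> {x \<in> C. {c, x} \<in> E}" "card {a, b} = 2" using F by auto
    ultimately have "{a, b} = {x \<in> C. {c, x} \<in> E}"
      by (intro card_subset_eq) (auto intro: card_ge_0_finite)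
    then show ?thesis using cd d by blast
  qed
  then show ?thesis using aw bw by blast
qed

lemma fan_basics:
  assumes C: "min_hole C" and f: "fan C c ws a b"
  shows "ipath E ws" "set ws \<subseteq> V" "ws \<noteq> []" "set ws \<inter> C = {}" "set ws \<subseteq> enclosed C"
proof -
  have F: "2 \<le> length ws" "set ws \<subseteq> enclosed C" "ipath E (a # ws @ [b])" using f by (auto simp: fan_def)
  show "ipath E ws" by (rule ipath_snocD[OF ipath_ConsD[OF F(3)]])
  show "set ws \<subseteq> V" "ws \<noteq> []" "set ws \<subseteq> enclosed C" using F by (auto simp: enclosed_def)
  obtain us where "induced_cycle V E us" "set us = C"
    using C by (rule min_hole_obtain)
  then show "set ws \<inter> C = {}" using enclosed_disjoint F(2) by blast
qed

lemma flip:
  assumes C: "min_hole C" and c: "clean C c" and f: "fan C c ws a b"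
  obtains us where "induced_cycle V E us" "set us = set ws \<union> (C - {c})"
    "Suc (length us) = card C + length ws"
proof -
  obtain vs where vs: "induced_cycle V E vs" "set vs = C" "length vs = card C"
    using C by (rule min_hole_obtain)
  note B = fan_basics[OF C f]
  have F: "a \<in> set vs" "b \<in> set vs" "a \<noteq> b" "{c, a} \<in> E" "{c, b} \<in> E" "c \<in> set vs"
    using f c vs(2) by (auto simp: fan_def clean_def)
  have "set ws \<inter> set vs = {}" using B(4) vs(2) by simp
  then show thesis
    using induced_cycle_flip[OF graph vs(1) F(6) B(1,2,3) _ F(1-5)] fan_adj[OF C c f] that vs by metis
qed

text \<open>The flipped cycle has length |C| - 1 + |ws|, lies in the closed interior and avoids c.
  If |ws| were odd, it would be a second odd hole there.\<close>

lemma fan_even: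
  assumes C: "min_hole C" and c: "clean C c" and f: "fan C c ws a b"
  shows "even (length ws)"
proof (rule ccontr)
  assume o: "odd (length ws)"
  obtain us where us: "induced_cycle V E us" "set us = set ws \<union> (C - {c})"
    "Suc (length us) = card C + length ws" using C c f by (rule flip)
  have oC: "odd (card C)" "5 \<le> card C" using C by (auto simp: min_hole_def odd_hole_def)
  have l: "2 \<le> length ws" using f by (simp add: fan_def)
  have "odd (length us)" using us(3) oC(1) o by presburger
  then have "odd_hole (set us)" using odd_hole_cycle[OF us(1)] us(3) oC l by simp
  then have "set us = C" using min_hole_unique[OF C] us(2) fan_basics(5)[OF C f] by blast
  moreover have "c \<in> C" "c \<notin> set us" using c us(2) fan_basics(4)[OF C f] by (auto simp: clean_def)
  ultimately show False by blast
qed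

text \<open>If the fans are disjoint and not joined by an edge, c' can be flipped after c; a' and b'
  are still on the flipped cycle because c and c' are not adjacent. The resulting length |C| - 2 +
  |ws| + |ws'| is odd since both fans are even, again giving a second odd hole.\<close>

lemma fans_touch:
  assumes C: "min_hole C" and c: "clean C c" and f: "fan C c ws a b"
    and c': "clean C c'" and f': "fan C c' ws' a' b'" and n: "c \<noteq> c'" "{c, c'} \<notin> E"
  obtains u u' where "u \<in> set ws" "u' \<in> set ws'" "u = u' \<or> {u, u'} \<in> E"
proof (rule ccontr)
  note touch = that
  assume no: "\<not> thesis"
  have sep: "u \<noteq> u'" "{u', u} \<notin> E" if "u \<in> set ws" "u' \<in> set ws'" for u u'
    using touch[OF that] no by (auto simp: insert_commute)
  obtain us where us: "induced_cycle V E us" "set us = set ws \<union> (C - {c})"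
    "Suc (length us) = card C + length ws" using C c f by (rule flip)
  note B = fan_basics[OF C f] and B' = fan_basics[OF C f']
  have cC: "c \<in> C" "c' \<in> C" using c c' by (auto simp: clean_def)
  have F: "a' \<in> C" "b' \<in> C" "a' \<noteq> b'" "{c', a'} \<in> E" "{c', b'} \<in> E" using f' by (auto simp: fan_def)
  have "a' \<noteq> c" "b' \<noteq> c" using F n(2) by (auto simp: insert_commute)
  then have F2: "c' \<in> set us" "a' \<in> set us" "b' \<in> set us" using F cC n(1) us(2) by auto
  have dj: "set ws' \<inter> set us = {}" using B'(4) sep us(2) by blast
  have adj: "{w, d} \<in> E \<longleftrightarrow> w = hd ws' \<and> d = a' \<or> w = last ws' \<and> d = b'"
    if "w \<in> set ws'" "d \<in> set us" "d \<noteq> c'" for w d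
  proof (cases "d \<in> C")
    case True
    then show ?thesis using fan_adj[OF C c' f' that(1)] that(3) by blast
  next
    case False
    then have "d \<in> set ws" "d \<noteq> a'" "d \<noteq> b'" using that(2) us(2) F by auto
    then show ?thesis using sep(2)[of d w] that(1) by blast
  qed
  obtain us' where us': "induced_cycle V E us'" "set us' = set ws' \<union> (set us - {c'})"
    "Suc (length us') = length us + length ws'"
    using induced_cycle_flip[OF graph us(1) F2(1) B'(1,2,3) dj F2(2,3) F(3,4,5) adj] by blast
  have oC: "odd (card C)" "5 \<le> card C" using C by (auto simp: min_hole_def odd_hole_def)
  have l: "2 \<le> length ws" "2 \<le> length ws'" using f f' by (auto simp: fan_def)
  have "odd (length us')"
    using us(3) us'(3) oC(1) fan_even[OF C c f] fan_even[OF C c' f'] by presburger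
  then have "odd_hole (set us')" using odd_hole_cycle[OF us'(1)] us(3) us'(3) oC l by simp
  then have "set us' = C" using min_hole_unique[OF C] us(2) us'(2) B(5) B'(5) by blast
  moreover have "c \<notin> set us'" using cC us(2) us'(2) B(4) B'(4) by blast
  ultimately show False using cC by blast
qed

end

section \<open>Excluding hubs\<close>

lemma split_two:
  assumes "u \<in> set L" "v \<in> set L" "u \<noteq> v"
  obtains l1 m l2 where "L = l1 @ u # m @ v # l2" | l1 m l2 where "L = l1 @ v # m @ u # l2"
proof -
  obtain p q where L: "L = p @ u # q" using assms(1) by (meson split_list)
  then consider "v \<in> set p" | "v \<in> set q" using assms(2,3) by auto
  then show thesis
  proof cases
    case 1
    then obtain r s where "p = r @ v # s" by (meson split_list)
    then show thesis using that(2)[of r s q] L by simp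
  next
    case 2
    then obtain r s where "q = r @ v # s" by (meson split_list)
    then show thesis using that(1)[of p r s] L by simp
  qed
qed

context h_perfect_triang
begin

text \<open>Induction on the length of \<open>xs\<close>: if the first hub has no neighbour there, any other hub touching
  \<open>xs\<close> is separated from \<open>ys\<close> by the path through the first one, so its nonadjacent neighbours bound
  a shorter interval.\<close>

lemma clean_between:
  assumes C: "min_hole C"
  shows "hub C h \<Longrightarrow> induced_cycle V E (a # xs @ b # ys) \<Longrightarrow> set (a # xs @ b # ys) = C \<Longrightarrow>
    xs \<noteq> [] \<Longrightarrow> ys \<noteq> [] \<Longrightarrow> {h, a} \<in> E \<Longrightarrow> {h, b} \<in> E \<Longrightarrow> \<exists>c\<in>set xs. clean C c"
proof (induction "length xs" arbitrary: h a xs b ys rule: less_induct)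
  case less
  note IH = less.hyps and hub = less.prems(1) and cyc = less.prems(2,3) and ne = less.prems(4,5)
    and adj = less.prems(6,7)
  let ?L = "a # xs @ [b]"
  have dL: "distinct (?L @ ys)" using induced_cycleD(2)[OF graph cyc(1)] by auto
  \<comment> \<open>The cycle is rotated so as to start at \<open>u\<close>. Since \<open>u\<close>,
    \<open>v\<close> are not both ends of the list, the interval \<open>m\<close> between them is
    shorter than \<open>xs\<close>, and the induction hypothesis applies to the hub
    \<open>k\<close>.\<close>
  have shorter: "\<exists>c\<in>set xs. clean C c"
    if L: "?L = l1 @ u # m @ v # l2" and m: "m \<noteq> []" and l: "l1 \<noteq> [] \<or> l2 \<noteq> []"
      and k: "hub C k" "{k, u} \<in> E" "{k, v} \<in> E" for l1 u m v l2 k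
  proof -
    have eq: "a # xs @ b # ys = l1 @ (u # m @ v # l2 @ ys)"
      using arg_cong[OF L, of "\<lambda>z. z @ ys"] by simp
    have c: "induced_cycle V E ((u # m @ v # l2 @ ys) @ l1)"
      using cyc(1) unfolding eq by (rule induced_cycle_swap)
    then have "induced_cycle V E (u # m @ v # (l2 @ ys @ l1))" by simp
    moreover have "set (u # m @ v # (l2 @ ys @ l1)) = C" using cyc(2) unfolding eq by auto
    moreover have "length m < length xs"
    proof -
      have "length ?L = length (l1 @ u # m @ v # l2)" using L by (rule arg_cong)
      then show ?thesis using l by (auto simp: length_greater_0_conv[symmetric] simp del: length_greater_0_conv)
    qed
    moreover have "l2 @ ys @ l1 \<noteq> []" using ne by simp
    ultimately have "\<exists>c\<in>set m. clean C c" using IH k m by blast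
    moreover have "set m \<subseteq> set xs"
    proof -
      have "hd (l1 @ [u]) = a" using arg_cong[OF L, of hd] by (cases l1) auto
      then have 1: "a \<in> set (l1 @ [u])" by (metis hd_in_set snoc_eq_iff_butlast)
      have "last (v # l2) = b" using arg_cong[OF L, of last] by simp
      then have 2: "b \<in> set (v # l2)" by (metis last_in_set list.discI)
      have "distinct ?L" using dL by simp
      then have "distinct (l1 @ u # m @ v # l2)" by (simp only: L)
      then have "a \<notin> set m" "b \<notin> set m" using 1 2 by auto
      moreover have "set m \<subseteq> set ?L" unfolding L by auto
      ultimately show ?thesis by auto
    qed
    ultimately show ?thesis by blast
  qed
  \<comment> \<open>If \<open>c\<close> is the only entry of \<open>xs\<close>, then
    \<open>k\<close> sees three consecutive vertices of C. Otherwise the vertices between a and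
    \<open>c\<close> or those between \<open>c\<close> and b form a nonempty shorter
    interval.\<close>
  have three: "\<exists>c\<in>set xs. clean C c"
    if k: "hub C k" "{k, a} \<in> E" "{k, b} \<in> E" "{k, c} \<in> E" and c: "c \<in> set xs" for k c
  proof -
    obtain x1 x2 where x: "xs = x1 @ c # x2" using c by (meson split_list)
    show ?thesis
    proof (cases "x1 = [] \<and> x2 = []")
      case True
      then have c1: "induced_cycle V E (a # [c] @ b # ys)" using cyc(1) x by simp
      have "induced_cycle V E (c # (b # ys @ [a]))"
        using induced_cycle_swap[of V E "[a]" "[c] @ b # ys"] c1 by simp
      note S = induced_cycle_successors(1)[OF graph this]
      have cC: "c \<in> C" using cyc(2) x by auto
      have "{k, d} \<in> E" if "d \<in> C" "d = c \<or> {c, d} \<in> E" for d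
      proof (cases "d = c")
        case False
        then have "d \<in> set (b # ys @ [a])" "{c, d} \<in> E" using that cyc(2) x True by auto
        then have "d = b \<or> d = a" using S by auto
        then show ?thesis using k by blast
      qed (use k in simp)
      then have False using no_three_consecutive[OF C _ cC, of k] k(1) by (simp add: hub_def)
      then show ?thesis ..
    next
      case False
      then consider "x1 \<noteq> []" | "x2 \<noteq> []" by blast
      then show ?thesis
      proof cases
        case 1
        then show ?thesis using shorter[of "[]" a x1 c "x2 @ [b]" k] k x by simp
      next
        case 2
        then show ?thesis using shorter[of "a # x1" c x2 b "[]" k] k x by simp
      qed
    qed
  qed
  show ?case
  proof (cases "\<exists>c\<in>set xs. {h, c} \<in> E")
    case True
    then show ?thesis using three[OF hub adj] by blast
  next
    case False
    obtain c where c: "c \<in> set xs" using ne(1) by (cases xs) auto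
    show ?thesis
    proof (rule ccontr)
      assume no: "\<not> ?thesis"
      have "c \<in> C" using c cyc(2) by auto
      then obtain k where k: "hub C k" "{k, c} \<in> E" using c no by (auto simp: clean_def)
      have kh: "k \<noteq> h" using k c False by blast
      have I: "h \<in> enclosed C" "k \<in> enclosed C" using hub k by (auto simp: hub_def)
      have w: "walk_edges (b # [h] @ [a]) \<subseteq> E" using adj by (auto simp: insert_commute)
      \<comment> \<open>The path from a via h to b separates the two arcs, and \<open>k\<close>
        already has the neighbour \<open>c\<close> in \<open>xs\<close>.\<close>
      have noys: "{k, y} \<notin> E" if "y \<in> set ys" for y
        using hole_no_crossing[OF cyc, of "[h]" k k c y] ne I kh w k(2) c that by auto
      obtain u v where uv: "u \<in> C" "v \<in> C" "u \<noteq> v" "{u, v} \<notin> E" "{k, u} \<in> E" "{k, v} \<in> E"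
        using k(1) by (auto simp: hub_def)
      then have uvL: "u \<in> set ?L" "v \<in> set ?L" using noys cyc(2) by auto
      have fin: False
        if L: "?L = l1 @ s # m @ t # l2" and st: "{s, t} \<notin> E" "{k, s} \<in> E" "{k, t} \<in> E" for l1 s m t l2
      proof (cases "l1 = [] \<and> l2 = []")
        case True
        then have "s = a" "t = b" using L by auto
        then show False using three[OF k(1) _ _ k(2) c] st no by blast
      next
        case l: False
        have "m \<noteq> []"
        proof
          assume "m = []"
          then have eq: "a # xs @ b # ys = l1 @ (s # t # l2 @ ys)"
            using arg_cong[OF L, of "\<lambda>z. z @ ys"] by simp
          have "induced_cycle V E ((s # t # l2 @ ys) @ l1)"
            using cyc(1) unfolding eq by (rule induced_cycle_swap)
          then have "{s, t} \<in> E" using induced_cycleD(4)[OF graph, of _ 0 1] by fastforce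
          then show False using st by simp
        qed
        then show False using shorter[OF L _ _ k(1) st(2,3)] l no by blast
      qed
      show False
        using uvL uv(3)
      proof (cases rule: split_two)
        case (1 l1 m l2)
        show False by (rule fin[OF 1 uv(4,5,6)])
      next
        case (2 l1 m l2)
        have "{v, u} \<notin> E" using uv(4) by (simp add: insert_commute)
        then show False using fin[OF 2 _ uv(6,5)] by blast
      qed
    qed
  qed
qed

text \<open>Two nonadjacent neighbours u, v of the hub cut C into two arcs, each with a clean vertex
  by \<open>clean_between\<close>. The fans of these two touch, which connects the arcs through the
  interior. The connection avoids h because the fan of a clean vertex contains no hub, yet it would
  have to cross the path from u via h to v.\<close>

lemma no_hub:
  assumes C: "min_hole C" and h: "hub C h"
  shows False
proof -
  obtain u v where uv: "u \<in> C" "v \<in> C" "u \<noteq> v" "{u, v} \<notin> E" "{h, u} \<in> E" "{h, v} \<in> E"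
    using h by (auto simp: hub_def)
  obtain vs where vs: "induced_cycle V E vs" "set vs = C"
    using C by (rule min_hole_obtain)
  have uv': "u \<in> set vs" "v \<in> set vs" using uv vs by auto
  obtain xs ys where xy: "induced_cycle V E (u # xs @ v # ys)" "set (u # xs @ v # ys) = set vs"
    "xs \<noteq> []" "ys \<noteq> []" using graph vs(1) uv' uv(3,4) by (rule induced_cycle_split_at)
  have xyC: "set (u # xs @ v # ys) = C" using xy vs by simp
  obtain c where c: "c \<in> set xs" "clean C c"
    using clean_between[OF C h xy(1) xyC xy(3,4) uv(5,6)] by blast
  have yx: "induced_cycle V E (v # ys @ u # xs)" using induced_cycle_swap[of V E "u # xs" "v # ys"] xy by simp
  have yxC: "set (v # ys @ u # xs) = C" using xyC by auto
  obtain c' where c': "c' \<in> set ys" "clean C c'"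
    using clean_between[OF C h yx yxC xy(4,3) uv(6,5)] by blast
  have nc: "c \<noteq> c'" "{c, c'} \<notin> E"
    using induced_cycleD(2)[OF graph xy(1)] induced_cycle_separated[OF graph xy(1)] c(1) c'(1) by auto
  obtain ws a b where f: "fan C c ws a b" using C c(2) by (metis clean_def fan_exists)
  obtain ws' a' b' where f': "fan C c' ws' a' b'" using C c'(2) by (metis clean_def fan_exists)
  obtain w w' where w: "w \<in> set ws" "w' \<in> set ws'" "w = w' \<or> {w, w'} \<in> E"
    using C c(2) f c'(2) f' nc by (rule fans_touch)
  have W: "w \<in> enclosed C" "{w, c} \<in> E" "w' \<in> enclosed C" "{w', c'} \<in> E"
    using f f' w by (auto simp: fan_def insert_commute)
  have "h \<in> enclosed C" using h by (simp add: hub_def)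
  moreover have "w \<noteq> h" "w' \<noteq> h" using W c(2) c'(2) h by (auto simp: clean_def)
  moreover have "walk_edges (v # [h] @ [u]) \<subseteq> E" using uv by (auto simp: insert_commute)
  ultimately show False
    using hole_no_crossing[OF xy(1) xyC, of "[h]" w w' c c'] xy(3) w(3) W c(1) c'(1) by auto
qed

lemma all_clean: "min_hole C \<Longrightarrow> c \<in> C \<Longrightarrow> clean C c"
  using no_hub by (auto simp: clean_def)

section \<open>The vector 1/3 on a minimal hole and its fans\<close>

text \<open>The fan ends in a and b on C, which are not inside the triangle. From t it can leave the
  inside in either direction only through a corner, so the path has one corner before t and another
  one after it. These are adjacent but not consecutive on an induced path.\<close>

lemma fan_vertex_not_inside_triangle:
  assumes C: "min_hole C" and f: "fan C c ws a b" and t: "t \<in> set ws"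
    and T: "{u, v} \<in> E" "{v, w} \<in> E" "{w, u} \<in> E" "{u, v, w} \<subseteq> C \<union> enclosed C" "t \<notin> {u, v, w}"
  shows "p t \<notin> inside (drawing (triangle u v w))"
proof
  assume ins: "p t \<in> inside (drawing (triangle u v w))"
  let ?L = "a # ws @ [b]" and ?D = "drawing (triangle u v w)"
  have X: "triangle u v w \<subseteq> E" and U: "\<Union>(triangle u v w) = {u, v, w}"
    using T by (auto simp: triangle_def)
  obtain vs where vs: "induced_cycle V E vs" "set vs = C"
    using C by (rule min_hole_obtain)
  have sub: "inside ?D \<subseteq> inside (boundary C)"
    using region_drawing[OF vs(1) X] U T(4) vs(2) by simp
  have Cn: "p x \<notin> inside ?D" if "x \<in> C" for x
    using sub that enclosed_disjoint[OF vs(1)] induced_cycleD(3)[OF graph vs(1)] unfolding vs(2) enclosed_def by blast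
  have ip: "ipath E ?L" and ab: "a \<in> C" "b \<in> C" using f by (auto simp: fan_def)
  have ipe: "{?L ! i, ?L ! Suc i} \<in> E" if "Suc i < length ?L" for i
    using ip that unfolding ipath_def by blast
  obtain i where i: "i < length ws" "ws ! i = t" using t by (auto simp: in_set_conv_nth)
  \<comment> \<open>The leading a shifts positions by one: corners before t have index at most
    \<open>i\<close>, those after it at least \<open>Suc (Suc i)\<close>.\<close>
  have Li: "?L ! Suc i = t" using i by (simp add: nth_append)
  have "\<exists>j. j \<le> i \<and> ?L ! j \<in> {u, v, w}"
  proof (rule ccontr)
    assume no: "\<not> ?thesis"
    have "j \<le> Suc i \<Longrightarrow> p (?L ! (Suc i - j)) \<in> inside ?D" for j
    proof (induction j)
      case 0
      then show ?case using ins Li by simp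
    next
      case (Suc j)
      then have s: "Suc (i - j) = Suc i - j" by simp
      have "?L ! (i - j) \<notin> \<Union>(triangle u v w)" "?L ! (Suc i - j) \<notin> \<Union>(triangle u v w)"
        using no T(5) Li unfolding U by (cases j; auto)+
      moreover have "{?L ! (Suc i - j), ?L ! (i - j)} \<in> E"
        using ipe[of "i - j"] i(1) Suc(2) s by (simp add: insert_commute)
      ultimately show ?case using edge_same_side(1)[OF _ X] Suc by simp
    qed
    from this[of "Suc i"] show False using Cn ab by simp
  qed
  then obtain j1 where j1: "j1 \<le> i" "?L ! j1 \<in> {u, v, w}" by blast
  have "\<exists>j. Suc (Suc i) \<le> j \<and> j < length ?L \<and> ?L ! j \<in> {u, v, w}"
  proof (rule ccontr)
    assume no: "\<not> ?thesis"
    have "Suc i + j < length ?L \<Longrightarrow> p (?L ! (Suc i + j)) \<in> inside ?D" for j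
    proof (induction j)
      case 0
      then show ?case using ins Li by simp
    next
      case (Suc j)
      have off: "?L ! l \<notin> {u, v, w}" if "Suc (Suc i) \<le> l" "l < length ?L" for l using no that by blast
      have "?L ! (Suc i + Suc j) \<notin> \<Union>(triangle u v w)" unfolding U using Suc.prems by (intro off) linarith+
      moreover have "?L ! (Suc i + j) \<notin> \<Union>(triangle u v w)"
      proof (cases j)
        case 0
        then show ?thesis unfolding U using T(5) Li by simp
      next
        case j: (Suc l)
        show ?thesis unfolding U using Suc.prems j by (intro off) linarith+
      qed
      moreover have "{?L ! (Suc i + j), ?L ! (Suc i + Suc j)} \<in> E" using ipe[of "Suc i + j"] Suc(2) by simp
      ultimately show ?case using edge_same_side(1)[OF _ X] Suc by simp
    qed
    from this[of "length ws - i"] show False using Cn ab i(1) by (simp add: nth_append)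
  qed
  then obtain j2 where j2: "Suc (Suc i) \<le> j2" "j2 < length ?L" "?L ! j2 \<in> {u, v, w}" by blast
  have "?L ! j1 \<noteq> ?L ! j2"
  proof -
    have "distinct ?L" using ip unfolding ipath_def by blast
    then show ?thesis using j1 j2 nth_eq_iff_index_eq[of ?L j1 j2] by simp
  qed
  then have "{?L ! j1, ?L ! j2} \<in> E" using j1(2) j2(3) T(1-3) by (auto simp: insert_commute)
  moreover have "j1 < j2" using j1 j2 by simp
  ultimately have "j2 = Suc j1" using ip j2(2) unfolding ipath_def by blast
  then show False using j1(1) j2(1) by simp
qed

text \<open>By \<open>K4\<close> one of four mutually adjacent vertices would be inside the triangle
  of the others. For a vertex of C this fails because the triangle stays in the closed interior of
  C, and for a fan vertex by the preceding lemma.\<close>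

lemma no_K4_in_fans:
  assumes C: "min_hole C" and f: "\<And>c. c \<in> C \<Longrightarrow> fan C c (F c) (A c) (B c)"
    and W: "W = C \<union> (\<Union>c\<in>C. set (F c))" and K: "K \<subseteq> W" "clique K E"
  shows "card K \<le> 3"
proof (rule ccontr)
  assume "\<not> ?thesis"
  then have "4 \<le> card K" by simp
  then obtain T where T: "T \<subseteq> K" "card T = 4" by (meson obtain_subset_with_card_n)
  obtain a T' where a: "T = insert a T'" "a \<notin> T'" "card T' = 3"
    using T(2) card_Suc_eq[of T 3] by auto
  obtain b c d where bcd: "T' = {b, c, d}" "b \<noteq> c" "c \<noteq> d" "b \<noteq> d" using a(3) by (auto simp: card_3_iff)
  have sub: "{a, b, c, d} \<subseteq> W" using T(1) K(1) a bcd by auto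
  have e: "{a, b} \<in> E" "{b, c} \<in> E" "{c, a} \<in> E" "{a, d} \<in> E" "{b, d} \<in> E" "{c, d} \<in> E"
    using T(1) K(2) a bcd unfolding clique_def by auto
  have e': "{d, a} \<in> E" "{d, b} \<in> E" "{d, c} \<in> E" "{a, c} \<in> E" using e by (simp_all add: insert_commute)
  have ne: "a \<noteq> b" "a \<noteq> c" "a \<noteq> d" using a(2) bcd(1) by auto
  have WR: "W \<subseteq> C \<union> enclosed C" using f unfolding W fan_def by blast
  obtain vs where vs: "induced_cycle V E vs" "set vs = C"
    using C by (rule min_hole_obtain)
  have no: "p t \<notin> inside (drawing (triangle u v w))"
    if t: "t \<in> W" and T: "{u, v} \<in> E" "{v, w} \<in> E" "{w, u} \<in> E" "{u, v, w} \<subseteq> W" "t \<notin> {u, v, w}" for t u v w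
  proof (cases "t \<in> C")
    case True
    have "triangle u v w \<subseteq> E" "\<Union>(triangle u v w) \<subseteq> C \<union> enclosed C" using T WR by (auto simp: triangle_def)
    then have "inside (drawing (triangle u v w)) \<subseteq> inside (boundary C)" using region_drawing[OF vs(1)] vs(2) by simp
    then show ?thesis
      using True enclosed_disjoint[OF vs(1)] induced_cycleD(3)[OF graph vs(1)] unfolding vs(2) enclosed_def by blast
  next
    case False
    then obtain c where c: "c \<in> C" "t \<in> set (F c)" using t W by blast
    show ?thesis
      by (rule fan_vertex_not_inside_triangle[OF C f[OF c(1)] c(2) T(1-3) _ T(5)]) (use T(4) WR in blast)
  qed
  show False
    using K4[OF e] no[of a b c d] no[of b c a d] no[of c a b d] no[of d a b c] e e' sub ne bcd(2-4) by auto
qed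

end

lemma alternate_parity:
  assumes "\<And>i. Suc i < length xs \<Longrightarrow> xs ! i \<in> S \<longleftrightarrow> xs ! Suc i \<notin> S" and "i < length xs"
  shows "xs ! i \<in> S \<longleftrightarrow> (xs ! 0 \<in> S \<longleftrightarrow> even i)"
  using assms(2)
proof (induction i)
  case (Suc i)
  then show ?case using assms(1)[of i] by auto
qed simp

context h_perfect_triang
begin

lemma no_min_hole:
  assumes C: "min_hole C"
  shows False
proof -
  obtain vs where vs: "induced_cycle V E vs" "set vs = C" "length vs = card C" "5 \<le> length vs" "odd (length vs)"
    using C by (rule min_hole_obtain)
  have fin: "finite C" "finite (C \<union> enclosed C)" "C \<union> enclosed C \<subseteq> V" using min_hole_finite[OF C] by auto
  have "\<forall>c\<in>C. \<exists>ws a b. fan C c ws a b" using fan_exists[OF C] by metis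
  then obtain F A B where f: "\<And>c. c \<in> C \<Longrightarrow> fan C c (F c) (A c) (B c)" by metis
  define W where "W = C \<union> (\<Union>c\<in>C. set (F c))"
  have FI: "set (F c) \<subseteq> enclosed C" if "c \<in> C" for c using f[OF that] by (simp add: fan_def)
  have WR: "W \<subseteq> C \<union> enclosed C" using FI unfolding W_def by blast
  \<comment> \<open>The value 1/3 makes every triangle within \<open>W\<close> tight; the cycle
    constraint holds since |C|/3 \<le> (|C| - 1)/2 once |C| \<ge> 3.\<close>
  define x :: "real ^ 'v" where "x = (\<chi> v. if v \<in> W then 1 / 3 else 0)"
  have xW: "x $ v = 1 / 3" if "v \<in> W" for v using that by (simp add: x_def)
  have x0: "x $ v = 0" if "v \<notin> W" for v using that by (simp add: x_def)
  have xP: "x \<in> h_polytope V E"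
  proof (rule region_vector_in_polytope[OF C])
    show "x $ v = 0" if "v \<notin> C \<union> enclosed C" for v using that WR by (intro x0) auto
    show "0 \<le> x $ v" for v by (simp add: x_def)
    have "x $ v = 1 / 3" if "v \<in> C" for v using that xW by (simp add: W_def)
    then have "(\<Sum>v\<in>C. x $ v) = (\<Sum>v\<in>C. 1 / 3)" by (intro sum.cong) auto
    also have "\<dots> = real (card C) * (1 / 3)" by simp
    also have "\<dots> \<le> (real (card C) - 1) / 2" using vs(3,4) by simp
    finally show "(\<Sum>v\<in>C. x $ v) \<le> (real (card C) - 1) / 2" .
    fix K assume K: "K \<subseteq> C \<union> enclosed C" "clique K E"
    have "card (K \<inter> W) \<le> 3" using K by (intro no_K4_in_fans[OF C f W_def]) (auto simp: clique_def)
    have "(\<Sum>v\<in>K. x $ v) = (\<Sum>v\<in>K \<inter> W. x $ v)"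
      using x0 by (intro sum.mono_neutral_right) auto
    also have "\<dots> = (\<Sum>v\<in>K \<inter> W. 1 / 3)" using xW by (intro sum.cong) auto
    also have "\<dots> = real (card (K \<inter> W)) * (1 / 3)" by simp
    also have "\<dots> \<le> 1" using \<open>card (K \<inter> W) \<le> 3\<close> by simp
    finally show "(\<Sum>v\<in>K. x $ v) \<le> 1" .
  qed
  have "C \<noteq> {}" using vs by auto
  then obtain c0 where "c0 \<in> C" by blast
  then have "c0 \<in> W" by (simp add: W_def)
  then have pos: "0 < x $ c0" using xW[of c0] by simp
  obtain S where S: "S \<subseteq> V" "indep S E" "c0 \<in> S"
    and tight: "\<forall>A \<beta>. (\<forall>y\<in>h_polytope V E. (\<Sum>v\<in>A. y $ v) \<le> \<beta>) \<longrightarrow> (\<Sum>v\<in>A. x $ v) = \<beta>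
        \<longrightarrow> real (card (S \<inter> A)) = \<beta>"
    using hp xP pos by (rule h_perfect_stable_set)
  have tri: "card (S \<inter> {u, v, w}) = 1"
    if e: "{u, v} \<in> E" "{v, w} \<in> E" "{u, w} \<in> E" and s: "{u, v, w} \<subseteq> W" for u v w
  proof -
    have ne: "u \<noteq> v" "v \<noteq> w" "u \<noteq> w" using e edge_V by blast+
    have "clique {u, v, w} E" using e by (auto simp: clique_def insert_commute)
    moreover have "{u, v, w} \<subseteq> V" using e edge_V by blast
    ultimately have "\<And>y. y \<in> h_polytope V E \<Longrightarrow> (\<Sum>v\<in>{u, v, w}. y $ v) \<le> 1"
      by (intro h_polytope_clique)
    moreover have "x $ u = 1 / 3" "x $ v = 1 / 3" "x $ w = 1 / 3" using s xW[of u] xW[of v] xW[of w] by auto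
    then have "(\<Sum>v\<in>{u, v, w}. x $ v) = 1" using ne by simp
    ultimately have "real (card (S \<inter> {u, v, w})) = 1" by (rule tight[rule_format])
    then show ?thesis by simp
  qed
  \<comment> \<open>If c is not in S, each triangle formed by c and two consecutive entries of
    \<open>L\<close> has exactly one of these in S, so membership in S alternates along
    \<open>L\<close>.\<close>
  have exact: "card (S \<inter> {d \<in> C. d = c \<or> {d, c} \<in> E}) = 1" if c: "c \<in> C" for c
  proof -
    define L where "L = A c # F c @ [B c]"
    have fc: "2 \<le> length (F c)" "\<And>w. w \<in> set (F c) \<Longrightarrow> {c, w} \<in> E" "A c \<in> C" "B c \<in> C" "A c \<noteq> B c"
      "{c, A c} \<in> E" "{c, B c} \<in> E" "ipath E L"
      using f[OF c] unfolding fan_def L_def by blast+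
    have LW: "set L \<subseteq> W" using fc(3,4) c unfolding L_def W_def by auto
    have adj: "{c, l} \<in> E" if "l \<in> set L" for l using that fc unfolding L_def by auto
    have nb: "{d \<in> C. d = c \<or> {d, c} \<in> E} = {c, A c, B c}"
    proof -
      have "card {d \<in> C. {c, d} \<in> E} = 2" using induced_cycle_degree[OF graph vs(1)] vs(2) c by simp
      moreover have "{A c, B c} \<subseteq> {d \<in> C. {c, d} \<in> E}" "card {A c, B c} = 2" using fc by auto
      ultimately have "{A c, B c} = {d \<in> C. {c, d} \<in> E}"
        using fin(1) by (intro card_subset_eq) auto
      then show ?thesis using c by (auto simp: insert_commute)
    qed
    have ne: "c \<noteq> A c" "c \<noteq> B c" using fc edge_V by blast+
    show ?thesis
    proof (cases "c \<in> S")
      case True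
      then have "A c \<notin> S" "B c \<notin> S" using S(2) fc ne unfolding indep_def by blast+
      then have "S \<inter> {c, A c, B c} = {c}" using True by auto
      then show ?thesis unfolding nb by simp
    next
      case False
      have alt: "L ! i \<in> S \<longleftrightarrow> L ! Suc i \<notin> S" if i: "Suc i < length L" for i
      proof -
        have LL: "L ! i \<in> set L" "L ! Suc i \<in> set L" using i by auto
        have e: "{L ! i, L ! Suc i} \<in> E" using fc(8) i unfolding ipath_def by blast
        have "card (S \<inter> {c, L ! i, L ! Suc i}) = 1"
          by (rule tri) (use LL adj e LW c in \<open>auto simp: W_def\<close>)
        moreover have "S \<inter> {c, L ! i, L ! Suc i} = S \<inter> {L ! i, L ! Suc i}" using False by auto
        moreover have "L ! i \<noteq> L ! Suc i" using e edge_V by blast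
        ultimately show ?thesis by (cases "L ! i \<in> S"; cases "L ! Suc i \<in> S") auto
      qed
      \<comment> \<open>The fan is even, so \<open>B c\<close> has odd position in \<open>L\<close>,
        and alternation puts exactly one of \<open>A c\<close>, \<open>B c\<close> into S.\<close>
      have "L ! Suc (length (F c)) \<in> S \<longleftrightarrow> (L ! 0 \<in> S \<longleftrightarrow> even (Suc (length (F c))))"
        by (rule alternate_parity[OF alt]) (auto simp: L_def)
      moreover have "even (length (F c))" using fan_even[OF C all_clean[OF C c] f[OF c]] .
      ultimately have "B c \<in> S \<longleftrightarrow> A c \<notin> S" by (simp add: L_def nth_append)
      then have "S \<inter> {c, A c, B c} = {A c} \<or> S \<inter> {c, A c, B c} = {B c}" using False by auto
      then show ?thesis unfolding nb by auto
    qed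
  qed
  \<comment> \<open>Double counting of pairs of a member s of S and a vertex c that are equal or
    adjacent on the cycle: every c occurs once, every s three times.\<close>
  have "card C = (\<Sum>c\<in>C. card {s \<in> S \<inter> C. s = c \<or> {s, c} \<in> E})"
  proof -
    have "card {s \<in> S \<inter> C. s = c \<or> {s, c} \<in> E} = 1" if "c \<in> C" for c
    proof -
      have "{s \<in> S \<inter> C. s = c \<or> {s, c} \<in> E} = S \<inter> {d \<in> C. d = c \<or> {d, c} \<in> E}" by blast
      then show ?thesis using exact[OF that] by simp
    qed
    then show ?thesis by simp
  qed
  also have "\<dots> = (\<Sum>s\<in>S \<inter> C. card {c \<in> C. s = c \<or> {s, c} \<in> E})"
    using fin(1) by (intro sum_multicount_gen) auto
  also have "\<dots> = (\<Sum>s\<in>S \<inter> C. 3)"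
  proof (rule sum.cong[OF refl])
    fix s assume s: "s \<in> S \<inter> C"
    have "s \<notin> {d \<in> C. {s, d} \<in> E}" using edge_V by blast
    moreover have "{c \<in> C. s = c \<or> {s, c} \<in> E} = insert s {d \<in> C. {s, d} \<in> E}" using s by auto
    moreover have "card {d \<in> C. {s, d} \<in> E} = 2" using induced_cycle_degree[OF graph vs(1)] vs(2) s by simp
    ultimately show "card {c \<in> C. s = c \<or> {s, c} \<in> E} = 3" using fin(1) by simp
  qed
  finally have "card C = 3 * card (S \<inter> C)" by simp
  \<comment> \<open>The length is odd, at least 5 and a multiple of 3.\<close>
  then have n9: "9 \<le> length vs" using vs(3-5) by presburger
  have hole: "vs ! i \<in> C" if "i < 9" for i using that n9 vs(2) nth_mem[of i vs] by simp
  \<comment> \<open>The bound j < 8 keeps away from the last position, hence from the closing edge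
    of the cycle.\<close>
  have nonadj: "vs ! i \<noteq> vs ! j" "{vs ! i, vs ! j} \<notin> E" if "Suc i < j" "j < 8" for i j
    using induced_cycleD(2)[OF graph vs(1)] induced_cycleD(4)[OF graph vs(1), of i j] that n9
    by (auto simp: nth_eq_iff_index_eq)
  have touch: "\<exists>u u'. u \<in> set (F (vs ! i)) \<and> u' \<in> set (F (vs ! j)) \<and> (u = u' \<or> {u, u'} \<in> E)"
    if "Suc i < j" "j < 8" for i j
  proof -
    have c: "vs ! i \<in> C" "vs ! j \<in> C" using hole that by auto
    show ?thesis
      using fans_touch[OF C all_clean[OF C c(1)] f[OF c(1)] all_clean[OF C c(2)] f[OF c(2)] nonadj[OF that]]
      by metis
  qed
  \<comment> \<open>Positions 0, 4 and 2, 6 alternate around the cycle, so the connections through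
    the two touching pairs of fans have to cross.\<close>
  obtain u u' where u: "u \<in> set (F (vs ! 0))" "u' \<in> set (F (vs ! 4))" "u = u' \<or> {u, u'} \<in> E"
    using touch[of 0 4] by auto
  obtain v v' where v: "v \<in> set (F (vs ! 2))" "v' \<in> set (F (vs ! 6))" "v = v' \<or> {v, v'} \<in> E"
    using touch[of 2 6] by auto
  have Fadj: "w \<in> enclosed C" "{w, vs ! i} \<in> E" if "w \<in> set (F (vs ! i))" "i < 9" for w i
    using f[OF hole[OF that(2)]] that(1) by (auto simp: fan_def insert_commute)
  \<comment> \<open>A vertex common to the fans of two nonadjacent vertices of C would be a hub.
    Hence the two connections have no vertex in common.\<close>
  have disj: "w \<noteq> w'" if "w \<in> set (F (vs ! i))" "w' \<in> set (F (vs ! j))" "Suc i < j" "j < 8" for w w' i j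
  proof
    assume eq: "w = w'"
    have "hub C w"
      unfolding hub_def using Fadj[OF that(1)] Fadj[OF that(2)] that hole[of i] hole[of j] nonadj[OF that(3,4)] eq
      by auto
    then show False using no_hub[OF C] by blast
  qed
  define xs where "xs = [vs ! 1, vs ! 2, vs ! 3]"
  define ys where "ys = drop 5 vs"
  have dec: "vs = vs ! 0 # xs @ vs ! 4 # ys"
  proof (rule nth_equalityI)
    show "length vs = length (vs ! 0 # xs @ vs ! 4 # ys)" using n9 by (simp add: xs_def ys_def)
    fix i assume i: "i < length vs"
    show "vs ! i = (vs ! 0 # xs @ vs ! 4 # ys) ! i"
    proof (cases "i < 5")
      case True
      then have "i = 0 \<or> i = 1 \<or> i = 2 \<or> i = 3 \<or> i = 4" by presburger
      then show ?thesis by (auto simp: xs_def)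
    next
      case False
      then obtain k where k: "i = 5 + k" using le_Suc_ex by (metis not_less)
      then show ?thesis using i by (simp add: xs_def ys_def)
    qed
  qed
  have y6: "vs ! 6 \<in> set ys"
  proof -
    have "ys ! 1 = vs ! 6" "1 < length ys" using n9 by (simp_all add: ys_def)
    then show ?thesis by (metis nth_mem)
  qed
  have c: "induced_cycle V E (vs ! 0 # xs @ vs ! 4 # ys)" "set (vs ! 0 # xs @ vs ! 4 # ys) = C"
    using vs(1,2) dec by simp_all
  \<comment> \<open>The connection from position 4 to position 0 meets u' before u, and it has a
    single inner vertex if the fans share one.\<close>
  define ms where "ms = (if u = u' then [u] else [u', u])"
  have ms: "ms \<noteq> []" "distinct ms" "set ms = {u, u'}" by (auto simp: ms_def)
  have w: "walk_edges (vs ! 4 # ms @ [vs ! 0]) \<subseteq> E"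
    using Fadj(2)[OF u(1)] Fadj(2)[OF u(2)] u(3) by (auto simp: ms_def insert_commute)
  have I: "set ms \<subseteq> enclosed C" using Fadj(1)[OF u(1)] Fadj(1)[OF u(2)] ms(3) by simp
  have vn: "v \<notin> set ms" "v' \<notin> set ms"
    unfolding ms(3) using disj[OF u(1) v(1)] disj[OF v(1) u(2)] disj[OF u(1) v(2)] disj[OF u(2) v(2)] by auto
  show False
    by (rule hole_no_crossing[OF c _ ms(1,2) I w v(3) Fadj(1)[OF v(1)] Fadj(1)[OF v(2)] vn
          _ Fadj(2)[OF v(1)] y6 Fadj(2)[OF v(2)]])
      (auto simp: xs_def)
qed

lemma no_odd_hole: "\<not> odd_hole C"
proof
  assume "odd_hole C"
  then obtain C' where "odd_hole C'" "\<And>C''. odd_hole C'' \<Longrightarrow> card (C' \<union> enclosed C') \<le> card (C'' \<union> enclosed C'')"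
    using ex_has_least_nat[of odd_hole C "\<lambda>C. card (C \<union> enclosed C)"] by blast
  then show False using no_min_hole unfolding min_hole_def by blast
qed

end

subsection \<open>Colourings and stable set covers\<close>

lemma proper_coloring_induced:
  "proper_coloring W (induced_edges W E) k c \<longleftrightarrow> proper_coloring W E k c"
  unfolding proper_coloring_def induced_edges_def by auto

lemma clique_induced: "K \<subseteq> W \<Longrightarrow> clique K (induced_edges W E) \<longleftrightarrow> clique K E"
  unfolding clique_def induced_edges_def by auto

lemma clique_number_bound:
  assumes "finite W" "K \<subseteq> W" "clique K E"
  shows "card K \<le> clique_number W (induced_edges W E)"
  unfolding clique_number_def
proof (rule Max_ge)
  have "clique K (induced_edges W E)" using assms clique_induced by blast
  then show "card K \<in> card ` {K. K \<subseteq> W \<and> clique K (induced_edges W E)}" using assms(2) by blast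
qed (use assms in simp)

lemma clique_number_attained:
  assumes "finite W"
  obtains K where "K \<subseteq> W" "clique K E" "card K = clique_number W (induced_edges W E)"
proof -
  let ?A = "card ` {K. K \<subseteq> W \<and> clique K (induced_edges W E)}"
  have "{} \<in> {K. K \<subseteq> W \<and> clique K (induced_edges W E)}" by (simp add: clique_def)
  then have "?A \<noteq> {}" by blast
  then have "clique_number W (induced_edges W E) \<in> ?A"
    unfolding clique_number_def using assms by (intro Max_in) auto
  then obtain K where "K \<subseteq> W" "clique K (induced_edges W E)"
    "clique_number W (induced_edges W E) = card K" by blast
  then show thesis using that[of K] clique_induced[of K W E] by simp
qed

lemma clique_coloring_card:
  assumes c: "proper_coloring W E k c" and K: "K \<subseteq> W" "clique K E"
  shows "card K \<le> k"
proof -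
  have "inj_on c K"
    using c K unfolding proper_coloring_def clique_def inj_on_def by blast
  moreover have "c ` K \<subseteq> {..<k}" using c K by (auto simp: proper_coloring_def)
  ultimately show ?thesis using card_inj_on_le[of c K "{..<k}"] by simp
qed

lemma perfect_iff_coloring:
  assumes g: "simple_graph V E"
  shows "perfect V E \<longleftrightarrow> (\<forall>W\<subseteq>V. \<forall>k. (\<forall>K\<subseteq>W. clique K E \<longrightarrow> card K \<le> k) \<longrightarrow>
    (\<exists>c. proper_coloring W E k c))"
proof -
  have main: "chromatic_number W (induced_edges W E) = clique_number W (induced_edges W E) \<longleftrightarrow>
      (\<forall>k. (\<forall>K\<subseteq>W. clique K E \<longrightarrow> card K \<le> k) \<longrightarrow> (\<exists>c. proper_coloring W E k c))" (is "?L \<longleftrightarrow> ?R")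
    if W: "W \<subseteq> V" for W
  proof
    let ?P = "\<lambda>k. \<exists>c. proper_coloring W (induced_edges W E) k c"
    let ?w = "clique_number W (induced_edges W E)"
    have fin: "finite W" using g W unfolding simple_graph_def by (blast intro: finite_subset)
    have mono: "proper_coloring W E k c" if "proper_coloring W E j c" "j \<le> k" for j k c
      using that unfolding proper_coloring_def by force
    obtain K where K: "K \<subseteq> W" "clique K E" "card K = ?w"
      using fin by (rule clique_number_attained)
    show ?R if ?L
    proof (intro allI impI)
      fix k assume "\<forall>K\<subseteq>W. clique K E \<longrightarrow> card K \<le> k"
      then have "?w \<le> k" using K by metis
      obtain c where c: "inj_on c W" "c ` W = {0..<card W}"
        using ex_bij_betw_finite_nat[OF fin] by (auto simp: bij_betw_def)
      have "proper_coloring W E (card W) c"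
        unfolding proper_coloring_def
      proof (intro conjI ballI impI)
        show "c v < card W" if "v \<in> W" for v using c(2) that by auto
        show "c u \<noteq> c v" if "u \<in> W" "v \<in> W" "{u, v} \<in> E" for u v
          using edge_neq[OF g that(3)] inj_onD[OF c(1)] that by blast
      qed
      then have "?P (card W)" using proper_coloring_induced by blast
      then have "?P (LEAST k. ?P k)" by (rule LeastI)
      then have "?P ?w" using \<open>?L\<close> unfolding chromatic_number_def by simp
      then show "\<exists>c. proper_coloring W E k c"
        using mono[OF _ \<open>?w \<le> k\<close>] proper_coloring_induced by blast
    qed
    show ?L if R: ?R
      unfolding chromatic_number_def
    proof (rule Least_equality)
      show "?P ?w" using R clique_number_bound[OF fin] proper_coloring_induced by blast
      show "?w \<le> k" if P: "?P k" for k
      proof -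
        obtain c where "proper_coloring W E k c" using P unfolding proper_coloring_induced by blast
        then have "card K \<le> k" using K(1,2) by (rule clique_coloring_card)
        then show ?thesis using K(3) by simp
      qed
    qed
  qed
  show ?thesis
    unfolding perfect_def by (rule iff_allI, rule imp_cong[OF refl], erule main)
qed

context h_perfect_triang
begin

text \<open>With odd holes excluded, an odd induced cycle is a triangle, and its constraint has
  right-hand side (3 - 1)/2 = 1, that of a clique.\<close>

lemma polytope_cliques_only:
  fixes x :: "real ^ 'v"
  assumes x: "\<And>v. v \<notin> V \<Longrightarrow> x $ v = 0" "\<And>v. 0 \<le> x $ v"
    and cl: "\<And>K. K \<subseteq> V \<Longrightarrow> clique K E \<Longrightarrow> (\<Sum>v\<in>K. x $ v) \<le> 1"
  shows "x \<in> h_polytope V E"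
proof -
  have cy: "(\<Sum>v\<in>set us. x $ v) \<le> (real (length us) - 1) / 2"
    if us: "induced_cycle V E us" "odd (length us)" for us
  proof -
    have n: "3 \<le> length us" using induced_cycleD(1)[OF graph us(1)] by auto
    have "\<not> 5 \<le> length us" using odd_hole_cycle[OF us] no_odd_hole by blast
    moreover have "length us \<noteq> 4" using us(2) by auto
    ultimately have 3: "length us = 3" using n by linarith
    then have "clique (set us) E" using induced_cycle_3_clique[OF graph us(1)] by blast
    then show ?thesis using cl[of "set us"] induced_cycleD(3)[OF graph us(1)] 3 by simp
  qed
  show ?thesis
    unfolding h_polytope_def mem_Collect_eq using x cl cy by (intro conjI allI impI ballI) auto
qed

text \<open>Induction on the number of colours, with W arbitrary because each colour class is
  removed from it. The value 1/(k + 1) is chosen to make the cliques of k + 1 vertices in W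
  tight.\<close>

lemma coloring_exists:
  assumes "W \<subseteq> V" "\<And>K. K \<subseteq> W \<Longrightarrow> clique K E \<Longrightarrow> card K \<le> k"
  shows "\<exists>c. proper_coloring W E k c"
  using assms
proof (induction k arbitrary: W)
  case 0
  have "W = {}"
  proof (rule ccontr)
    assume "W \<noteq> {}"
    then obtain v where "v \<in> W" by blast
    then show False using 0(2)[of "{v}"] by (simp add: clique_def)
  qed
  then show ?case by (simp add: proper_coloring_def)
next
  case (Suc k)
  show ?case
  proof (cases "W = {}")
    case True
    then show ?thesis by (simp add: proper_coloring_def)
  next
    case False
    then obtain v0 where v0: "v0 \<in> W" by blast
    define x :: "real ^ 'v" where "x = (\<chi> v. if v \<in> W then 1 / Suc k else 0)"
    have xW: "x $ v = 1 / Suc k" if "v \<in> W" for v using that by (simp add: x_def)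
    have x0: "x $ v = 0" if "v \<notin> W" for v using that by (simp add: x_def)
    have sumW: "(\<Sum>v\<in>K. x $ v) = real (card K) * (1 / Suc k)" if "K \<subseteq> W" for K
    proof -
      have "(\<Sum>v\<in>K. x $ v) = (\<Sum>v\<in>K. 1 / Suc k)" using that xW by (intro sum.cong) auto
      then show ?thesis by simp
    qed
    have xP: "x \<in> h_polytope V E"
    proof (rule polytope_cliques_only)
      show "x $ v = 0" if "v \<notin> V" for v using that Suc(2) by (intro x0) auto
      show "0 \<le> x $ v" for v by (simp add: x_def)
      fix K assume K: "K \<subseteq> V" "clique K E"
      have "card (K \<inter> W) \<le> Suc k" using K by (intro Suc(3)) (auto simp: clique_def)
      have "(\<Sum>v\<in>K. x $ v) = (\<Sum>v\<in>K \<inter> W. x $ v)"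
        using x0 by (intro sum.mono_neutral_right) auto
      also have "\<dots> = real (card (K \<inter> W)) * (1 / Suc k)" by (rule sumW) simp
      also have "\<dots> \<le> 1" using \<open>card (K \<inter> W) \<le> Suc k\<close> by (simp add: divide_simps)
      finally show "(\<Sum>v\<in>K. x $ v) \<le> 1" .
    qed
    have pos: "0 < x $ v0" using xW[OF v0] by simp
    obtain S where S: "S \<subseteq> V" "indep S E" "v0 \<in> S"
      and tight: "\<forall>A \<beta>. (\<forall>y\<in>h_polytope V E. (\<Sum>v\<in>A. y $ v) \<le> \<beta>) \<longrightarrow> (\<Sum>v\<in>A. x $ v) = \<beta>
        \<longrightarrow> real (card (S \<inter> A)) = \<beta>"
      using hp xP pos by (rule h_perfect_stable_set)
    have "card K \<le> k" if K: "K \<subseteq> W - S" "clique K E" for K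
    proof (rule ccontr)
      assume "\<not> card K \<le> k"
      moreover have "card K \<le> Suc k" using K Suc(3) by blast
      ultimately have cK: "card K = Suc k" by simp
      have KW: "K \<subseteq> W" "K \<subseteq> V" using K(1) Suc(2) by auto
      have "real (card (S \<inter> K)) = 1"
        using tight[rule_format, of K 1] h_polytope_clique[OF _ KW(2) K(2)] sumW[OF KW(1)] cK by simp
      moreover have "S \<inter> K = {}" using K(1) by blast
      ultimately show False by simp
    qed
    then obtain c where c: "proper_coloring (W - S) E k c" using Suc.IH[of "W - S"] Suc(2) by blast
    let ?c = "\<lambda>v. if v \<in> S then k else c v"
    have "proper_coloring W E (Suc k) ?c"
      unfolding proper_coloring_def
    proof (intro conjI ballI impI)
      show "?c v < Suc k" if "v \<in> W" for v
        using c that unfolding proper_coloring_def by (cases "v \<in> S") (auto simp: less_Suc_eq)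
      fix u v assume uv: "u \<in> W" "v \<in> W" "{u, v} \<in> E"
      have "\<not> (u \<in> S \<and> v \<in> S)" using S(2) uv(3) edge_V[OF uv(3)] unfolding indep_def by blast
      then show "?c u \<noteq> ?c v"
        using c uv unfolding proper_coloring_def by (cases "u \<in> S"; cases "v \<in> S") force+
    qed
    then show ?thesis by blast
  qed
qed

lemma h_perfect_imp_perfect: "perfect V E"
  unfolding perfect_iff_coloring[OF graph] using coloring_exists by blast

end

section \<open>From perfection to h-perfection\<close>

text \<open>An indexed family and not a set of stable sets, since repeated and empty classes have to
  be counted.\<close>

definition weighted_cover :: "'v set \<Rightarrow> 'v set set \<Rightarrow> ('v \<Rightarrow> nat) \<Rightarrow> nat \<Rightarrow> (nat \<Rightarrow> 'v set) \<Rightarrow> bool" where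
  "weighted_cover V E w N f \<longleftrightarrow> (\<forall>i<N. f i \<subseteq> V \<and> indep (f i) E) \<and>
    (\<forall>v\<in>V. card {i. i < N \<and> v \<in> f i} = w v)"

lemma weighted_cover_add:
  assumes f: "weighted_cover V E w N f" and S: "S \<subseteq> V" "indep S E"
    and w': "\<And>v. v \<in> V \<Longrightarrow> w' v = (if v \<in> S then Suc (w v) else w v)"
  shows "weighted_cover V E w' (Suc N) (f(N := S))"
  unfolding weighted_cover_def
proof (intro conjI allI impI ballI)
  show "(f(N := S)) i \<subseteq> V" "indep ((f(N := S)) i) E" if "i < Suc N" for i
    using f S that unfolding weighted_cover_def by (auto simp: less_Suc_eq)
  fix v assume v: "v \<in> V"
  have "{i. i < Suc N \<and> v \<in> (f(N := S)) i} =
      (if v \<in> S then insert N {i. i < N \<and> v \<in> f i} else {i. i < N \<and> v \<in> f i})"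
    by (auto simp: less_Suc_eq)
  then show "card {i. i < Suc N \<and> v \<in> (f(N := S)) i} = w' v"
    using f v w' unfolding weighted_cover_def by auto
qed

text \<open>Lovasz replication: a vertex of weight at least two is lowered by one. If this does not lower
  the largest weight of a clique, then every heaviest clique avoids the vertex and meets each class of
  the cover in exactly one point, so a class containing the vertex may be split off.\<close>

lemma perfect_weighted_cover:
  assumes g: "simple_graph V E" and p: "perfect V E"
  shows "(\<And>K. K \<subseteq> V \<Longrightarrow> clique K E \<Longrightarrow> sum w K \<le> N) \<Longrightarrow> \<exists>f. weighted_cover V E w N f"
proof (induction "sum w V" arbitrary: w N rule: less_induct)
  case less
  note cl = less.prems
  have fin: "finite V" using g unfolding simple_graph_def by blast
  show ?case
  proof (cases "\<forall>v\<in>V. w v \<le> 1")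
    case True
    \<comment> \<open>For 0-1 weights the colour classes of the vertices of weight 1 form the
      cover.\<close>
    let ?W = "{v \<in> V. w v = 1}"
    have "card K \<le> N" if K: "K \<subseteq> ?W" "clique K E" for K
    proof -
      have "card K = sum w K" using K(1) by (subst card_eq_sum, intro sum.cong) auto
      then show ?thesis using cl[of K] K by auto
    qed
    moreover have "?W \<subseteq> V" by blast
    ultimately obtain c where c: "proper_coloring ?W E N c"
      using p unfolding perfect_iff_coloring[OF g] by blast
    have "weighted_cover V E w N (\<lambda>i. {v \<in> ?W. c v = i})"
      unfolding weighted_cover_def
    proof (intro conjI allI impI ballI)
      show "{v \<in> ?W. c v = i} \<subseteq> V" for i by blast
      show "indep {v \<in> ?W. c v = i} E" for i
        using c unfolding proper_coloring_def indep_def by blast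
      fix v assume v: "v \<in> V"
      have "{i. i < N \<and> v \<in> {v \<in> ?W. c v = i}} = (if w v = 1 then {c v} else {})"
        using c v unfolding proper_coloring_def by auto
      then show "card {i. i < N \<and> v \<in> {v \<in> ?W. c v = i}} = w v" using True v by force
    qed
    then show ?thesis by blast
  next
    case False
    then obtain x where x: "x \<in> V" "2 \<le> w x" by force
    define w1 where "w1 = w(x := w x - 1)"
    have w1: "w1 v \<le> w v" for v by (simp add: w1_def)
    have s1: "sum w1 V < sum w V" using fin x w1 by (intro sum_strict_mono_ex1) (auto simp: w1_def)
    have finK: "finite K" if "K \<subseteq> V" for K using that fin by (rule finite_subset)
    have "clique {x} E" by (simp add: clique_def)
    then have N: "0 < N" using cl[of "{x}"] x by simp
    then obtain M where M: "N = Suc M" by (cases N) auto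
    show ?thesis
    proof (cases "\<forall>K\<subseteq>V. clique K E \<longrightarrow> sum w1 K \<le> M")
      case True
      then obtain f where f: "weighted_cover V E w1 M f" using less.hyps[OF s1] by blast
      have "weighted_cover V E w (Suc M) (f(M := {x}))"
        by (rule weighted_cover_add[OF f]) (use x in \<open>auto simp: indep_def w1_def\<close>)
      then show ?thesis using M by blast
    next
      case False
      have "sum w1 K \<le> N" if "K \<subseteq> V" "clique K E" for K
        using cl[OF that] sum_mono[of K w1 w] w1 by (meson le_trans)
      then obtain f where f: "weighted_cover V E w1 N f" using less.hyps[OF s1] by blast
      have fi: "f i \<subseteq> V" "indep (f i) E" if "i < N" for i
        using f that unfolding weighted_cover_def by blast+
      have fv: "card {i. i < N \<and> v \<in> f i} = w1 v" if "v \<in> V" for v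
        using f that unfolding weighted_cover_def by blast
      have "card {i. i < N \<and> x \<in> f i} \<noteq> 0" using fv[OF x(1)] x(2) by (simp add: w1_def)
      then have "{i. i < N \<and> x \<in> f i} \<noteq> {}" by (metis card.empty)
      then obtain j where j: "j < N" "x \<in> f j" by blast
      define S where "S = f j"
      have pos: "0 < w1 v" if "v \<in> S" for v
      proof -
        have "v \<in> V" using that fi[OF j(1)] S_def by blast
        moreover have "j \<in> {i. i < N \<and> v \<in> f i}" using that j S_def by blast
        ultimately show ?thesis using fv[of v] card_gt_0_iff[of "{i. i < N \<and> v \<in> f i}"] by fastforce
      qed
      \<comment> \<open>As x was already lowered in \<open>w1\<close>, this is \<open>w\<close>
        lowered by one on all of \<open>S\<close>; by \<open>pos\<close> the subtraction is not
        truncated.\<close>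
      define w2 where "w2 v = (if v \<in> S - {x} then w1 v - 1 else w1 v)" for v
      have w2: "w2 v \<le> w1 v" for v by (simp add: w2_def)
      have "sum w2 V \<le> sum w1 V" using w2 by (intro sum_mono) auto
      then have s2: "sum w2 V < sum w V" using s1 by simp
      \<comment> \<open>A clique of \<open>w2\<close>-weight N would have weight N for
        \<open>w1\<close> and \<open>w\<close> too, so it would contain neither x nor any vertex of
        \<open>S\<close>. But N is also the sum, over the N classes, of the number of its vertices
        in the class, which is at most 1 for each class and 0 for class j.\<close>
      have "sum w2 K \<le> M" if K: "K \<subseteq> V" "clique K E" for K
      proof (rule ccontr)
        assume "\<not> sum w2 K \<le> M"
        moreover have "sum w2 K \<le> sum w1 K" using w2 by (intro sum_mono) auto
        moreover have "sum w1 K \<le> sum w K" using w1 by (intro sum_mono) auto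
        ultimately have eq: "sum w2 K = N" "sum w1 K = N" "sum w K = N" using cl[OF K] M by linarith+
        have xK: "x \<notin> K"
        proof
          assume "x \<in> K"
          then have "sum w1 K < sum w K"
            using finK[OF K(1)] w1 x by (intro sum_strict_mono_ex1) (auto simp: w1_def)
          then show False using eq by simp
        qed
        have SK: "K \<inter> S = {}"
        proof (rule ccontr)
          assume "K \<inter> S \<noteq> {}"
          then obtain y where y: "y \<in> K" "y \<in> S" by blast
          then have "w2 y < w1 y" using pos[of y] xK by (auto simp: w2_def)
          then have "sum w2 K < sum w1 K"
            using finK[OF K(1)] w2 y(1) by (intro sum_strict_mono_ex1) auto
          then show False using eq by simp
        qed
        have le1: "card {v \<in> K. v \<in> f i} \<le> 1" if "i < N" for i
        proof -
          have "u = v" if "u \<in> K" "u \<in> f i" "v \<in> K" "v \<in> f i" for u v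
            using that K(2) fi(2)[OF \<open>i < N\<close>] unfolding clique_def indep_def by blast
          then show ?thesis using finK[OF K(1)] unfolding One_nat_def
            by (subst card_le_Suc0_iff_eq) auto
        qed
        have "N = (\<Sum>v\<in>K. card {i \<in> {..<N}. v \<in> f i})"
        proof -
          have "card {i \<in> {..<N}. v \<in> f i} = w1 v" if "v \<in> K" for v
          proof -
            have "{i \<in> {..<N}. v \<in> f i} = {i. i < N \<and> v \<in> f i}" by auto
            then show ?thesis using fv K(1) that by auto
          qed
          then show ?thesis using eq(2) by simp
        qed
        also have "\<dots> = (\<Sum>i<N. card {v \<in> K. v \<in> f i})"
          using finK[OF K(1)] by (intro sum_multicount_gen) auto
        also have "\<dots> < (\<Sum>i<N. 1)"
        proof (rule sum_strict_mono_ex1)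
          show "\<forall>i\<in>{..<N}. card {v \<in> K. v \<in> f i} \<le> 1" using le1 by blast
          have e: "{v \<in> K. v \<in> f j} = {}" using SK S_def by blast
          have "card {v \<in> K. v \<in> f j} < 1" unfolding e by simp
          then show "\<exists>i\<in>{..<N}. card {v \<in> K. v \<in> f i} < 1" using j(1) by blast
        qed simp
        finally show False by simp
      qed
      then obtain h where h: "weighted_cover V E w2 M h" using less.hyps[OF s2] by blast
      have "weighted_cover V E w (Suc M) (h(M := S))"
      proof (rule weighted_cover_add[OF h])
        show "S \<subseteq> V" "indep S E" using fi[OF j(1)] S_def by auto
        show "w v = (if v \<in> S then Suc (w2 v) else w2 v)" for v
          using pos[of v] x j S_def by (auto simp: w2_def w1_def)
      qed
      then show ?thesis using M by blast
    qed
  qed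
qed

lemma floor_quotient_tendsto:
  fixes a :: real assumes "0 \<le> a"
  shows "(\<lambda>n. real (nat \<lfloor>real (Suc n) * a\<rfloor>) / real (Suc n)) \<longlonglongrightarrow> a"
proof (rule tendsto_sandwich)
  have b: "real (Suc n) * a - 1 \<le> real (nat \<lfloor>real (Suc n) * a\<rfloor>) \<and>
      real (nat \<lfloor>real (Suc n) * a\<rfloor>) \<le> real (Suc n) * a" for n
  proof -
    have "0 \<le> real (Suc n) * a" using assms by simp
    then have "real (nat \<lfloor>real (Suc n) * a\<rfloor>) = of_int \<lfloor>real (Suc n) * a\<rfloor>" by simp
    then show ?thesis using real_of_int_floor_add_one_ge[of "real (Suc n) * a"]
      of_int_floor_le[of "real (Suc n) * a"] by linarith
  qed
  have "a - inverse (real (Suc n)) \<le> real (nat \<lfloor>real (Suc n) * a\<rfloor>) / real (Suc n)" for n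
  proof -
    have "(a - inverse (real (Suc n))) * real (Suc n) = real (Suc n) * a - 1"
      by (simp add: left_diff_distrib)
    then show ?thesis using b[of n] by (subst pos_le_divide_eq) auto
  qed
  then show "\<forall>\<^sub>F n in sequentially. a - inverse (real (Suc n)) \<le> real (nat \<lfloor>real (Suc n) * a\<rfloor>) / real (Suc n)"
    by (rule always_eventually[OF allI])
  have "real (nat \<lfloor>real (Suc n) * a\<rfloor>) / real (Suc n) \<le> a" for n
    using b[of n] by (subst pos_divide_le_eq) (auto simp: mult.commute)
  then show "\<forall>\<^sub>F n in sequentially. real (nat \<lfloor>real (Suc n) * a\<rfloor>) / real (Suc n) \<le> a"
    by (rule always_eventually[OF allI])
  show "(\<lambda>n. a - inverse (real (Suc n))) \<longlonglongrightarrow> a"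
    using tendsto_diff[OF tendsto_const[of a] LIMSEQ_inverse_real_of_nat] by simp
qed simp

text \<open>Rounding (n + 1)x down keeps all clique weights at most n + 1, so n + 1 stable sets
  realise the rounded weights, and their average tends to x. The hull of the finitely many stable
  sets is closed, so it is the whole polytope and its extreme points are 0-1 vectors.\<close>

lemma perfect_imp_h_perfect:
  fixes V :: "'v::finite set"
  assumes g: "simple_graph V E" and p: "perfect V E"
  shows "h_perfect V E"
proof -
  let ?P = "h_polytope V E"
  define I where "I = ind_vec ` {S. S \<subseteq> V \<and> indep S E}"
  have IP: "convex hull I \<subseteq> ?P"
    by (rule hull_minimal) (use ind_vec_in_h_polytope[OF g] h_polytope_convex in \<open>auto simp: I_def\<close>)
  have cl: "closed (convex hull I)"
    unfolding I_def by (intro compact_imp_closed compact_convex_hull finite_imp_compact) simp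
  have PI: "x \<in> convex hull I" if x: "x \<in> ?P" for x
  proof -
    define w where "w n v = nat \<lfloor>real (Suc n) * x $ v\<rfloor>" for n v
    have "\<exists>f. weighted_cover V E (w n) (Suc n) f" for n
    proof (rule perfect_weighted_cover[OF g p])
      fix K assume K: "K \<subseteq> V" "clique K E"
      have "real (sum (w n) K) \<le> (\<Sum>v\<in>K. real (Suc n) * x $ v)"
        unfolding of_nat_sum
      proof (rule sum_mono)
        fix v assume "v \<in> K"
        then have "0 \<le> real (Suc n) * x $ v" using h_polytope_le_1(1)[OF x] K by (intro mult_nonneg_nonneg) auto
        then show "real (w n v) \<le> real (Suc n) * x $ v" unfolding w_def by (simp only: of_nat_nat zero_le_floor of_int_floor_le)
      qed
      also have "\<dots> = real (Suc n) * (\<Sum>v\<in>K. x $ v)" by (rule sum_distrib_left[symmetric])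
      also have "\<dots> \<le> real (Suc n) * 1" using h_polytope_clique[OF x K] by (intro mult_left_mono) auto
      finally show "sum (w n) K \<le> Suc n" unfolding mult_1_right of_nat_le_iff .
    qed
    then obtain f where f: "\<And>n. weighted_cover V E (w n) (Suc n) (f n)" by metis
    define y where "y n = (\<Sum>i<Suc n. (1 / real (Suc n)) *\<^sub>R ind_vec (f n i))" for n
    have "y n \<in> convex hull I" for n
      unfolding y_def
    proof (rule convex_sum)
      show "(\<Sum>i<Suc n. 1 / real (Suc n)) = 1" by simp
      show "ind_vec (f n i) \<in> convex hull I" if "i \<in> {..<Suc n}" for i
      proof (rule hull_inc)
        have "f n i \<subseteq> V \<and> indep (f n i) E" using f[of n] that unfolding weighted_cover_def by blast
        then show "ind_vec (f n i) \<in> I" by (auto simp: I_def)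
      qed
    qed (auto intro: convex_convex_hull)
    moreover have "y \<longlonglongrightarrow> x"
    proof (rule vec_tendstoI)
      fix v
      show "(\<lambda>n. y n $ v) \<longlonglongrightarrow> x $ v"
      proof (cases "v \<in> V")
        case True
        have "y n $ v = real (nat \<lfloor>real (Suc n) * x $ v\<rfloor>) / real (Suc n)" for n
        proof -
          have "y n $ v = (\<Sum>i<Suc n. if v \<in> f n i then 1 / real (Suc n) else 0)"
            unfolding y_def sum_component by (intro sum.cong) (auto simp: ind_vec_def)
          also have "\<dots> = (\<Sum>i\<in>{i. i < Suc n \<and> v \<in> f n i}. 1 / real (Suc n))"
            by (rule sum.mono_neutral_cong_right) auto
          also have "\<dots> = real (w n v) / real (Suc n)"
            using f[of n] True unfolding weighted_cover_def by simp
          finally show ?thesis by (simp only: w_def)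
        qed
        then show ?thesis using floor_quotient_tendsto[OF h_polytope_le_1(1)[OF x True]] by simp
      next
        case False
        have "y n $ v = 0" for n
        proof -
          have "v \<notin> f n i" if "i < Suc n" for i
            using f[of n] that False unfolding weighted_cover_def by blast
          then show ?thesis unfolding y_def sum_component by (intro sum.neutral) (auto simp: ind_vec_def)
        qed
        then show ?thesis using h_polytope_outside[OF x False] by simp
      qed
    qed
    ultimately show ?thesis using cl closed_sequentially by blast
  qed
  show ?thesis
    unfolding h_perfect_def integral_polytope_def
  proof (intro allI impI)
    fix x v assume x: "x extreme_point_of ?P"
    then have "x extreme_point_of (convex hull I)"
      using IP PI unfolding extreme_point_of_def by blast
    then have "x \<in> I" by (rule extreme_point_of_convex_hull)
    then show "x $ v \<in> \<int>" by (auto simp: I_def ind_vec_def)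
  qed
qed

theorem theorem1:
  fixes V :: "'v::finite set" and E :: "'v set set"
    and p :: "'v \<Rightarrow> complex" and \<gamma> :: "'v set \<Rightarrow> real \<Rightarrow> complex"
  assumes "plane_triangulation V E p \<gamma>"
  shows "h_perfect V E \<longleftrightarrow> perfect V E"
proof
  assume hp: "h_perfect V E"
  interpret h_perfect_triang V E p \<gamma>
    by unfold_locales (use assms hp in \<open>auto simp: plane_triangulation_def\<close>)
  show "perfect V E" by (rule h_perfect_imp_perfect)
next
  assume "perfect V E"
  then show "h_perfect V E"
    using assms perfect_imp_h_perfect unfolding plane_triangulation_def by blast
qed

end
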